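(* Let $\mathcal C$ be an exact stably 2-Calabi–Yau category, and $\mathcal B$ a functorially finite extension closed subcategory of $\mathcal C$. Then $\mathcal B$ (with the exact structure inherited from $\mathcal C$) has enough projectives and enough injectives, and $\mathcal B$ is a stably 2-Calabi–Yau category.
   Context: All categories are Krull–Schmidt $k$-categories over an algebraically closed field $k$; subcategories are full and closed under isomorphisms, finite direct sums and direct summands. An exact category $\mathcal C$ is stably 2-Calabi–Yau if it is Frobenius (it has enough projectives and enough injectives, and these coincide) and its triangulated stable category $\underline{\mathcal C}$ is $\operatorname{Hom}$-finite and 2-Calabi–Yau, i.e. there are functorial isomorphisms $D\operatorname{Ext}^1(A,B)\simeq\operatorname{Ext}^1(B,A)$, where $D=\operatorname{Hom}_k(-,k)$ and $\operatorname{Ext}^1(A,B)=\operatorname{Hom}_{\underline{\mathcal C}}(A,B[1])$. *)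

theory Defs
  imports "HOL-Algebra.Algebra"
begin

text \<open>Frees \<open>X\<close>, which denotes an object here and the polynomial variable in the library.\<close>

no_notation Polynomials.var (\<open>X\<index>\<close>)

section \<open>Categories over a field\<close>

text \<open>
  Each morphism space is a module record over the ground field; its ring multiplication and
  its unit carry no meaning. Morphism spaces between different pairs of objects are disjoint
  (see below), so composition, written in the usual order, needs no object arguments.
\<close>

record ('k, 'o, 'm) k_cat =
  Obj :: "'o set"
  Hom :: "'o \<Rightarrow> 'o \<Rightarrow> ('k, 'm) module"
  ident :: "'o \<Rightarrow> 'm"
  Comp :: "'m \<Rightarrow> 'm \<Rightarrow> 'm"  (infixr \<open>\<cdot>\<index>\<close> 75)

abbreviation arr :: "('k, 'o, 'm) k_cat \<Rightarrow> 'o \<Rightarrow> 'o \<Rightarrow> 'm set" where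
  "arr C X Y \<equiv> carrier (Hom C X Y)"

locale k_category = field K for K :: "('k, 'x) ring_scheme" (structure) +
  fixes C :: "('k, 'o, 'm) k_cat"
  assumes hom_module: "\<lbrakk>X \<in> Obj C; Y \<in> Obj C\<rbrakk> \<Longrightarrow> module K (Hom C X Y)"
    and hom_disjoint:
      "\<lbrakk>X \<in> Obj C; Y \<in> Obj C; X' \<in> Obj C; Y' \<in> Obj C; f \<in> arr C X Y; f \<in> arr C X' Y'\<rbrakk>
        \<Longrightarrow> X = X' \<and> Y = Y'"
    and ident_closed: "X \<in> Obj C \<Longrightarrow> ident C X \<in> arr C X X"
    and comp_closed:
      "\<lbrakk>X \<in> Obj C; Y \<in> Obj C; Z \<in> Obj C; f \<in> arr C X Y; g \<in> arr C Y Z\<rbrakk>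
        \<Longrightarrow> g \<cdot>\<^bsub>C\<^esub> f \<in> arr C X Z"
    and comp_assoc:
      "\<lbrakk>W \<in> Obj C; X \<in> Obj C; Y \<in> Obj C; Z \<in> Obj C;
        f \<in> arr C W X; g \<in> arr C X Y; h \<in> arr C Y Z\<rbrakk>
        \<Longrightarrow> (h \<cdot>\<^bsub>C\<^esub> g) \<cdot>\<^bsub>C\<^esub> f = h \<cdot>\<^bsub>C\<^esub> (g \<cdot>\<^bsub>C\<^esub> f)"
    and ident_left:
      "\<lbrakk>X \<in> Obj C; Y \<in> Obj C; f \<in> arr C X Y\<rbrakk> \<Longrightarrow> ident C Y \<cdot>\<^bsub>C\<^esub> f = f"
    and ident_right:
      "\<lbrakk>X \<in> Obj C; Y \<in> Obj C; f \<in> arr C X Y\<rbrakk> \<Longrightarrow> f \<cdot>\<^bsub>C\<^esub> ident C X = f"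
    and comp_add_left:
      "\<lbrakk>X \<in> Obj C; Y \<in> Obj C; Z \<in> Obj C; f \<in> arr C X Y; g \<in> arr C Y Z; h \<in> arr C Y Z\<rbrakk>
        \<Longrightarrow> (g \<oplus>\<^bsub>Hom C Y Z\<^esub> h) \<cdot>\<^bsub>C\<^esub> f = (g \<cdot>\<^bsub>C\<^esub> f) \<oplus>\<^bsub>Hom C X Z\<^esub> (h \<cdot>\<^bsub>C\<^esub> f)"
    and comp_add_right:
      "\<lbrakk>X \<in> Obj C; Y \<in> Obj C; Z \<in> Obj C; f \<in> arr C X Y; g \<in> arr C X Y; h \<in> arr C Y Z\<rbrakk>
        \<Longrightarrow> h \<cdot>\<^bsub>C\<^esub> (f \<oplus>\<^bsub>Hom C X Y\<^esub> g) = (h \<cdot>\<^bsub>C\<^esub> f) \<oplus>\<^bsub>Hom C X Z\<^esub> (h \<cdot>\<^bsub>C\<^esub> g)"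
    and comp_smult_left:
      "\<lbrakk>X \<in> Obj C; Y \<in> Obj C; Z \<in> Obj C; f \<in> arr C X Y; g \<in> arr C Y Z; c \<in> carrier K\<rbrakk>
        \<Longrightarrow> (c \<odot>\<^bsub>Hom C Y Z\<^esub> g) \<cdot>\<^bsub>C\<^esub> f = c \<odot>\<^bsub>Hom C X Z\<^esub> (g \<cdot>\<^bsub>C\<^esub> f)"
    and comp_smult_right:
      "\<lbrakk>X \<in> Obj C; Y \<in> Obj C; Z \<in> Obj C; f \<in> arr C X Y; g \<in> arr C Y Z; c \<in> carrier K\<rbrakk>
        \<Longrightarrow> g \<cdot>\<^bsub>C\<^esub> (c \<odot>\<^bsub>Hom C X Y\<^esub> f) = c \<odot>\<^bsub>Hom C X Z\<^esub> (g \<cdot>\<^bsub>C\<^esub> f)"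

definition iso_arr :: "('k, 'o, 'm) k_cat \<Rightarrow> 'o \<Rightarrow> 'o \<Rightarrow> 'm \<Rightarrow> bool" where
  "iso_arr C X Y f \<longleftrightarrow> f \<in> arr C X Y \<and>
     (\<exists>g\<in>arr C Y X. g \<cdot>\<^bsub>C\<^esub> f = ident C X \<and> f \<cdot>\<^bsub>C\<^esub> g = ident C Y)"

definition direct_sum ::
  "('k, 'o, 'm) k_cat \<Rightarrow> 'i set \<Rightarrow> ('i \<Rightarrow> 'o) \<Rightarrow> 'o \<Rightarrow> bool" where
  "direct_sum C I X S \<longleftrightarrow> finite I \<and> S \<in> Obj C \<and> (\<forall>a\<in>I. X a \<in> Obj C) \<and>
     (\<exists>i p. (\<forall>a\<in>I. i a \<in> arr C (X a) S \<and> p a \<in> arr C S (X a)) \<and>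
        (\<forall>a\<in>I. p a \<cdot>\<^bsub>C\<^esub> i a = ident C (X a)) \<and>
        (\<forall>a\<in>I. \<forall>b\<in>I. a \<noteq> b \<longrightarrow> p b \<cdot>\<^bsub>C\<^esub> i a = \<zero>\<^bsub>Hom C (X a) (X b)\<^esub>) \<and>
        (\<Oplus>\<^bsub>Hom C S S\<^esub>a\<in>I. i a \<cdot>\<^bsub>C\<^esub> p a) = ident C S)"

text \<open>The empty family gives a zero object.\<close>

locale additive_category = k_category +
  assumes ex_direct_sum:
    "\<lbrakk>finite (I :: nat set); \<forall>a\<in>I. X a \<in> Obj C\<rbrakk> \<Longrightarrow> \<exists>S. direct_sum C I X S"

definition End_ring :: "('k, 'o, 'm) k_cat \<Rightarrow> 'o \<Rightarrow> 'm ring" where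
  "End_ring C X = \<lparr>carrier = arr C X X, monoid.mult = Comp C, one = ident C X,
     ring.zero = \<zero>\<^bsub>Hom C X X\<^esub>, add = add (Hom C X X)\<rparr>"

definition local_ring :: "('a, 'b) ring_scheme \<Rightarrow> bool" where
  "local_ring R \<longleftrightarrow> ring R \<and> \<one>\<^bsub>R\<^esub> \<noteq> \<zero>\<^bsub>R\<^esub> \<and>
     (\<forall>x\<in>carrier R - Units R. \<forall>y\<in>carrier R - Units R. x \<oplus>\<^bsub>R\<^esub> y \<notin> Units R)"

locale krull_schmidt_category = additive_category +
  assumes krull_schmidt:
    "S \<in> Obj C \<Longrightarrow>
       \<exists>(I :: nat set) X. direct_sum C I X S \<and> (\<forall>a\<in>I. local_ring (End_ring C (X a)))"

section \<open>Exact categories\<close>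

definition is_kernel ::
  "('k, 'o, 'm) k_cat \<Rightarrow> 'o \<Rightarrow> 'o \<Rightarrow> 'o \<Rightarrow> 'm \<Rightarrow> 'm \<Rightarrow> bool" where
  "is_kernel C X Y Z i p \<longleftrightarrow> i \<in> arr C X Y \<and> p \<in> arr C Y Z \<and> p \<cdot>\<^bsub>C\<^esub> i = \<zero>\<^bsub>Hom C X Z\<^esub> \<and>
     (\<forall>W\<in>Obj C. \<forall>f\<in>arr C W Y. p \<cdot>\<^bsub>C\<^esub> f = \<zero>\<^bsub>Hom C W Z\<^esub> \<longrightarrow>
        (\<exists>!g. g \<in> arr C W X \<and> i \<cdot>\<^bsub>C\<^esub> g = f))"

definition is_cokernel ::
  "('k, 'o, 'm) k_cat \<Rightarrow> 'o \<Rightarrow> 'o \<Rightarrow> 'o \<Rightarrow> 'm \<Rightarrow> 'm \<Rightarrow> bool" where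
  "is_cokernel C X Y Z i p \<longleftrightarrow> i \<in> arr C X Y \<and> p \<in> arr C Y Z \<and> p \<cdot>\<^bsub>C\<^esub> i = \<zero>\<^bsub>Hom C X Z\<^esub> \<and>
     (\<forall>W\<in>Obj C. \<forall>f\<in>arr C Y W. f \<cdot>\<^bsub>C\<^esub> i = \<zero>\<^bsub>Hom C X W\<^esub> \<longrightarrow>
        (\<exists>!g. g \<in> arr C Z W \<and> g \<cdot>\<^bsub>C\<^esub> p = f))"

text \<open>The square \<open>i' \<circ> f = f' \<circ> i\<close> with \<open>f : X \<rightarrow> X'\<close>, \<open>i : X \<rightarrow> Y\<close>, \<open>i' : X' \<rightarrow> Y'\<close>, \<open>f' : Y \<rightarrow> Y'\<close>.\<close>

definition is_pushout ::
  "('k, 'o, 'm) k_cat \<Rightarrow> 'o \<Rightarrow> 'o \<Rightarrow> 'o \<Rightarrow> 'o \<Rightarrow> 'm \<Rightarrow> 'm \<Rightarrow> 'm \<Rightarrow> 'm \<Rightarrow> bool" where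
  "is_pushout C X Y X' Y' i f i' f' \<longleftrightarrow>
     i \<in> arr C X Y \<and> f \<in> arr C X X' \<and> i' \<in> arr C X' Y' \<and> f' \<in> arr C Y Y' \<and>
     i' \<cdot>\<^bsub>C\<^esub> f = f' \<cdot>\<^bsub>C\<^esub> i \<and>
     (\<forall>W\<in>Obj C. \<forall>u\<in>arr C X' W. \<forall>v\<in>arr C Y W. u \<cdot>\<^bsub>C\<^esub> f = v \<cdot>\<^bsub>C\<^esub> i \<longrightarrow>
        (\<exists>!w. w \<in> arr C Y' W \<and> w \<cdot>\<^bsub>C\<^esub> i' = u \<and> w \<cdot>\<^bsub>C\<^esub> f' = v))"

text \<open>The square \<open>f \<circ> p' = p \<circ> f'\<close> with \<open>f : Z' \<rightarrow> Z\<close>, \<open>p : Y \<rightarrow> Z\<close>, \<open>p' : Y' \<rightarrow> Z'\<close>, \<open>f' : Y' \<rightarrow> Y\<close>.\<close>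

definition is_pullback ::
  "('k, 'o, 'm) k_cat \<Rightarrow> 'o \<Rightarrow> 'o \<Rightarrow> 'o \<Rightarrow> 'o \<Rightarrow> 'm \<Rightarrow> 'm \<Rightarrow> 'm \<Rightarrow> 'm \<Rightarrow> bool" where
  "is_pullback C Y Z Y' Z' p f p' f' \<longleftrightarrow>
     p \<in> arr C Y Z \<and> f \<in> arr C Z' Z \<and> p' \<in> arr C Y' Z' \<and> f' \<in> arr C Y' Y \<and>
     f \<cdot>\<^bsub>C\<^esub> p' = p \<cdot>\<^bsub>C\<^esub> f' \<and>
     (\<forall>W\<in>Obj C. \<forall>u\<in>arr C W Z'. \<forall>v\<in>arr C W Y. f \<cdot>\<^bsub>C\<^esub> u = p \<cdot>\<^bsub>C\<^esub> v \<longrightarrow>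
        (\<exists>!w. w \<in> arr C W Y' \<and> p' \<cdot>\<^bsub>C\<^esub> w = u \<and> f' \<cdot>\<^bsub>C\<^esub> w = v))"

text \<open>
  \<open>(X, i, Y, p, Z)\<close> stands for the sequence \<open>X \<rightarrow> Y \<rightarrow> Z\<close> with maps \<open>i\<close> and \<open>p\<close>. An exact
  structure is the set of its admissible short exact sequences (conflations).
\<close>

type_synonym ('o, 'm) exact_str = "('o \<times> 'm \<times> 'o \<times> 'm \<times> 'o) set"

definition inflation :: "('o, 'm) exact_str \<Rightarrow> 'o \<Rightarrow> 'o \<Rightarrow> 'm \<Rightarrow> bool" where
  "inflation E X Y i \<longleftrightarrow> (\<exists>p Z. (X, i, Y, p, Z) \<in> E)"

definition deflation :: "('o, 'm) exact_str \<Rightarrow> 'o \<Rightarrow> 'o \<Rightarrow> 'm \<Rightarrow> bool" where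
  "deflation E Y Z p \<longleftrightarrow> (\<exists>X i. (X, i, Y, p, Z) \<in> E)"

text \<open>Quillen's axioms, in the self-dual formulation of Keller and Buehler.\<close>

locale exact_category = additive_category +
  fixes E :: "('o, 'm) exact_str"
  assumes conflation:
      "(X, i, Y, p, Z) \<in> E \<Longrightarrow>
         X \<in> Obj C \<and> Y \<in> Obj C \<and> Z \<in> Obj C \<and> is_kernel C X Y Z i p \<and> is_cokernel C X Y Z i p"
    and conflation_iso:
      "\<lbrakk>(X, i, Y, p, Z) \<in> E; X' \<in> Obj C; Y' \<in> Obj C; Z' \<in> Obj C;
        i' \<in> arr C X' Y'; p' \<in> arr C Y' Z';
        iso_arr C X X' a; iso_arr C Y Y' b; iso_arr C Z Z' c;
        b \<cdot>\<^bsub>C\<^esub> i = i' \<cdot>\<^bsub>C\<^esub> a; c \<cdot>\<^bsub>C\<^esub> p = p' \<cdot>\<^bsub>C\<^esub> b\<rbrakk>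
        \<Longrightarrow> (X', i', Y', p', Z') \<in> E"
    and inflation_ident: "X \<in> Obj C \<Longrightarrow> inflation E X X (ident C X)"
    and deflation_ident: "X \<in> Obj C \<Longrightarrow> deflation E X X (ident C X)"
    and inflation_comp:
      "\<lbrakk>inflation E X Y i; inflation E Y Z j\<rbrakk> \<Longrightarrow> inflation E X Z (j \<cdot>\<^bsub>C\<^esub> i)"
    and deflation_comp:
      "\<lbrakk>deflation E X Y p; deflation E Y Z q\<rbrakk> \<Longrightarrow> deflation E X Z (q \<cdot>\<^bsub>C\<^esub> p)"
    and inflation_pushout:
      "\<lbrakk>inflation E X Y i; X' \<in> Obj C; f \<in> arr C X X'\<rbrakk> \<Longrightarrow>
         \<exists>Y'\<in>Obj C. \<exists>i' f'. is_pushout C X Y X' Y' i f i' f' \<and> inflation E X' Y' i'"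
    and deflation_pullback:
      "\<lbrakk>deflation E Y Z p; Z' \<in> Obj C; f \<in> arr C Z' Z\<rbrakk> \<Longrightarrow>
         \<exists>Y'\<in>Obj C. \<exists>p' f'. is_pullback C Y Z Y' Z' p f p' f' \<and> deflation E Y' Z' p'"

definition projective :: "('k, 'o, 'm) k_cat \<Rightarrow> ('o, 'm) exact_str \<Rightarrow> 'o \<Rightarrow> bool" where
  "projective C E P \<longleftrightarrow> P \<in> Obj C \<and>
     (\<forall>Y Z p f. deflation E Y Z p \<and> f \<in> arr C P Z \<longrightarrow> (\<exists>g\<in>arr C P Y. p \<cdot>\<^bsub>C\<^esub> g = f))"

definition injective :: "('k, 'o, 'm) k_cat \<Rightarrow> ('o, 'm) exact_str \<Rightarrow> 'o \<Rightarrow> bool" where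
  "injective C E Q \<longleftrightarrow> Q \<in> Obj C \<and>
     (\<forall>X Y i f. inflation E X Y i \<and> f \<in> arr C X Q \<longrightarrow> (\<exists>g\<in>arr C Y Q. g \<cdot>\<^bsub>C\<^esub> i = f))"

definition enough_projectives :: "('k, 'o, 'm) k_cat \<Rightarrow> ('o, 'm) exact_str \<Rightarrow> bool" where
  "enough_projectives C E \<longleftrightarrow> (\<forall>X\<in>Obj C. \<exists>P p. projective C E P \<and> deflation E P X p)"

definition enough_injectives :: "('k, 'o, 'm) k_cat \<Rightarrow> ('o, 'm) exact_str \<Rightarrow> bool" where
  "enough_injectives C E \<longleftrightarrow> (\<forall>X\<in>Obj C. \<exists>Q i. injective C E Q \<and> inflation E X Q i)"

locale frobenius_category = exact_category +
  assumes enough_proj: "enough_projectives C E"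
    and enough_inj: "enough_injectives C E"
    and proj_iff_inj: "projective C E P \<longleftrightarrow> injective C E P"

section \<open>The stable category and its shift\<close>

definition proj_maps ::
  "('k, 'o, 'm) k_cat \<Rightarrow> ('o, 'm) exact_str \<Rightarrow> 'o \<Rightarrow> 'o \<Rightarrow> 'm set" where
  "proj_maps C E X Y = {h \<cdot>\<^bsub>C\<^esub> g | P g h. projective C E P \<and> g \<in> arr C X P \<and> h \<in> arr C P Y}"

definition quotient_module :: "('k, 'm) module \<Rightarrow> 'm set \<Rightarrow> ('k, 'm set) module" where
  "quotient_module M N =
     \<lparr>carrier = a_rcosets\<^bsub>M\<^esub> N, monoid.mult = undefined, one = undefined,
      ring.zero = N, add = (\<lambda>U V. U <+>\<^bsub>M\<^esub> V),
      smult = (\<lambda>c U. \<Union>x\<in>U. N +>\<^bsub>M\<^esub> (c \<odot>\<^bsub>M\<^esub> x))\<rparr>"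

definition stable_class :: "('k, 'o, 'm) k_cat \<Rightarrow> ('o, 'm) exact_str \<Rightarrow> 'o \<Rightarrow> 'o \<Rightarrow> 'm \<Rightarrow> 'm set" where
  "stable_class C E X Y f = proj_maps C E X Y +>\<^bsub>Hom C X Y\<^esub> f"

text \<open>
  Operations on classes are unions over all representatives; over a Frobenius category these
  unions consist of one single class each.
\<close>

definition stable_cat :: "('k, 'o, 'm) k_cat \<Rightarrow> ('o, 'm) exact_str \<Rightarrow> ('k, 'o, 'm set) k_cat" where
  "stable_cat C E =
     \<lparr>Obj = Obj C,
      Hom = (\<lambda>X Y. quotient_module (Hom C X Y) (proj_maps C E X Y)),
      ident = (\<lambda>X. stable_class C E X X (ident C X)),
      Comp = (\<lambda>V U. \<Union>{stable_class C E X Z (g \<cdot>\<^bsub>C\<^esub> f) | X Y Z f g.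
                X \<in> Obj C \<and> Y \<in> Obj C \<and> Z \<in> Obj C \<and>
                f \<in> U \<and> f \<in> arr C X Y \<and> g \<in> V \<and> g \<in> arr C Y Z})\<rparr>"

text \<open>
  Shift of the stable category of a Frobenius category: for every object \<open>X\<close> a conflation
  \<open>X \<rightarrow> I \<rightarrow> X[1]\<close> with \<open>I\<close> injective is fixed. Another choice gives a naturally isomorphic shift.
  A map \<open>f : X \<rightarrow> Y\<close> extends to a map of conflations, and \<open>f[1]\<close> is the class of the map induced
  on the third terms.
\<close>

definition inj_conflation ::
  "('k, 'o, 'm) k_cat \<Rightarrow> ('o, 'm) exact_str \<Rightarrow> 'o \<Rightarrow> 'm \<times> 'o \<times> 'm \<times> 'o" where
  "inj_conflation C E X = (SOME (i, I, p, T). injective C E I \<and> (X, i, I, p, T) \<in> E)"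

definition shift_obj :: "('k, 'o, 'm) k_cat \<Rightarrow> ('o, 'm) exact_str \<Rightarrow> 'o \<Rightarrow> 'o" where
  "shift_obj C E X = (case inj_conflation C E X of (i, I, p, T) \<Rightarrow> T)"

definition shift_arr ::
  "('k, 'o, 'm) k_cat \<Rightarrow> ('o, 'm) exact_str \<Rightarrow> 'o \<Rightarrow> 'o \<Rightarrow> 'm set \<Rightarrow> 'm set" where
  "shift_arr C E X Y F =
     (case inj_conflation C E X of (i, I, p, T) \<Rightarrow>
      case inj_conflation C E Y of (j, J, q, S) \<Rightarrow>
        \<Union>{stable_class C E T S t | f u t.
            f \<in> F \<and> f \<in> arr C X Y \<and> u \<in> arr C I J \<and> t \<in> arr C T S \<and>
            u \<cdot>\<^bsub>C\<^esub> i = j \<cdot>\<^bsub>C\<^esub> f \<and> t \<cdot>\<^bsub>C\<^esub> p = q \<cdot>\<^bsub>C\<^esub> u})"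

definition Ext1 ::
  "('k, 'o, 'm) k_cat \<Rightarrow> ('o, 'm) exact_str \<Rightarrow> 'o \<Rightarrow> 'o \<Rightarrow> ('k, 'm set) module" where
  "Ext1 C E A B = Hom (stable_cat C E) A (shift_obj C E B)"

text \<open>
  The map \<open>Ext1(A, B) \<rightarrow> Ext1(A', B')\<close> induced by stable maps \<open>a : A' \<rightarrow> A\<close> and \<open>b : B \<rightarrow> B'\<close>.
\<close>

definition Ext1_map ::
  "('k, 'o, 'm) k_cat \<Rightarrow> ('o, 'm) exact_str \<Rightarrow> 'o \<Rightarrow> 'o \<Rightarrow> 'm set \<Rightarrow> 'm set \<Rightarrow> 'm set \<Rightarrow> 'm set" where
  "Ext1_map C E B B' a b \<xi> =
     shift_arr C E B B' b \<cdot>\<^bsub>stable_cat C E\<^esub> \<xi> \<cdot>\<^bsub>stable_cat C E\<^esub> a"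

section \<open>Stably 2-Calabi--Yau categories\<close>

definition finite_dim :: "('k, 'x) ring_scheme \<Rightarrow> ('k, 'v) module \<Rightarrow> bool" where
  "finite_dim K M \<longleftrightarrow>
     (\<exists>S. finite S \<and> S \<subseteq> carrier M \<and>
        carrier M = {\<Oplus>\<^bsub>M\<^esub>s\<in>S. c s \<odot>\<^bsub>M\<^esub> s | c. c \<in> S \<rightarrow> carrier K})"

definition hom_finite :: "('k, 'x) ring_scheme \<Rightarrow> ('k, 'o, 'm) k_cat \<Rightarrow> bool" where
  "hom_finite K C \<longleftrightarrow> (\<forall>X\<in>Obj C. \<forall>Y\<in>Obj C. finite_dim K (Hom C X Y))"

definition linear_iso ::
  "('k, 'x) ring_scheme \<Rightarrow> ('k, 'v) module \<Rightarrow> ('k, 'w) module \<Rightarrow> ('v \<Rightarrow> 'w) \<Rightarrow> bool" where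
  "linear_iso K M N \<phi> \<longleftrightarrow> bij_betw \<phi> (carrier M) (carrier N) \<and>
     (\<forall>x\<in>carrier M. \<forall>y\<in>carrier M. \<phi> (x \<oplus>\<^bsub>M\<^esub> y) = \<phi> x \<oplus>\<^bsub>N\<^esub> \<phi> y) \<and>
     (\<forall>c\<in>carrier K. \<forall>x\<in>carrier M. \<phi> (c \<odot>\<^bsub>M\<^esub> x) = c \<odot>\<^bsub>N\<^esub> \<phi> x)"

definition dual :: "('k, 'x) ring_scheme \<Rightarrow> ('k, 'v) module \<Rightarrow> ('k, 'v \<Rightarrow> 'k) module" where
  "dual K M =
     \<lparr>carrier = {\<phi> \<in> carrier M \<rightarrow>\<^sub>E carrier K.
        (\<forall>x\<in>carrier M. \<forall>y\<in>carrier M. \<phi> (x \<oplus>\<^bsub>M\<^esub> y) = \<phi> x \<oplus>\<^bsub>K\<^esub> \<phi> y) \<and>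
        (\<forall>c\<in>carrier K. \<forall>x\<in>carrier M. \<phi> (c \<odot>\<^bsub>M\<^esub> x) = c \<otimes>\<^bsub>K\<^esub> \<phi> x)},
      monoid.mult = undefined, one = undefined,
      ring.zero = (\<lambda>x\<in>carrier M. \<zero>\<^bsub>K\<^esub>),
      add = (\<lambda>\<phi> \<psi>. \<lambda>x\<in>carrier M. \<phi> x \<oplus>\<^bsub>K\<^esub> \<psi> x),
      smult = (\<lambda>c \<phi>. \<lambda>x\<in>carrier M. c \<otimes>\<^bsub>K\<^esub> \<phi> x)\<rparr>"

text \<open>
  The last condition is naturality in both variables: \<open>D Ext1(A, B)\<close> and \<open>Ext1(B, A)\<close> are both
  covariant in \<open>A\<close> and contravariant in \<open>B\<close>.
\<close>

definition two_calabi_yau ::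
  "('k, 'x) ring_scheme \<Rightarrow> ('k, 'o, 'm) k_cat \<Rightarrow> ('o, 'm) exact_str \<Rightarrow> bool" where
  "two_calabi_yau K C E \<longleftrightarrow>
     (\<exists>\<Phi> :: 'o \<Rightarrow> 'o \<Rightarrow> ('m set \<Rightarrow> 'k) \<Rightarrow> 'm set.
        (\<forall>A\<in>Obj C. \<forall>B\<in>Obj C. linear_iso K (dual K (Ext1 C E A B)) (Ext1 C E B A) (\<Phi> A B)) \<and>
        (\<forall>A\<in>Obj C. \<forall>A'\<in>Obj C. \<forall>B\<in>Obj C. \<forall>B'\<in>Obj C.
           \<forall>a\<in>arr (stable_cat C E) A A'. \<forall>b\<in>arr (stable_cat C E) B' B.
           \<forall>\<phi>\<in>carrier (dual K (Ext1 C E A B)).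
             \<Phi> A' B' (\<lambda>\<xi>\<in>carrier (Ext1 C E A' B'). \<phi> (Ext1_map C E B' B a b \<xi>))
             = Ext1_map C E A A' b a (\<Phi> A B \<phi>)))"

locale stably_2CY_category = krull_schmidt_category + frobenius_category +
  assumes stable_hom_finite: "hom_finite K (stable_cat C E)"
    and stable_2CY: "two_calabi_yau K C E"

section \<open>Subcategories\<close>

text \<open>A full subcategory is given by its set of objects.\<close>

definition full_subcat :: "('k, 'o, 'm) k_cat \<Rightarrow> 'o set \<Rightarrow> ('k, 'o, 'm) k_cat" where
  "full_subcat C B = C\<lparr>Obj := B\<rparr>"

definition inherited_exact :: "('o, 'm) exact_str \<Rightarrow> 'o set \<Rightarrow> ('o, 'm) exact_str" where
  "inherited_exact E B = {(X, i, Y, p, Z) \<in> E. X \<in> B \<and> Y \<in> B \<and> Z \<in> B}"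

definition subcategory :: "('k, 'o, 'm) k_cat \<Rightarrow> 'o set \<Rightarrow> bool" where
  "subcategory C B \<longleftrightarrow> B \<subseteq> Obj C \<and>
     (\<forall>X\<in>B. \<forall>Y\<in>Obj C. (\<exists>f. iso_arr C X Y f) \<longrightarrow> Y \<in> B) \<and>
     (\<forall>(I :: nat set) X S. direct_sum C I X S \<and> (\<forall>a\<in>I. X a \<in> B) \<longrightarrow> S \<in> B) \<and>
     (\<forall>(I :: nat set) X S. direct_sum C I X S \<and> S \<in> B \<longrightarrow> (\<forall>a\<in>I. X a \<in> B))"

definition contravariantly_finite :: "('k, 'o, 'm) k_cat \<Rightarrow> 'o set \<Rightarrow> bool" where
  "contravariantly_finite C B \<longleftrightarrow>
     (\<forall>X\<in>Obj C. \<exists>Y\<in>B. \<exists>f\<in>arr C Y X. \<forall>Y'\<in>B. \<forall>g\<in>arr C Y' X. \<exists>h\<in>arr C Y' Y. f \<cdot>\<^bsub>C\<^esub> h = g)"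

definition covariantly_finite :: "('k, 'o, 'm) k_cat \<Rightarrow> 'o set \<Rightarrow> bool" where
  "covariantly_finite C B \<longleftrightarrow>
     (\<forall>X\<in>Obj C. \<exists>Y\<in>B. \<exists>f\<in>arr C X Y. \<forall>Y'\<in>B. \<forall>g\<in>arr C X Y'. \<exists>h\<in>arr C Y Y'. h \<cdot>\<^bsub>C\<^esub> f = g)"

definition functorially_finite :: "('k, 'o, 'm) k_cat \<Rightarrow> 'o set \<Rightarrow> bool" where
  "functorially_finite C B \<longleftrightarrow> contravariantly_finite C B \<and> covariantly_finite C B"

definition extension_closed :: "('o, 'm) exact_str \<Rightarrow> 'o set \<Rightarrow> bool" where
  "extension_closed E B \<longleftrightarrow>
     (\<forall>(X, i, Y, p, Z)\<in>E. X \<in> B \<and> Z \<in> B \<longrightarrow> Y \<in> B)"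

end

(*
  A projective cover in the subcategory of an object Z is found by pushing out a projective
  presentation L \<rightarrow> P \<rightarrow> Z along a minimal left approximation L \<rightarrow> A; the pushout Q is
  projective by Wakamatsu's lemma. Injectives are dual. An object Q of the subcategory is
  relatively projective (injective) iff Ext1(Q, Y) = 0 (Ext1(Y, Q) = 0) in C for all Y in the
  subcategory, so the Calabi-Yau duality makes the two classes coincide. Finally Ext1 of the
  subcategory is naturally isomorphic to the restriction of Ext1 of C: the embedding of Y into an
  injective of the subcategory maps to the embedding into an injective of C, and every extension
  in C of objects of the subcategory stays in it. The duality is transported along this
  isomorphism. Maps that factor through a projective of C factor through one of the subcategory,
  so stable morphism spaces can only shrink.
*)

theory Submission
  imports Defs
begin

text \<open>Two obstacles shape the argument. A lift of the approximation into an extension gives an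
  endomorphism \<open>p' m\<close> of \<open>A\<close> with \<open>p' m f = f\<close>, and a
  splitting results only if this endomorphism can be inverted over \<open>f\<close>. That is what
  minimality provides, and the Krull-Schmidt property is where minimality comes from. The second
  obstacle is that the shift of \<open>Y\<close> depends on the ambient category: in the subcategory
  it is an object of \<open>B\<close>, in C it need not be, and a stable map of the subcategory does
  not determine a stable map of C. What the two categories share are the conflations. All
  comparisons therefore rest on one principle: a map from \<open>A\<close> into the shift of
  \<open>Y\<close> factors through the injective middle term exactly when the conflation pulled back
  along it splits, and the middle term of that pullback lies in \<open>B\<close> whenever
  \<open>A\<close> and \<open>Y\<close> do. Passing to the opposite category halves the work up to
  the existence of injectives, but not beyond: Ext1 is computed from injective conflations, which
  become projective ones there, so relative projectivity and relative injectivity need separate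
  criteria.\<close>

no_notation Ideal_Product.ideal_prod (infixl \<open>\<cdot>\<index>\<close> 80)

section \<open>Calculus of morphisms\<close>

context k_category
begin

text \<open>Disjointness of the morphism spaces makes source and target functions of the arrow
  alone. Typing conditions then become equations between objects, which the simplifier can discharge
  while it rewrites composites.\<close>

definition mor :: "'m \<Rightarrow> bool" where
  "mor f \<longleftrightarrow> (\<exists>X\<in>Obj C. \<exists>Y\<in>Obj C. f \<in> arr C X Y)"

definition src :: "'m \<Rightarrow> 'o" where
  "src f = (THE X. X \<in> Obj C \<and> (\<exists>Y\<in>Obj C. f \<in> arr C X Y))"

definition tgt :: "'m \<Rightarrow> 'o" where
  "tgt f = (THE Y. Y \<in> Obj C \<and> (\<exists>X\<in>Obj C. f \<in> arr C X Y))"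

text \<open>The morphism space is read off the first argument, so sums carry no object indices; the
  operation is meaningful for parallel arrows only.\<close>

definition plus :: "'m \<Rightarrow> 'm \<Rightarrow> 'm" (infixl \<open>\<boxplus>\<close> 65) where
  "f \<boxplus> g = f \<oplus>\<^bsub>Hom C (src f) (tgt f)\<^esub> g"

definition minus :: "'m \<Rightarrow> 'm \<Rightarrow> 'm" (infixl \<open>\<boxminus>\<close> 65) where
  "f \<boxminus> g = f \<ominus>\<^bsub>Hom C (src f) (tgt f)\<^esub> g"

abbreviation nul :: "'o \<Rightarrow> 'o \<Rightarrow> 'm" where
  "nul X Y \<equiv> \<zero>\<^bsub>Hom C X Y\<^esub>"

abbreviation compo :: "'m \<Rightarrow> 'm \<Rightarrow> 'm" (infixr \<open>\<star>\<close> 75) where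
  "g \<star> f \<equiv> g \<cdot>\<^bsub>C\<^esub> f"

abbreviation in_hom :: "'m \<Rightarrow> 'o \<Rightarrow> 'o \<Rightarrow> bool" (\<open>\<guillemotleft>_ : _ \<rightarrow> _\<guillemotright>\<close>) where
  "\<guillemotleft>f : X \<rightarrow> Y\<guillemotright> \<equiv> mor f \<and> src f = X \<and> tgt f = Y"

lemma src_eq: "\<lbrakk>X \<in> Obj C; Y \<in> Obj C; f \<in> arr C X Y\<rbrakk> \<Longrightarrow> src f = X"
  unfolding src_def by (rule the_equality) (use hom_disjoint in blast)+

lemma tgt_eq: "\<lbrakk>X \<in> Obj C; Y \<in> Obj C; f \<in> arr C X Y\<rbrakk> \<Longrightarrow> tgt f = Y"
  unfolding tgt_def by (rule the_equality) (use hom_disjoint in blast)+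

lemma mor_arr: "mor f \<Longrightarrow> f \<in> arr C (src f) (tgt f)"
  unfolding mor_def using src_eq tgt_eq by auto

lemma src_obj [simp]: "mor f \<Longrightarrow> src f \<in> Obj C"
  unfolding mor_def using src_eq by auto

lemma tgt_obj [simp]: "mor f \<Longrightarrow> tgt f \<in> Obj C"
  unfolding mor_def using tgt_eq by auto

lemma arr_iff: "\<lbrakk>X \<in> Obj C; Y \<in> Obj C\<rbrakk> \<Longrightarrow> f \<in> arr C X Y \<longleftrightarrow> \<guillemotleft>f : X \<rightarrow> Y\<guillemotright>"
  using mor_arr src_eq tgt_eq mor_def by blast

lemma homI: "\<lbrakk>X \<in> Obj C; Y \<in> Obj C; f \<in> arr C X Y\<rbrakk> \<Longrightarrow> \<guillemotleft>f : X \<rightarrow> Y\<guillemotright>"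
  using arr_iff by blast

lemma homD: "\<guillemotleft>f : X \<rightarrow> Y\<guillemotright> \<Longrightarrow> f \<in> arr C X Y \<and> X \<in> Obj C \<and> Y \<in> Obj C"
  using mor_arr by auto

lemma hom_abelian: "\<lbrakk>X \<in> Obj C; Y \<in> Obj C\<rbrakk> \<Longrightarrow> abelian_group (Hom C X Y)"
  using hom_module module.axioms(2) by blast

lemma comp_hom: "\<lbrakk>\<guillemotleft>f : X \<rightarrow> Y\<guillemotright>; \<guillemotleft>g : Y \<rightarrow> Z\<guillemotright>\<rbrakk> \<Longrightarrow> \<guillemotleft>g \<star> f : X \<rightarrow> Z\<guillemotright>"
  using comp_closed[of X Y Z f g] by (metis arr_iff homD)

lemma comp_simps [simp]:
  assumes "mor f" "mor g" "tgt f = src g"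
  shows "mor (g \<star> f)" "src (g \<star> f) = src f" "tgt (g \<star> f) = tgt g"
  using comp_hom[of f "src f" "src g" g "tgt g"] assms by auto

lemma comp_assoc' [simp]:
  "\<lbrakk>mor f; mor g; mor h; tgt f = src g; tgt g = src h\<rbrakk> \<Longrightarrow> (h \<star> g) \<star> f = h \<star> g \<star> f"
  using comp_assoc[of "src f" "src g" "src h" "tgt h" f g h] mor_arr[of f] mor_arr[of g] mor_arr[of h]
    src_obj[of f] src_obj[of g] src_obj[of h] tgt_obj[of h] by simp

text \<open>Composites are normalised to the right, which hides a known product
  \<open>g \<star> f\<close> inside \<open>g \<star> f \<star> e\<close>. This form lets an equation
  for the product be used there as a rewrite rule.\<close>

lemma comp_reassoc:
  "\<lbrakk>g \<star> f = k; mor e; mor f; mor g; tgt e = src f; tgt f = src g\<rbrakk> \<Longrightarrow> g \<star> f \<star> e = k \<star> e"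
  using comp_assoc' by metis

abbreviation idm :: "'o \<Rightarrow> 'm" where
  "idm X \<equiv> ident C X"

lemma ident_simps [simp]:
  assumes "X \<in> Obj C"
  shows "mor (idm X)" "src (idm X) = X" "tgt (idm X) = X"
  using ident_closed[OF assms] homI[OF assms assms] by auto

lemma comp_ident_left [simp]: "\<lbrakk>mor f; tgt f = Y\<rbrakk> \<Longrightarrow> idm Y \<star> f = f"
  using ident_left mor_arr by force

lemma comp_ident_right [simp]: "\<lbrakk>mor f; src f = X\<rbrakk> \<Longrightarrow> f \<star> idm X = f"
  using ident_right mor_arr by force

lemma nul_simps [simp]:
  assumes "X \<in> Obj C" "Y \<in> Obj C"
  shows "mor (nul X Y)" "src (nul X Y) = X" "tgt (nul X Y) = Y"
proof -
  interpret M: abelian_group "Hom C X Y" using assms by (rule hom_abelian)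
  show "mor (nul X Y)" "src (nul X Y) = X" "tgt (nul X Y) = Y"
    using homI[OF assms M.zero_closed] by auto
qed

lemma plus_hom:
  assumes "\<guillemotleft>f : X \<rightarrow> Y\<guillemotright>" "\<guillemotleft>g : X \<rightarrow> Y\<guillemotright>"
  shows "f \<oplus>\<^bsub>Hom C X Y\<^esub> g = f \<boxplus> g" "\<guillemotleft>f \<boxplus> g : X \<rightarrow> Y\<guillemotright>"
    "f \<ominus>\<^bsub>Hom C X Y\<^esub> g = f \<boxminus> g" "\<guillemotleft>f \<boxminus> g : X \<rightarrow> Y\<guillemotright>"
proof -
  have o: "X \<in> Obj C" "Y \<in> Obj C" "f \<in> arr C X Y" "g \<in> arr C X Y"
    using assms homD by blast+
  interpret M: abelian_group "Hom C X Y" using o by (simp add: hom_abelian)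
  show p: "f \<oplus>\<^bsub>Hom C X Y\<^esub> g = f \<boxplus> g" "f \<ominus>\<^bsub>Hom C X Y\<^esub> g = f \<boxminus> g"
    unfolding plus_def minus_def using assms by auto
  show "\<guillemotleft>f \<boxplus> g : X \<rightarrow> Y\<guillemotright>" "\<guillemotleft>f \<boxminus> g : X \<rightarrow> Y\<guillemotright>"
    unfolding p[symmetric] using o homI by simp_all
qed

lemma plus_simps [simp]:
  assumes "mor f" "mor g" "src f = src g" "tgt f = tgt g"
  shows "mor (f \<boxplus> g)" "src (f \<boxplus> g) = src g" "tgt (f \<boxplus> g) = tgt g"
    "mor (f \<boxminus> g)" "src (f \<boxminus> g) = src g" "tgt (f \<boxminus> g) = tgt g"
  using plus_hom[of f "src g" "tgt g" g] assms by auto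

lemma minus_eq_nul_iff:
  assumes "mor f" "mor g" "src f = src g" "tgt f = tgt g" "X = src g" "Y = tgt g"
  shows "f \<boxminus> g = nul X Y \<longleftrightarrow> f = g"
proof -
  interpret M: abelian_group "Hom C X Y" using assms by (simp add: hom_abelian)
  have "f \<in> arr C X Y" "g \<in> arr C X Y" using assms mor_arr[of f] mor_arr[of g] by auto
  then have "f \<ominus>\<^bsub>Hom C X Y\<^esub> g = \<zero>\<^bsub>Hom C X Y\<^esub> \<longleftrightarrow> f = g"
    by (metis M.a_inv_closed M.minus_eq M.minus_equality M.minus_minus M.r_neg)
  then show ?thesis using assms by (simp add: minus_def)
qed

lemma minus_self [simp]: "mor f \<Longrightarrow> f \<boxminus> f = nul (src f) (tgt f)"
  using minus_eq_nul_iff by simp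

lemma add_simps [simp]:
  assumes "mor f" "src f = X" "tgt f = Y"
  shows "f \<boxminus> nul X Y = f" "f \<boxplus> nul X Y = f" "nul X Y \<boxplus> f = f"
proof -
  interpret M: abelian_group "Hom C X Y" using assms by (auto simp: hom_abelian)
  have "f \<in> arr C X Y" "X \<in> Obj C" "Y \<in> Obj C" using assms homD by blast+
  then show "f \<boxminus> nul X Y = f" "f \<boxplus> nul X Y = f" "nul X Y \<boxplus> f = f"
    using assms by (auto simp: plus_def minus_def M.minus_eq)
qed

lemma add_minus_cancel:
  assumes "mor f" "mor g" "src f = src g" "tgt f = tgt g"
  shows "(f \<boxminus> g) \<boxplus> g = f" "(f \<boxplus> g) \<boxminus> g = f" "g \<boxplus> (f \<boxminus> g) = f" "f \<boxplus> g = g \<boxplus> f"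
    "f \<boxminus> (f \<boxminus> g) = g"
proof -
  interpret M: abelian_group "Hom C (src g) (tgt g)" using assms by (simp add: hom_abelian)
  have m: "f \<in> arr C (src g) (tgt g)" "g \<in> arr C (src g) (tgt g)" using assms mor_arr[of f] mor_arr[of g] by auto
  let ?p = "\<lambda>a b. a \<oplus>\<^bsub>Hom C (src g) (tgt g)\<^esub> b" and ?m = "\<lambda>a b. a \<ominus>\<^bsub>Hom C (src g) (tgt g)\<^esub> b"
  have eqs': "f \<boxplus> g = ?p f g" "f \<boxminus> g = ?m f g" "g \<boxplus> f = ?p g f"
    using assms by (simp_all add: plus_def minus_def)
  have eqs: "(f \<boxminus> g) \<boxplus> g = ?p (f \<boxminus> g) g"
    "(f \<boxplus> g) \<boxminus> g = ?m (f \<boxplus> g) g" "g \<boxplus> (f \<boxminus> g) = ?p g (f \<boxminus> g)" "f \<boxminus> (f \<boxminus> g) = ?m f (f \<boxminus> g)"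
    using assms by (simp_all add: plus_def[of g "f \<boxminus> g"] plus_def[of "f \<boxminus> g"]
        minus_def[of f "f \<boxminus> g"] minus_def[of "f \<boxplus> g"])
  have l: "?p f (?p g (\<ominus>\<^bsub>Hom C (src g) (tgt g)\<^esub> f)) = g"
    using m M.a_lcomm[of f g "\<ominus>\<^bsub>Hom C (src g) (tgt g)\<^esub> f"] by (simp add: M.r_neg)
  show "(f \<boxminus> g) \<boxplus> g = f" "(f \<boxplus> g) \<boxminus> g = f" "g \<boxplus> (f \<boxminus> g) = f" "f \<boxplus> g = g \<boxplus> f"
    "f \<boxminus> (f \<boxminus> g) = g"
    unfolding eqs unfolding eqs' using m
    by (simp_all add: M.minus_eq M.a_ac M.minus_add M.r_neg1 M.r_neg2 M.r_neg M.l_neg l)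
qed

lemma comp_plus_distrib:
  assumes "mor f" "mor g" "src f = src g" "tgt f = tgt g"
  shows "\<lbrakk>mor h; src h = tgt g\<rbrakk> \<Longrightarrow> h \<star> (f \<boxplus> g) = (h \<star> f) \<boxplus> (h \<star> g)"
    "\<lbrakk>mor h; tgt h = src g\<rbrakk> \<Longrightarrow> (f \<boxplus> g) \<star> h = (f \<star> h) \<boxplus> (g \<star> h)"
proof -
  have m: "f \<in> arr C (src g) (tgt g)" "g \<in> arr C (src g) (tgt g)" using assms mor_arr[of f] mor_arr[of g] by auto
  show "h \<star> (f \<boxplus> g) = (h \<star> f) \<boxplus> (h \<star> g)" if "mor h" "src h = tgt g"
    using comp_add_right[OF _ _ _ m, of "tgt h" h] that assms mor_arr[of h] by (simp add: plus_def)
  show "(f \<boxplus> g) \<star> h = (f \<star> h) \<boxplus> (g \<star> h)" if "mor h" "tgt h = src g"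
    using comp_add_left[OF _ _ _ _ m, of "src h" h] that assms mor_arr[of h] by (simp add: plus_def)
qed

lemma plus_cancel_right:
  assumes "f \<boxplus> h = g \<boxplus> h" "mor f" "mor g" "mor h" "src f = src h" "tgt f = tgt h"
    "src g = src h" "tgt g = tgt h"
  shows "f = g"
  using assms add_minus_cancel(2) by metis

lemma comp_minus_distrib [simp]:
  assumes "mor f" "mor g" "src f = src g" "tgt f = tgt g"
  shows "\<lbrakk>mor h; src h = tgt g\<rbrakk> \<Longrightarrow> h \<star> (f \<boxminus> g) = (h \<star> f) \<boxminus> (h \<star> g)"
    "\<lbrakk>mor h; tgt h = src g\<rbrakk> \<Longrightarrow> (f \<boxminus> g) \<star> h = (f \<star> h) \<boxminus> (g \<star> h)"
proof -
  note [simp] = assms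
  show "h \<star> (f \<boxminus> g) = (h \<star> f) \<boxminus> (h \<star> g)" if [simp]: "mor h" "src h = tgt g"
  proof (rule plus_cancel_right[where h = "h \<star> g"])
    show "(h \<star> (f \<boxminus> g)) \<boxplus> (h \<star> g) = ((h \<star> f) \<boxminus> (h \<star> g)) \<boxplus> (h \<star> g)"
      using comp_plus_distrib(1)[of "f \<boxminus> g" g h] by (simp add: add_minus_cancel)
  qed simp_all
  show "(f \<boxminus> g) \<star> h = (f \<star> h) \<boxminus> (g \<star> h)" if [simp]: "mor h" "tgt h = src g"
  proof (rule plus_cancel_right[where h = "g \<star> h"])
    show "((f \<boxminus> g) \<star> h) \<boxplus> (g \<star> h) = ((f \<star> h) \<boxminus> (g \<star> h)) \<boxplus> (g \<star> h)"
      using comp_plus_distrib(2)[of "f \<boxminus> g" g h] by (simp add: add_minus_cancel)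
  qed simp_all
qed

text \<open>Zero is the difference of zero with itself, so this is a case of distributivity over
  differences.\<close>

lemma comp_nul [simp]:
  "\<lbrakk>mor h; src h = Y; X \<in> Obj C\<rbrakk> \<Longrightarrow> h \<star> nul X Y = nul X (tgt h)"
  "\<lbrakk>mor h; tgt h = X; Y \<in> Obj C\<rbrakk> \<Longrightarrow> nul X Y \<star> h = nul (src h) Y"
proof -
  show "h \<star> nul X Y = nul X (tgt h)" if "mor h" "src h = Y" "X \<in> Obj C"
    using comp_minus_distrib(1)[of "nul X Y" "nul X Y" h] that by auto
  show "nul X Y \<star> h = nul (src h) Y" if "mor h" "tgt h = X" "Y \<in> Obj C"
    using comp_minus_distrib(2)[of "nul X Y" "nul X Y" h] that by auto
qed

lemma minus_minus_plus:
  assumes "\<guillemotleft>f : X \<rightarrow> Y\<guillemotright>" "\<guillemotleft>g : X \<rightarrow> Y\<guillemotright>" "\<guillemotleft>h : X \<rightarrow> Y\<guillemotright>"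
  shows "f \<boxminus> (g \<boxplus> h) = (f \<boxminus> g) \<boxminus> h"
proof -
  interpret M: abelian_group "Hom C X Y" using assms homD by (metis hom_abelian)
  have "f \<in> arr C X Y" "g \<in> arr C X Y" "h \<in> arr C X Y" using assms homD by blast+
  then have "f \<ominus>\<^bsub>Hom C X Y\<^esub> (g \<oplus>\<^bsub>Hom C X Y\<^esub> h) = (f \<ominus>\<^bsub>Hom C X Y\<^esub> g) \<ominus>\<^bsub>Hom C X Y\<^esub> h"
    by (simp add: M.minus_eq M.minus_add M.a_ac)
  then show ?thesis using plus_hom[OF assms(2,3)] plus_hom[OF assms(1,2)] plus_hom(3) assms by metis
qed

lemma comp_finsum:
  assumes "finite I" "\<And>a. a \<in> I \<Longrightarrow> \<guillemotleft>u a : X \<rightarrow> Y\<guillemotright>" "X \<in> Obj C" "Y \<in> Obj C"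
  shows "\<guillemotleft>\<Oplus>\<^bsub>Hom C X Y\<^esub>a\<in>I. u a : X \<rightarrow> Y\<guillemotright>"
    "\<guillemotleft>h : Y \<rightarrow> Z\<guillemotright> \<Longrightarrow> h \<star> (\<Oplus>\<^bsub>Hom C X Y\<^esub>a\<in>I. u a) = (\<Oplus>\<^bsub>Hom C X Z\<^esub>a\<in>I. h \<star> u a)"
    "\<guillemotleft>k : W \<rightarrow> X\<guillemotright> \<Longrightarrow> (\<Oplus>\<^bsub>Hom C X Y\<^esub>a\<in>I. u a) \<star> k = (\<Oplus>\<^bsub>Hom C W Y\<^esub>a\<in>I. u a \<star> k)"
proof -
  interpret M: abelian_group "Hom C X Y" using assms by (simp add: hom_abelian)
  have c: "\<guillemotleft>\<Oplus>\<^bsub>Hom C X Y\<^esub>a\<in>J. u a : X \<rightarrow> Y\<guillemotright>" if "J \<subseteq> I" for J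
    using that assms homD by (intro homI M.finsum_closed) blast+
  then show "\<guillemotleft>\<Oplus>\<^bsub>Hom C X Y\<^esub>a\<in>I. u a : X \<rightarrow> Y\<guillemotright>" by blast
  have s: "(\<Oplus>\<^bsub>Hom C X Y\<^esub>a\<in>insert a J. u a) = u a \<boxplus> (\<Oplus>\<^bsub>Hom C X Y\<^esub>a\<in>J. u a)"
    if "finite J" "a \<notin> J" "insert a J \<subseteq> I" for a J
  proof -
    have "u \<in> J \<rightarrow> arr C X Y" "u a \<in> arr C X Y" using that assms homD by blast+
    from M.finsum_insert[OF that(1,2) this] show ?thesis
      using plus_hom(1)[OF assms(2) c] that by auto
  qed
  show "h \<star> (\<Oplus>\<^bsub>Hom C X Y\<^esub>a\<in>I. u a) = (\<Oplus>\<^bsub>Hom C X Z\<^esub>a\<in>I. h \<star> u a)" if h: "\<guillemotleft>h : Y \<rightarrow> Z\<guillemotright>"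
  proof -
    have Z: "Z \<in> Obj C" using h by auto
    interpret N: abelian_group "Hom C X Z" using assms Z by (simp add: hom_abelian)
    have hu: "h \<star> u a \<in> arr C X Z" "\<guillemotleft>h \<star> u a : X \<rightarrow> Z\<guillemotright>" if "a \<in> I" for a
      using comp_hom[OF assms(2)[OF that] h] homD by blast+
    \<comment> \<open>The induction runs over subsets \<open>J\<close> of \<open>I\<close>, for
      which the typing hypothesis on the summands is still available.\<close>
    have "h \<star> (\<Oplus>\<^bsub>Hom C X Y\<^esub>a\<in>J. u a) = (\<Oplus>\<^bsub>Hom C X Z\<^esub>a\<in>J. h \<star> u a)" if "J \<subseteq> I" for J
      using finite_subset[OF that assms(1)] that
    proof (induction J rule: finite_induct)
      case empty
      then show ?case using assms h by simp
    next
      case (insert a J)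
      have "h \<star> (\<Oplus>\<^bsub>Hom C X Y\<^esub>a\<in>insert a J. u a) = (h \<star> u a) \<boxplus> (h \<star> (\<Oplus>\<^bsub>Hom C X Y\<^esub>a\<in>J. u a))"
        using s insert assms(2)[of a] c[of J] h comp_plus_distrib(1) by simp
      also have "\<dots> = (\<Oplus>\<^bsub>Hom C X Z\<^esub>a\<in>insert a J. h \<star> u a)"
        using insert hu by (subst N.finsum_insert) (auto simp: plus_def)
      finally show ?case .
    qed
    then show ?thesis by simp
  qed
  show "(\<Oplus>\<^bsub>Hom C X Y\<^esub>a\<in>I. u a) \<star> k = (\<Oplus>\<^bsub>Hom C W Y\<^esub>a\<in>I. u a \<star> k)" if k: "\<guillemotleft>k : W \<rightarrow> X\<guillemotright>"
  proof -
    have W: "W \<in> Obj C" using k by auto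
    interpret N: abelian_group "Hom C W Y" using assms W by (simp add: hom_abelian)
    have uk: "u a \<star> k \<in> arr C W Y" "\<guillemotleft>u a \<star> k : W \<rightarrow> Y\<guillemotright>" if "a \<in> I" for a
      using comp_hom[OF k assms(2)[OF that]] homD by blast+
    have "(\<Oplus>\<^bsub>Hom C X Y\<^esub>a\<in>J. u a) \<star> k = (\<Oplus>\<^bsub>Hom C W Y\<^esub>a\<in>J. u a \<star> k)" if "J \<subseteq> I" for J
      using finite_subset[OF that assms(1)] that
    proof (induction J rule: finite_induct)
      case empty
      then show ?case using assms k by simp
    next
      case (insert a J)
      have "(\<Oplus>\<^bsub>Hom C X Y\<^esub>a\<in>insert a J. u a) \<star> k = (u a \<star> k) \<boxplus> ((\<Oplus>\<^bsub>Hom C X Y\<^esub>a\<in>J. u a) \<star> k)"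
        using s insert assms(2)[of a] c[of J] k comp_plus_distrib(2) by simp
      also have "\<dots> = (\<Oplus>\<^bsub>Hom C W Y\<^esub>a\<in>insert a J. u a \<star> k)"
        using insert uk by (subst N.finsum_insert) (auto simp: plus_def)
      finally show ?case .
    qed
    then show ?thesis by simp
  qed
qed

lemma smult_hom:
  assumes "\<guillemotleft>f : X \<rightarrow> Y\<guillemotright>" "c \<in> carrier K"
  shows "\<guillemotleft>c \<odot>\<^bsub>Hom C X Y\<^esub> f : X \<rightarrow> Y\<guillemotright>"
proof -
  have o: "X \<in> Obj C" "Y \<in> Obj C" "f \<in> arr C X Y" using assms homD by blast+
  show ?thesis
    by (rule homI[OF o(1,2) module.smult_closed[OF hom_module[OF o(1,2)] assms(2) o(3)]])
qed

end

lemma is_kernelD: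
  assumes "is_kernel C X Y Z i p" "W \<in> Obj C" "f \<in> arr C W Y" "p \<cdot>\<^bsub>C\<^esub> f = \<zero>\<^bsub>Hom C W Z\<^esub>"
  shows "\<exists>g\<in>arr C W X. i \<cdot>\<^bsub>C\<^esub> g = f"
  using assms unfolding is_kernel_def by blast

lemma is_cokernelD:
  assumes "is_cokernel C X Y Z i p" "W \<in> Obj C" "f \<in> arr C Y W" "f \<cdot>\<^bsub>C\<^esub> i = \<zero>\<^bsub>Hom C X W\<^esub>"
  shows "\<exists>g\<in>arr C Z W. g \<cdot>\<^bsub>C\<^esub> p = f"
  using assms unfolding is_cokernel_def by blast

section \<open>The opposite category\<close>

text \<open>Objects and arrows are kept, only composition and the direction of the morphism spaces
  are reversed. The dual notions then unfold to the original ones, so that results on inflations and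
  pushouts carry over to deflations and pullbacks by rewriting.\<close>

definition op_cat :: "('k, 'o, 'm) k_cat \<Rightarrow> ('k, 'o, 'm) k_cat" where
  "op_cat C = \<lparr>Obj = Obj C, Hom = (\<lambda>X Y. Hom C Y X), ident = ident C, Comp = (\<lambda>g f. f \<cdot>\<^bsub>C\<^esub> g)\<rparr>"

definition op_exact :: "('o, 'm) exact_str \<Rightarrow> ('o, 'm) exact_str" where
  "op_exact E = {(Z, p, Y, i, X) | X i Y p Z. (X, i, Y, p, Z) \<in> E}"

lemma op_cat_simps [simp]:
  "Obj (op_cat C) = Obj C" "Hom (op_cat C) X Y = Hom C Y X" "ident (op_cat C) X = ident C X"
  "g \<cdot>\<^bsub>op_cat C\<^esub> f = f \<cdot>\<^bsub>C\<^esub> g"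
  by (simp_all add: op_cat_def)

lemma op_exact_iff [simp]: "(Z, p, Y, i, X) \<in> op_exact E \<longleftrightarrow> (X, i, Y, p, Z) \<in> E"
  by (simp add: op_exact_def)

lemma k_category_op:
  assumes "k_category K C"
  shows "k_category K (op_cat C)"
proof -
  interpret k_category K C by fact
  show ?thesis
    apply (intro k_category.intro k_category_axioms.intro)
    subgoal by unfold_locales
    subgoal by (simp add: hom_module)
    subgoal by (simp, blast dest: hom_disjoint)
    subgoal by (simp add: ident_closed)
    subgoal by (simp, rule comp_closed)
    subgoal by (simp, rule comp_assoc[symmetric])
    subgoal by (simp add: ident_right)
    subgoal by (simp add: ident_left)
    subgoal by (simp add: comp_add_right)
    subgoal by (simp add: comp_add_left)
    subgoal by (simp add: comp_smult_right)
    subgoal by (simp add: comp_smult_left)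
    done
qed

lemma iso_arr_op [simp]: "iso_arr (op_cat C) X Y f \<longleftrightarrow> iso_arr C Y X f"
  by (auto simp: iso_arr_def)

lemma direct_sum_op_imp: "direct_sum C I X S \<Longrightarrow> direct_sum (op_cat C) I X S"
  unfolding direct_sum_def
  apply (elim conjE exE)
  subgoal for i p by (intro conjI exI[of _ p] exI[of _ i]) auto
  done

lemma direct_sum_op [simp]: "direct_sum (op_cat C) I X S \<longleftrightarrow> direct_sum C I X S"
proof
  have "op_cat (op_cat C) = C" by (simp add: op_cat_def)
  then show "direct_sum (op_cat C) I X S \<Longrightarrow> direct_sum C I X S"
    using direct_sum_op_imp[of "op_cat C"] by simp
qed (rule direct_sum_op_imp)

lemma additive_category_op:
  assumes "additive_category K C"
  shows "additive_category K (op_cat C)"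
proof -
  interpret additive_category K C by fact
  interpret o: k_category K "op_cat C" by (rule k_category_op) unfold_locales
  show ?thesis by unfold_locales (simp add: ex_direct_sum)
qed

text \<open>The endomorphism ring in the opposite category is the opposite ring. Being a unit is a
  left-right symmetric condition, so the nonunits, and with them locality, are the same.\<close>

lemma local_ring_op:
  assumes "local_ring (End_ring C X)"
  shows "local_ring (End_ring (op_cat C) X)"
proof -
  let ?R = "End_ring C X" and ?S = "End_ring (op_cat C) X"
  have s: "carrier ?S = carrier ?R" "\<one>\<^bsub>?S\<^esub> = \<one>\<^bsub>?R\<^esub>" "\<zero>\<^bsub>?S\<^esub> = \<zero>\<^bsub>?R\<^esub>"
    "\<And>x y. x \<otimes>\<^bsub>?S\<^esub> y = y \<otimes>\<^bsub>?R\<^esub> x" "\<And>x y. x \<oplus>\<^bsub>?S\<^esub> y = x \<oplus>\<^bsub>?R\<^esub> y"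
    by (simp_all add: End_ring_def)
  interpret R: ring ?R using assms by (simp add: local_ring_def)
  have "Units ?S = Units ?R" unfolding Units_def s by auto
  moreover have "ring ?S"
  proof (rule ringI)
    show "abelian_group ?S"
      by (rule abelian_groupI) (auto simp: s R.a_ac intro: R.add.l_inv_ex)
    show "monoid ?S"
      by (rule monoidI) (auto simp: s R.m_assoc)
  qed (auto simp: s R.l_distr R.r_distr)
  ultimately show ?thesis using assms by (simp add: local_ring_def s)
qed

lemma krull_schmidt_category_op:
  assumes "krull_schmidt_category K C"
  shows "krull_schmidt_category K (op_cat C)"
proof -
  interpret krull_schmidt_category K C by fact
  interpret o: additive_category K "op_cat C" by (rule additive_category_op) unfold_locales
  show ?thesis
    by unfold_locales (use krull_schmidt local_ring_op in fastforce)
qed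

lemma is_kernel_op [simp]: "is_kernel (op_cat C) X Y Z i p \<longleftrightarrow> is_cokernel C Z Y X p i"
  by (simp add: is_kernel_def is_cokernel_def conj_ac)

lemma is_cokernel_op [simp]: "is_cokernel (op_cat C) X Y Z i p \<longleftrightarrow> is_kernel C Z Y X p i"
  by (simp add: is_kernel_def is_cokernel_def conj_ac)

lemma is_pushout_op [simp]:
  "is_pushout (op_cat C) X Y X' Y' i f i' f' \<longleftrightarrow> is_pullback C Y X Y' X' i f i' f'"
  by (auto simp: is_pushout_def is_pullback_def)

lemma is_pullback_op [simp]:
  "is_pullback (op_cat C) Y Z Y' Z' p f p' f' \<longleftrightarrow> is_pushout C Z Y Z' Y' p f p' f'"
  by (auto simp: is_pushout_def is_pullback_def)

lemma inflation_op [simp]: "inflation (op_exact E) X Y i \<longleftrightarrow> deflation E Y X i"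
  by (auto simp: inflation_def deflation_def)

lemma deflation_op [simp]: "deflation (op_exact E) Y Z p \<longleftrightarrow> inflation E Z Y p"
  by (auto simp: inflation_def deflation_def)

lemma projective_op [simp]: "projective (op_cat C) (op_exact E) P \<longleftrightarrow> injective C E P"
  by (auto simp: projective_def injective_def)

lemma injective_op [simp]: "injective (op_cat C) (op_exact E) P \<longleftrightarrow> projective C E P"
  by (auto simp: projective_def injective_def)

lemma (in k_category) iso_arr_inverse:
  assumes "iso_arr C X Y f"
  obtains g where "iso_arr C Y X g" "g \<star> f = idm X" "f \<star> g = idm Y"
  using assms unfolding iso_arr_def by blast

lemma exact_category_op:
  assumes "exact_category K C E"
  shows "exact_category K (op_cat C) (op_exact E)"
proof -
  interpret exact_category K C E by fact
  interpret o: additive_category K "op_cat C" by (rule additive_category_op) unfold_locales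
  show ?thesis
  proof unfold_locales
    fix X i Y p Z X' Y' Z' i' p' a b c
    assume e: "(X, i, Y, p, Z) \<in> op_exact E"
      and o: "X' \<in> Obj (op_cat C)" "Y' \<in> Obj (op_cat C)" "Z' \<in> Obj (op_cat C)"
        "i' \<in> arr (op_cat C) X' Y'" "p' \<in> arr (op_cat C) Y' Z'"
      and iso: "iso_arr (op_cat C) X X' a" "iso_arr (op_cat C) Y Y' b" "iso_arr (op_cat C) Z Z' c"
      and eq: "b \<cdot>\<^bsub>op_cat C\<^esub> i = i' \<cdot>\<^bsub>op_cat C\<^esub> a" "c \<cdot>\<^bsub>op_cat C\<^esub> p = p' \<cdot>\<^bsub>op_cat C\<^esub> b"
    \<comment> \<open>The given isomorphisms point the wrong way in C; their inverses form the
      isomorphism of conflations to which closure under isomorphism applies.\<close>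
    obtain a' where a': "iso_arr C X X' a'" "a' \<star> a = idm X'" "a \<star> a' = idm X"
      using iso(1) iso_arr_inverse by force
    obtain b' where b': "iso_arr C Y Y' b'" "b' \<star> b = idm Y'" "b \<star> b' = idm Y"
      using iso(2) iso_arr_inverse by force
    obtain c' where c': "iso_arr C Z Z' c'" "c' \<star> c = idm Z'" "c \<star> c' = idm Z"
      using iso(3) iso_arr_inverse by force
    have e': "(Z, p, Y, i, X) \<in> E" using e by simp
    have ob: "X \<in> Obj C" "Y \<in> Obj C" "Z \<in> Obj C" using conflation[OF e'] by auto
    have m: "\<guillemotleft>p : Z \<rightarrow> Y\<guillemotright>" "\<guillemotleft>i : Y \<rightarrow> X\<guillemotright>"
      using conflation[OF e'] ob by (auto simp: is_kernel_def arr_iff)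
    have m': "\<guillemotleft>p' : Z' \<rightarrow> Y'\<guillemotright>" "\<guillemotleft>i' : Y' \<rightarrow> X'\<guillemotright>"
      "\<guillemotleft>a : X' \<rightarrow> X\<guillemotright>" "\<guillemotleft>b : Y' \<rightarrow> Y\<guillemotright>" "\<guillemotleft>c : Z' \<rightarrow> Z\<guillemotright>"
      "\<guillemotleft>a' : X \<rightarrow> X'\<guillemotright>" "\<guillemotleft>b' : Y \<rightarrow> Y'\<guillemotright>" "\<guillemotleft>c' : Z \<rightarrow> Z'\<guillemotright>"
      using o iso a'(1) b'(1) c'(1) ob by (simp_all add: iso_arr_def arr_iff)
    note m = m m'
    have "b' \<star> p = b' \<star> (p \<star> c) \<star> c'" using m c' ob by simp
    also have "\<dots> = (b' \<star> b) \<star> p' \<star> c'" using m eq by simp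
    finally have 1: "b' \<star> p = p' \<star> c'" using m b' by simp
    have "a' \<star> i = a' \<star> (i \<star> b) \<star> b'" using m b' ob by simp
    also have "\<dots> = (a' \<star> a) \<star> i' \<star> b'" using m eq by simp
    finally have 2: "a' \<star> i = i' \<star> b'" using m a' by simp
    show "(X', i', Y', p', Z') \<in> op_exact E"
      using conflation_iso[of Z p Y i X Z' Y' X' p' i' c' b' a'] e o a'(1) b'(1) c'(1) 1 2 by simp
  next
    fix X Y i X' f
    assume "inflation (op_exact E) X Y i" "X' \<in> Obj (op_cat C)" "f \<in> arr (op_cat C) X X'"
    then show "\<exists>Y'\<in>Obj (op_cat C). \<exists>i' f'.
        is_pushout (op_cat C) X Y X' Y' i f i' f' \<and> inflation (op_exact E) X' Y' i'"
      using deflation_pullback by simp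
  next
    fix Y Z p Z' f
    assume "deflation (op_exact E) Y Z p" "Z' \<in> Obj (op_cat C)" "f \<in> arr (op_cat C) Z' Z"
    then show "\<exists>Y'\<in>Obj (op_cat C). \<exists>p' f'.
        is_pullback (op_cat C) Y Z Y' Z' p f p' f' \<and> deflation (op_exact E) Y' Z' p'"
      using inflation_pushout by simp
  qed (use conflation inflation_comp deflation_comp inflation_ident deflation_ident in auto)
qed

section \<open>Conflations\<close>

context exact_category
begin

lemma conflD:
  assumes "(X, i, Y, p, Z) \<in> E"
  shows "X \<in> Obj C" "Y \<in> Obj C" "Z \<in> Obj C" "\<guillemotleft>i : X \<rightarrow> Y\<guillemotright>" "\<guillemotleft>p : Y \<rightarrow> Z\<guillemotright>" "p \<star> i = nul X Z"
  using conflation[OF assms] by (auto simp: is_kernel_def arr_iff)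

lemma confl_ker:
  assumes "(X, i, Y, p, Z) \<in> E" "\<guillemotleft>f : W \<rightarrow> Y\<guillemotright>" "p \<star> f = nul W Z"
  obtains g where "\<guillemotleft>g : W \<rightarrow> X\<guillemotright>" "i \<star> g = f"
proof -
  have "W \<in> Obj C" "f \<in> arr C W Y" using assms homD by blast+
  then show thesis
    using is_kernelD[of C X Y Z i p W f] conflation[OF assms(1)] assms that homI by blast
qed

lemma confl_mono:
  assumes "(X, i, Y, p, Z) \<in> E" "\<guillemotleft>f : W \<rightarrow> X\<guillemotright>" "\<guillemotleft>g : W \<rightarrow> X\<guillemotright>" "i \<star> f = i \<star> g"
  shows "f = g"
proof -
  have m: "\<guillemotleft>i : X \<rightarrow> Y\<guillemotright>" "\<guillemotleft>p : Y \<rightarrow> Z\<guillemotright>" "p \<star> i = nul X Z" using assms conflD by auto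
  have o: "W \<in> Obj C" "f \<in> arr C W X" "g \<in> arr C W X" "i \<star> f \<in> arr C W Y"
    using assms homD comp_hom m by blast+
  have "p \<star> i \<star> f = nul W Z" using assms m homD[OF m(2)] by (auto simp: comp_reassoc[OF m(3)])
  then show ?thesis
    using conflation[OF assms(1)] o assms unfolding is_kernel_def by metis
qed

lemma confl_coker:
  assumes "(X, i, Y, p, Z) \<in> E" "\<guillemotleft>f : Y \<rightarrow> W\<guillemotright>" "f \<star> i = nul X W"
  obtains g where "\<guillemotleft>g : Z \<rightarrow> W\<guillemotright>" "g \<star> p = f"
proof -
  have "W \<in> Obj C" "f \<in> arr C Y W" using assms homD by blast+
  then show thesis
    using is_cokernelD[of C X Y Z i p W f] conflation[OF assms(1)] assms that homI by blast
qed

lemma confl_epi: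
  assumes "(X, i, Y, p, Z) \<in> E" "\<guillemotleft>f : Z \<rightarrow> W\<guillemotright>" "\<guillemotleft>g : Z \<rightarrow> W\<guillemotright>" "f \<star> p = g \<star> p"
  shows "f = g"
proof -
  have m: "\<guillemotleft>i : X \<rightarrow> Y\<guillemotright>" "\<guillemotleft>p : Y \<rightarrow> Z\<guillemotright>" "p \<star> i = nul X Z" using assms conflD by auto
  have o: "W \<in> Obj C" "f \<in> arr C Z W" "g \<in> arr C Z W" "f \<star> p \<in> arr C Y W" "X \<in> Obj C"
    using assms homD comp_hom m by blast+
  have "(f \<star> p) \<star> i = nul X W" using m assms o by auto
  then show ?thesis
    using conflation[OF assms(1)] o assms unfolding is_cokernel_def by metis
qed

lemma pushoutD:
  assumes "is_pushout C X Y X' Y' i f i' f'" "X \<in> Obj C" "Y \<in> Obj C" "X' \<in> Obj C" "Y' \<in> Obj C"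
  shows "\<guillemotleft>i : X \<rightarrow> Y\<guillemotright>" "\<guillemotleft>f : X \<rightarrow> X'\<guillemotright>" "\<guillemotleft>i' : X' \<rightarrow> Y'\<guillemotright>" "\<guillemotleft>f' : Y \<rightarrow> Y'\<guillemotright>" "i' \<star> f = f' \<star> i"
    "\<lbrakk>\<guillemotleft>u : X' \<rightarrow> W\<guillemotright>; \<guillemotleft>v : Y \<rightarrow> W\<guillemotright>; u \<star> f = v \<star> i\<rbrakk> \<Longrightarrow> \<exists>w. \<guillemotleft>w : Y' \<rightarrow> W\<guillemotright> \<and> w \<star> i' = u \<and> w \<star> f' = v"
    "\<lbrakk>\<guillemotleft>w : Y' \<rightarrow> W\<guillemotright>; \<guillemotleft>w' : Y' \<rightarrow> W\<guillemotright>; w \<star> i' = w' \<star> i'; w \<star> f' = w' \<star> f'\<rbrakk> \<Longrightarrow> w = w'"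
proof -
  show m: "\<guillemotleft>i : X \<rightarrow> Y\<guillemotright>" "\<guillemotleft>f : X \<rightarrow> X'\<guillemotright>" "\<guillemotleft>i' : X' \<rightarrow> Y'\<guillemotright>" "\<guillemotleft>f' : Y \<rightarrow> Y'\<guillemotright>" "i' \<star> f = f' \<star> i"
    using assms by (auto simp: is_pushout_def arr_iff)
  have u: "\<exists>!w. w \<in> arr C Y' W \<and> w \<star> i' = u \<and> w \<star> f' = v"
    if "\<guillemotleft>u : X' \<rightarrow> W\<guillemotright>" "\<guillemotleft>v : Y \<rightarrow> W\<guillemotright>" "u \<star> f = v \<star> i" for u v W
    using assms(1) homD[OF that(1)] homD[OF that(2)] that(3) unfolding is_pushout_def by blast
  show "\<exists>w. \<guillemotleft>w : Y' \<rightarrow> W\<guillemotright> \<and> w \<star> i' = u \<and> w \<star> f' = v"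
    if "\<guillemotleft>u : X' \<rightarrow> W\<guillemotright>" "\<guillemotleft>v : Y \<rightarrow> W\<guillemotright>" "u \<star> f = v \<star> i"
    using u[OF that] homI assms(5) homD[OF that(1)] by blast
  show "w = w'" if "\<guillemotleft>w : Y' \<rightarrow> W\<guillemotright>" "\<guillemotleft>w' : Y' \<rightarrow> W\<guillemotright>" "w \<star> i' = w' \<star> i'" "w \<star> f' = w' \<star> f'"
  proof -
    have "(w \<star> i') \<star> f = (w \<star> f') \<star> i" using that(1) m by simp
    from u[OF _ _ this] show ?thesis
      using that m comp_hom homD[OF that(1)] homD[OF that(2)] by metis
  qed
qed

text \<open>Two cokernels of the same map are isomorphic under it, and conflations are closed under
  isomorphism. The axioms only assert that certain maps are inflations; this lemma allows the third
  term to be chosen explicitly.\<close>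

lemma conflation_replace_coker:
  assumes "(X, i, Y, p, Z) \<in> E" "is_cokernel C X Y Z' i p'" "Z' \<in> Obj C"
  shows "(X, i, Y, p', Z') \<in> E"
proof -
  note m = conflD[OF assms(1)]
  have p': "\<guillemotleft>p' : Y \<rightarrow> Z'\<guillemotright>" "p' \<star> i = nul X Z'"
    using assms m by (auto simp: is_cokernel_def arr_iff)
  obtain c where c: "\<guillemotleft>c : Z \<rightarrow> Z'\<guillemotright>" "c \<star> p = p'"
    using confl_coker[OF assms(1) p'] by blast
  obtain d where d: "\<guillemotleft>d : Z' \<rightarrow> Z\<guillemotright>" "d \<star> p' = p"
    using is_cokernelD[OF assms(2) m(3), of p] m homD[OF m(5)] homI[OF assms(3) m(3)] by blast
  have "(d \<star> c) \<star> p = idm Z \<star> p" using m c d by simp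
  then have dc: "d \<star> c = idm Z"
    using confl_epi[OF assms(1), of "d \<star> c" Z "idm Z"] m c d by simp
  have "(c \<star> d) \<star> p' = idm Z' \<star> p'" using m c d p' by simp
  moreover have "\<exists>!g. g \<in> arr C Z' Z' \<and> g \<star> p' = p'"
    using assms(2) p' homD[OF p'(1)] unfolding is_cokernel_def by blast
  ultimately have cd: "c \<star> d = idm Z'"
    using comp_hom[OF d(1) c(1)] homD[OF p'(1)] ident_closed homD p'
    by (metis comp_ident_left)
  have "iso_arr C Z Z' c"
    unfolding iso_arr_def using cd dc homD[OF c(1)] homD[OF d(1)] by blast
  moreover have "iso_arr C W W (idm W)" if "W \<in> Obj C" for W
    unfolding iso_arr_def using that ident_closed by (auto intro!: bexI[of _ "idm W"])
  ultimately show ?thesis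
    using conflation_iso[OF assms(1), of X Y Z' i p' "idm X" "idm Y" c] m p' c assms(3) homD
    by simp
qed

text \<open>A map out of the pushout that kills \<open>i'\<close> is determined by its restriction
  to \<open>Y\<close>, and this restriction kills \<open>i\<close>. Hence \<open>i'\<close> and
  \<open>i\<close> have the same cokernel object, and the pushout is again an extension of
  \<open>Z\<close>.\<close>

lemma pushout_conflation:
  assumes "(X, i, Y, p, Z) \<in> E" "\<guillemotleft>f : X \<rightarrow> X'\<guillemotright>"
  obtains Y' i' f' p' where "Y' \<in> Obj C" "is_pushout C X Y X' Y' i f i' f'" "(X', i', Y', p', Z) \<in> E"
    "p' \<star> f' = p"
proof -
  note m = conflD[OF assms(1)]
  have o: "f \<in> arr C X X'" "X' \<in> Obj C" using homD[OF assms(2)] by auto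
  have "inflation E X Y i" using assms(1) by (auto simp: inflation_def)
  then obtain Y' i' f' where Y': "Y' \<in> Obj C" and po: "is_pushout C X Y X' Y' i f i' f'"
    and inf: "inflation E X' Y' i'"
    using inflation_pushout[OF _ o(2,1)] by blast
  note P = pushoutD[OF po m(1,2) o(2) Y']
  have "nul X' Z \<star> f = p \<star> i" using assms m o by simp
  then obtain p' where p': "\<guillemotleft>p' : Y' \<rightarrow> Z\<guillemotright>" "p' \<star> i' = nul X' Z" "p' \<star> f' = p"
    using P(6)[of "nul X' Z" Z p] m o by auto
  have "is_cokernel C X' Y' Z i' p'"
    unfolding is_cokernel_def
  proof (intro conjI ballI impI)
    fix W g assume "W \<in> Obj C" "g \<in> arr C Y' W" and g0: "g \<star> i' = nul X' W"
    then have g: "\<guillemotleft>g : Y' \<rightarrow> W\<guillemotright>" "W \<in> Obj C" using Y' by (auto simp: arr_iff)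
    have "(g \<star> f') \<star> i = (g \<star> i') \<star> f" using g P by simp
    then have "(g \<star> f') \<star> i = nul X W" using g0 g P o by simp
    then obtain h where h: "\<guillemotleft>h : Z \<rightarrow> W\<guillemotright>" "h \<star> p = g \<star> f'"
      using confl_coker[OF assms(1), of "g \<star> f'" W] g P by auto
    have "h \<star> p' = g"
      by (rule P(7)[of _ W]) (use h g p' P g0 g o in auto)
    moreover have "h' = h" if "\<guillemotleft>h' : Z \<rightarrow> W\<guillemotright>" "h' \<star> p' = g" for h'
    proof (rule confl_epi[OF assms(1) that(1) h(1)])
      have "h' \<star> p = (h' \<star> p') \<star> f'" using that(1) p' P by simp
      then show "h' \<star> p = h \<star> p" unfolding that(2) using h by simp
    qed
    ultimately show "\<exists>!h. h \<in> arr C Z W \<and> h \<star> p' = g"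
      using h(1) arr_iff[OF m(3) g(2)] by metis
  qed (use P p' homD in blast)+
  moreover obtain q Z2 where "(X', i', Y', q, Z2) \<in> E" using inf by (auto simp: inflation_def)
  ultimately have "(X', i', Y', p', Z) \<in> E" using conflation_replace_coker m by blast
  then show thesis using that Y' po p' by blast
qed

end

section \<open>Pullbacks of conflations, and lifting along maps of conflations\<close>

context exact_category
begin

interpretation op: exact_category K "op_cat C" "op_exact E"
  by (rule exact_category_op) unfold_locales

lemma op_mor: "op.mor = mor"
  by (auto simp: op.mor_def mor_def fun_eq_iff)

lemma op_src: "mor f \<Longrightarrow> op.src f = tgt f"
  by (rule op.src_eq[where Y = "src f"]) (use mor_arr in auto)

lemma op_tgt: "mor f \<Longrightarrow> op.tgt f = src f"
  by (rule op.tgt_eq[where X = "tgt f"]) (use mor_arr in auto)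

lemma pullbackD:
  assumes "is_pullback C Y Z Y' Z' p f p' f'" "Y \<in> Obj C" "Z \<in> Obj C" "Y' \<in> Obj C" "Z' \<in> Obj C"
  shows "\<guillemotleft>p : Y \<rightarrow> Z\<guillemotright>" "\<guillemotleft>f : Z' \<rightarrow> Z\<guillemotright>" "\<guillemotleft>p' : Y' \<rightarrow> Z'\<guillemotright>" "\<guillemotleft>f' : Y' \<rightarrow> Y\<guillemotright>" "f \<star> p' = p \<star> f'"
    "\<lbrakk>\<guillemotleft>u : W \<rightarrow> Z'\<guillemotright>; \<guillemotleft>v : W \<rightarrow> Y\<guillemotright>; f \<star> u = p \<star> v\<rbrakk> \<Longrightarrow> \<exists>w. \<guillemotleft>w : W \<rightarrow> Y'\<guillemotright> \<and> p' \<star> w = u \<and> f' \<star> w = v"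
    "\<lbrakk>\<guillemotleft>w : W \<rightarrow> Y'\<guillemotright>; \<guillemotleft>w' : W \<rightarrow> Y'\<guillemotright>; p' \<star> w = p' \<star> w'; f' \<star> w = f' \<star> w'\<rbrakk> \<Longrightarrow> w = w'"
proof -
  show m: "\<guillemotleft>p : Y \<rightarrow> Z\<guillemotright>" "\<guillemotleft>f : Z' \<rightarrow> Z\<guillemotright>" "\<guillemotleft>p' : Y' \<rightarrow> Z'\<guillemotright>" "\<guillemotleft>f' : Y' \<rightarrow> Y\<guillemotright>" "f \<star> p' = p \<star> f'"
    using assms by (auto simp: is_pullback_def arr_iff)
  have u: "\<exists>!w. w \<in> arr C W Y' \<and> p' \<star> w = u \<and> f' \<star> w = v"
    if "\<guillemotleft>u : W \<rightarrow> Z'\<guillemotright>" "\<guillemotleft>v : W \<rightarrow> Y\<guillemotright>" "f \<star> u = p \<star> v" for u v W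
    using assms(1) homD[OF that(1)] homD[OF that(2)] that(3) unfolding is_pullback_def by blast
  show "\<exists>w. \<guillemotleft>w : W \<rightarrow> Y'\<guillemotright> \<and> p' \<star> w = u \<and> f' \<star> w = v"
    if "\<guillemotleft>u : W \<rightarrow> Z'\<guillemotright>" "\<guillemotleft>v : W \<rightarrow> Y\<guillemotright>" "f \<star> u = p \<star> v"
    using u[OF that] homI assms(4) homD[OF that(1)] by blast
  show "w = w'" if "\<guillemotleft>w : W \<rightarrow> Y'\<guillemotright>" "\<guillemotleft>w' : W \<rightarrow> Y'\<guillemotright>" "p' \<star> w = p' \<star> w'" "f' \<star> w = f' \<star> w'"
  proof -
    have "f \<star> (p' \<star> w) = p \<star> (f' \<star> w)" using that(1) m by (simp add: comp_reassoc[OF m(5)])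
    from u[OF _ _ this] show ?thesis
      using that m comp_hom homD[OF that(1)] homD[OF that(2)] by metis
  qed
qed

lemma pullback_conflation:
  assumes "(X, i, Y, p, Z) \<in> E" "\<guillemotleft>f : Z' \<rightarrow> Z\<guillemotright>"
  obtains Y' p' f' i' where "Y' \<in> Obj C" "is_pullback C Y Z Y' Z' p f p' f'" "(X, i', Y', p', Z') \<in> E"
    "f' \<star> i' = i"
proof -
  obtain Y' p' f' i' where "Y' \<in> Obj (op_cat C)" "is_pushout (op_cat C) Z Y Z' Y' p f p' f'"
    "(Z', p', Y', i', X) \<in> op_exact E" "i' \<cdot>\<^bsub>op_cat C\<^esub> f' = i"
    by (rule op.pushout_conflation[of Z p Y i X f Z'])
      (use assms op_src op_tgt in \<open>auto simp: op_mor\<close>)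
  with that show thesis by simp
qed

text \<open>Half of the fact that a map of conflations which is the identity on the left is a pullback square.\<close>

lemma conflation_map_lift:
  assumes E1: "(X, i, Y, p, Z) \<in> E" and E2: "(X, i', Y', p', Z') \<in> E"
    and u: "\<guillemotleft>u : Y \<rightarrow> Y'\<guillemotright>" "u \<star> i = i'" and t: "\<guillemotleft>t : Z \<rightarrow> Z'\<guillemotright>" "t \<star> p = p' \<star> u"
    and f: "\<guillemotleft>f : A \<rightarrow> Z\<guillemotright>" and w: "\<guillemotleft>w : A \<rightarrow> Y'\<guillemotright>" "t \<star> f = p' \<star> w"
  obtains g where "\<guillemotleft>g : A \<rightarrow> Y\<guillemotright>" "p \<star> g = f"
proof -
  note m = conflD[OF E1] conflD[OF E2]
  obtain W r f' k where W: "W \<in> Obj C" and pb: "is_pullback C Y Z W A p f r f'"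
    and E3: "(X, k, W, r, A) \<in> E" and k: "f' \<star> k = i"
    using pullback_conflation[OF E1 f] by metis
  note m3 = conflD[OF E3]
  note P = pullbackD[OF pb m(2,3) W m3(3)]
  \<comment> \<open>The two maps \<open>u \<star> f'\<close> and \<open>w \<star> r\<close> from
    \<open>W\<close> to \<open>Y'\<close> agree after \<open>p'\<close>, so they differ by
    \<open>i' \<star> e\<close>. This \<open>e\<close> is a retraction of \<open>k\<close>, so the
    pulled back conflation splits: \<open>f' \<boxminus> (i \<star> e)\<close> kills
    \<open>k\<close> and descends along \<open>r\<close> to the required lift.\<close>
  have "p' \<star> (u \<star> f') = t \<star> f \<star> r"
    using m m3 P u t comp_assoc'[of f' u p'] comp_assoc'[of f' p t] by simp
  also have "\<dots> = p' \<star> w \<star> r" using w f m m3 comp_assoc'[of r f t] t by simp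
  finally have "p' \<star> ((u \<star> f') \<boxminus> (w \<star> r)) = nul W Z'"
    using m P u w by simp
  then obtain e where e: "\<guillemotleft>e : W \<rightarrow> X\<guillemotright>" "i' \<star> e = (u \<star> f') \<boxminus> (w \<star> r)"
    using confl_ker[OF E2, of "(u \<star> f') \<boxminus> (w \<star> r)" W] m P u w by auto
  have "i' \<star> e \<star> k = ((u \<star> f') \<boxminus> (w \<star> r)) \<star> k"
    using e m m3 comp_assoc'[of k e i'] by simp
  also have "\<dots> = i' \<star> idm X" using m m3 P u w k by simp
  finally have "i' \<star> e \<star> k = i' \<star> idm X" .
  then have ek: "e \<star> k = idm X"
    using confl_mono[OF E2, of "e \<star> k" X "idm X"] e m3 by simp
  have "(f' \<boxminus> (i \<star> e)) \<star> k = nul X Y" using P e m m3 k ek by simp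
  then obtain g where g: "\<guillemotleft>g : A \<rightarrow> Y\<guillemotright>" "g \<star> r = f' \<boxminus> (i \<star> e)"
    using confl_coker[OF E3, of "f' \<boxminus> (i \<star> e)" Y] P e m m3 by auto
  have "(p \<star> g) \<star> r = p \<star> (f' \<boxminus> (i \<star> e))" using m g P by simp
  also have "\<dots> = f \<star> r"
    using m P e f by (simp add: comp_reassoc[OF m(6)])
  finally have "p \<star> g = f" using confl_epi[OF E3, of "p \<star> g" Z f] g m f by simp
  with g that show thesis by blast
qed

end

section \<open>Minimal left approximations\<close>

definition left_approx :: "('k, 'o, 'm) k_cat \<Rightarrow> 'o set \<Rightarrow> 'o \<Rightarrow> 'o \<Rightarrow> 'm \<Rightarrow> bool" where
  "left_approx C B M Y f \<longleftrightarrow> f \<in> arr C M Y \<and>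
     (\<forall>Y'\<in>B. \<forall>g\<in>arr C M Y'. \<exists>h\<in>arr C Y Y'. h \<cdot>\<^bsub>C\<^esub> f = g)"

text \<open>The sum of \<open>x\<close> and \<open>idm X \<boxminus> x\<close> is the identity,
  hence a unit; in a local ring two nonunits cannot add up to a unit.\<close>

lemma (in k_category) local_End_unit:
  assumes "local_ring (End_ring C X)" "\<guillemotleft>x : X \<rightarrow> X\<guillemotright>"
    and "\<nexists>u. \<guillemotleft>u : X \<rightarrow> X\<guillemotright> \<and> u \<star> x = idm X \<and> x \<star> u = idm X"
  obtains u where "\<guillemotleft>u : X \<rightarrow> X\<guillemotright>" "u \<star> (idm X \<boxminus> x) = idm X" "(idm X \<boxminus> x) \<star> u = idm X"
proof -
  let ?R = "End_ring C X"
  have X: "X \<in> Obj C" using assms(2) by auto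
  interpret R: ring ?R using assms(1) by (simp add: local_ring_def)
  have c: "y \<in> carrier ?R \<longleftrightarrow> \<guillemotleft>y : X \<rightarrow> X\<guillemotright>" for y
    using arr_iff[OF X X] by (simp add: End_ring_def)
  have U: "y \<in> Units ?R \<longleftrightarrow> \<guillemotleft>y : X \<rightarrow> X\<guillemotright> \<and> (\<exists>u. \<guillemotleft>u : X \<rightarrow> X\<guillemotright> \<and> u \<star> y = idm X \<and> y \<star> u = idm X)" for y
    unfolding Units_def mem_Collect_eq Bex_def c by (auto simp: End_ring_def)
  have m: "\<guillemotleft>idm X \<boxminus> x : X \<rightarrow> X\<guillemotright>" using assms X by simp
  have "x \<oplus>\<^bsub>?R\<^esub> (idm X \<boxminus> x) = \<one>\<^bsub>?R\<^esub>"
    using plus_hom(1)[OF assms(2) m] add_minus_cancel(3)[of "idm X" x] assms X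
    by (simp add: End_ring_def)
  then have "x \<oplus>\<^bsub>?R\<^esub> (idm X \<boxminus> x) \<in> Units ?R" by simp
  then have "idm X \<boxminus> x \<in> Units ?R"
    using assms(1,3) U m assms(2) c unfolding local_ring_def by blast
  then show thesis using U that by blast
qed

context krull_schmidt_category
begin

text \<open>
  Instead of splitting summands off an approximation, an approximating family of maps into objects
  with local endomorphism rings is kept, so that minimality is a condition on the index set.
\<close>

definition approx_family where
  "approx_family M B I X f \<longleftrightarrow> finite (I :: nat set) \<and>
     (\<forall>a\<in>I. X a \<in> B \<and> local_ring (End_ring C (X a)) \<and> \<guillemotleft>f a : M \<rightarrow> X a\<guillemotright>) \<and>
     (\<forall>Y\<in>B. \<forall>g. \<guillemotleft>g : M \<rightarrow> Y\<guillemotright> \<longrightarrow>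
        (\<exists>h. (\<forall>a\<in>I. \<guillemotleft>h a : X a \<rightarrow> Y\<guillemotright>) \<and> g = (\<Oplus>\<^bsub>Hom C M Y\<^esub>a\<in>I. h a \<star> f a)))"

lemma approx_familyD:
  assumes "approx_family M B I X f" "Y \<in> B" "\<guillemotleft>g : M \<rightarrow> Y\<guillemotright>"
  obtains h where "\<forall>a\<in>I. \<guillemotleft>h a : X a \<rightarrow> Y\<guillemotright>" "g = (\<Oplus>\<^bsub>Hom C M Y\<^esub>a\<in>I. h a \<star> f a)"
proof -
  have "\<forall>Y\<in>B. \<forall>g. \<guillemotleft>g : M \<rightarrow> Y\<guillemotright> \<longrightarrow>
        (\<exists>h. (\<forall>a\<in>I. \<guillemotleft>h a : X a \<rightarrow> Y\<guillemotright>) \<and> g = (\<Oplus>\<^bsub>Hom C M Y\<^esub>a\<in>I. h a \<star> f a))"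
    using assms(1) unfolding approx_family_def by (elim conjE)
  from this[rule_format, OF assms(2,3)] that show thesis by (elim exE conjE)
qed

lemma direct_sum_homs:
  assumes "direct_sum C I X S"
  obtains i p where "finite I" "S \<in> Obj C" "\<forall>a\<in>I. X a \<in> Obj C"
    "\<forall>a\<in>I. \<guillemotleft>i a : X a \<rightarrow> S\<guillemotright>" "\<forall>a\<in>I. \<guillemotleft>p a : S \<rightarrow> X a\<guillemotright>"
    "\<forall>a\<in>I. p a \<star> i a = idm (X a)" "\<forall>a\<in>I. \<forall>b\<in>I. a \<noteq> b \<longrightarrow> p b \<star> i a = nul (X a) (X b)"
    "(\<Oplus>\<^bsub>Hom C S S\<^esub>a\<in>I. i a \<star> p a) = idm S"
proof -
  obtain i p where *: "\<forall>a\<in>I. i a \<in> arr C (X a) S \<and> p a \<in> arr C S (X a)"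
    "\<forall>a\<in>I. p a \<star> i a = idm (X a)" "\<forall>a\<in>I. \<forall>b\<in>I. a \<noteq> b \<longrightarrow> p b \<star> i a = nul (X a) (X b)"
    "(\<Oplus>\<^bsub>Hom C S S\<^esub>a\<in>I. i a \<star> p a) = idm S"
    and o: "finite I" "S \<in> Obj C" "\<forall>a\<in>I. X a \<in> Obj C"
    using assms unfolding direct_sum_def by blast
  have "\<forall>a\<in>I. \<guillemotleft>i a : X a \<rightarrow> S\<guillemotright>" "\<forall>a\<in>I. \<guillemotleft>p a : S \<rightarrow> X a\<guillemotright>"
    using *(1) o by (auto simp: arr_iff)
  from that[OF o this *(2-4)] show thesis .
qed

text \<open>The components of an approximation with respect to a Krull-Schmidt decomposition of its
  target form such a family: inserting the identity of the target, written as the sum of the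
  \<open>i a \<star> p a\<close>, between \<open>h\<close> and \<open>f\<close> decomposes every map
  \<open>h \<star> f\<close>. Closure under summands keeps the components in
  \<open>B\<close>.\<close>

lemma ex_approx_family:
  assumes B: "subcategory C B" and f: "left_approx C B M Y f" "Y \<in> B" "M \<in> Obj C"
  shows "\<exists>I X f. approx_family M B I X f"
proof -
  have BO: "B \<subseteq> Obj C" using B by (simp add: subcategory_def)
  have fm: "\<guillemotleft>f : M \<rightarrow> Y\<guillemotright>" using f BO arr_iff by (auto simp: left_approx_def)
  obtain I :: "nat set" and X where S: "direct_sum C I X Y"
    and l: "\<forall>a\<in>I. local_ring (End_ring C (X a))"
    using krull_schmidt f BO by blast
  obtain i p where "finite I" "Y \<in> Obj C" "\<forall>a\<in>I. X a \<in> Obj C"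
    "\<forall>a\<in>I. \<guillemotleft>i a : X a \<rightarrow> Y\<guillemotright>" "\<forall>a\<in>I. \<guillemotleft>p a : Y \<rightarrow> X a\<guillemotright>"
    "\<forall>a\<in>I. p a \<star> i a = idm (X a)" "\<forall>a\<in>I. \<forall>b\<in>I. a \<noteq> b \<longrightarrow> p b \<star> i a = nul (X a) (X b)"
    "(\<Oplus>\<^bsub>Hom C Y Y\<^esub>a\<in>I. i a \<star> p a) = idm Y"
    by (rule direct_sum_homs[OF S])
  note ip = this(1) this(4,5)[THEN bspec] this(8,2)
  have XB: "\<forall>a\<in>I. X a \<in> B" using B S f unfolding subcategory_def by blast
  have "approx_family M B I X (\<lambda>a. p a \<star> f)"
    unfolding approx_family_def
  proof (intro conjI ballI allI impI)
    fix Z g assume Z: "Z \<in> B" and g: "\<guillemotleft>g : M \<rightarrow> Z\<guillemotright>"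
    obtain h where "h \<in> arr C Y Z" "h \<star> f = g"
      using f Z homD[OF g] by (auto simp: left_approx_def)
    then have h: "\<guillemotleft>h : Y \<rightarrow> Z\<guillemotright>" "h \<star> f = g" using ip(5) Z BO arr_iff by blast+
    have ipm: "\<guillemotleft>i a \<star> p a : Y \<rightarrow> Y\<guillemotright>" if "a \<in> I" for a using comp_hom ip that by blast
    then have hip: "\<guillemotleft>h \<star> i a \<star> p a : Y \<rightarrow> Z\<guillemotright>" if "a \<in> I" for a using comp_hom h that by blast
    have Zo: "Z \<in> Obj C" using Z BO by blast
    have "h \<star> idm Y = (\<Oplus>\<^bsub>Hom C Y Z\<^esub>a\<in>I. h \<star> i a \<star> p a)"
      unfolding ip(4)[symmetric] by (rule comp_finsum(2)[OF ip(1) ipm ip(5,5) h(1)])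
    then have "g = (\<Oplus>\<^bsub>Hom C Y Z\<^esub>a\<in>I. h \<star> i a \<star> p a) \<star> f" using h by simp
    also have "\<dots> = (\<Oplus>\<^bsub>Hom C M Z\<^esub>a\<in>I. (h \<star> i a \<star> p a) \<star> f)"
      by (rule comp_finsum(3)[OF ip(1) hip ip(5) Zo fm])
    also have "\<dots> = (\<Oplus>\<^bsub>Hom C M Z\<^esub>a\<in>I. (h \<star> i a) \<star> p a \<star> f)"
    proof -
      interpret N: abelian_group "Hom C M Z" using f(3) Zo by (simp add: hom_abelian)
      show ?thesis
      proof (rule N.finsum_cong')
        fix a assume a: "a \<in> I"
        note [simp] = ip(2)[OF a] ip(3)[OF a]
        show "(h \<star> i a \<star> p a) \<star> f = (h \<star> i a) \<star> p a \<star> f" using h(1) fm by simp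
      next
        have "\<guillemotleft>(h \<star> i a) \<star> p a \<star> f : M \<rightarrow> Z\<guillemotright>" if "a \<in> I" for a
          by (rule comp_hom[OF comp_hom[OF fm ip(3)[OF that]] comp_hom[OF ip(2)[OF that] h(1)]])
        then show "(\<lambda>a. (h \<star> i a) \<star> p a \<star> f) \<in> I \<rightarrow> arr C M Z" using homD by blast
      qed simp
    qed
    finally show "\<exists>h. (\<forall>a\<in>I. \<guillemotleft>h a : X a \<rightarrow> Z\<guillemotright>) \<and> g = (\<Oplus>\<^bsub>Hom C M Z\<^esub>a\<in>I. h a \<star> p a \<star> f)"
      using comp_hom[OF ip(2) h(1)] by (intro exI[of _ "\<lambda>a. h \<star> i a"]) blast
  qed (use ip l XB fm comp_hom in auto)
  then show ?thesis by blast
qed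

text \<open>A linear relation with coefficient one at \<open>a\<close> expresses \<open>f a\<close>
  through the other components, which makes it redundant. Concretely, subtracting \<open>h a\<close>
  times the relation from an expansion of \<open>g\<close> does not change \<open>g\<close> and
  clears the coefficient at \<open>a\<close>.\<close>

lemma approx_family_remove:
  assumes BO: "B \<subseteq> Obj C" and F: "approx_family M B I X f" and M: "M \<in> Obj C" and a: "a \<in> I"
    and w: "\<And>b. b \<in> I \<Longrightarrow> \<guillemotleft>w b : X b \<rightarrow> X a\<guillemotright>" "w a = idm (X a)"
    and rel: "(\<Oplus>\<^bsub>Hom C M (X a)\<^esub>b\<in>I. w b \<star> f b) = nul M (X a)"
  shows "approx_family M B (I - {a}) X f"
  unfolding approx_family_def
proof (intro conjI ballI allI impI)
  fix Y g assume Y: "Y \<in> B" and g: "\<guillemotleft>g : M \<rightarrow> Y\<guillemotright>"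
  obtain h where h: "\<forall>b\<in>I. \<guillemotleft>h b : X b \<rightarrow> Y\<guillemotright>" "g = (\<Oplus>\<^bsub>Hom C M Y\<^esub>b\<in>I. h b \<star> f b)"
    by (rule approx_familyD[OF F Y g])
  note h = h(1)[THEN bspec] h(2)
  have fin: "finite I" and f: "\<And>b. b \<in> I \<Longrightarrow> \<guillemotleft>f b : M \<rightarrow> X b\<guillemotright>" "\<And>b. b \<in> I \<Longrightarrow> X b \<in> Obj C"
    using F BO unfolding approx_family_def by blast+
  have Yo: "Y \<in> Obj C" using Y BO by blast
  interpret N: abelian_group "Hom C M Y" using M Yo by (simp add: hom_abelian)
  define k where "k b = h b \<boxminus> (h a \<star> w b)" for b
  have ha: "\<guillemotleft>h a : X a \<rightarrow> Y\<guillemotright>" using h a by blast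
  have hw: "\<guillemotleft>h a \<star> w b : X b \<rightarrow> Y\<guillemotright>" if "b \<in> I" for b using comp_hom[OF w(1)[OF that] ha] .
  have k: "\<guillemotleft>k b : X b \<rightarrow> Y\<guillemotright>" if "b \<in> I" for b
    unfolding k_def by (rule plus_hom(4)[OF h(1)[OF that] hw[OF that]])
  have wf: "\<guillemotleft>w b \<star> f b : M \<rightarrow> X a\<guillemotright>" if "b \<in> I" for b using comp_hom[OF f(1)[OF that] w(1)[OF that]] .
  have kf: "\<guillemotleft>k b \<star> f b : M \<rightarrow> Y\<guillemotright>" if "b \<in> I" for b using comp_hom[OF f(1)[OF that] k[OF that]] .
  have hwf: "\<guillemotleft>h a \<star> w b \<star> f b : M \<rightarrow> Y\<guillemotright>" if "b \<in> I" for b using comp_hom[OF wf[OF that] ha] .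
  have "g = (\<Oplus>\<^bsub>Hom C M Y\<^esub>b\<in>I. (k b \<star> f b) \<oplus>\<^bsub>Hom C M Y\<^esub> (h a \<star> w b \<star> f b))"
    unfolding h(2)
  proof (rule N.finsum_cong')
    fix b assume b: "b \<in> I"
    note [simp] = f(1)[OF b] w(1)[OF b] h(1)[OF b] k[OF b] ha
    have "(k b \<boxplus> (h a \<star> w b)) = h b" unfolding k_def by (rule add_minus_cancel(1)) simp_all
    then have "h b \<star> f b = (k b \<boxplus> (h a \<star> w b)) \<star> f b" by simp
    also have "\<dots> = (k b \<star> f b) \<boxplus> ((h a \<star> w b) \<star> f b)" by (rule comp_plus_distrib(2)) simp_all
    also have "\<dots> = (k b \<star> f b) \<oplus>\<^bsub>Hom C M Y\<^esub> (h a \<star> w b \<star> f b)"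
      unfolding plus_hom(1)[OF kf[OF b] hwf[OF b]] by simp
    finally show "h b \<star> f b = (k b \<star> f b) \<oplus>\<^bsub>Hom C M Y\<^esub> (h a \<star> w b \<star> f b)" .
  next
    show "(\<lambda>b. (k b \<star> f b) \<oplus>\<^bsub>Hom C M Y\<^esub> (h a \<star> w b \<star> f b)) \<in> I \<rightarrow> arr C M Y"
      using kf hwf homD by blast
  qed simp
  also have "\<dots> = (\<Oplus>\<^bsub>Hom C M Y\<^esub>b\<in>I. k b \<star> f b) \<oplus>\<^bsub>Hom C M Y\<^esub> (\<Oplus>\<^bsub>Hom C M Y\<^esub>b\<in>I. h a \<star> w b \<star> f b)"
    by (rule N.finsum_addf) (use kf hwf homD in blast)+
  also have "(\<Oplus>\<^bsub>Hom C M Y\<^esub>b\<in>I. h a \<star> w b \<star> f b) = h a \<star> (\<Oplus>\<^bsub>Hom C M (X a)\<^esub>b\<in>I. w b \<star> f b)"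
    by (rule comp_finsum(2)[OF fin wf M f(2)[OF a] ha, symmetric])
  also have "\<dots> = nul M Y" unfolding rel using ha M by simp
  also have "(\<Oplus>\<^bsub>Hom C M Y\<^esub>b\<in>I. k b \<star> f b) \<oplus>\<^bsub>Hom C M Y\<^esub> nul M Y = (\<Oplus>\<^bsub>Hom C M Y\<^esub>b\<in>I. k b \<star> f b)"
    by (rule N.r_zero, rule N.finsum_closed) (use kf homD in blast)
  also have "\<dots> = (k a \<star> f a) \<oplus>\<^bsub>Hom C M Y\<^esub> (\<Oplus>\<^bsub>Hom C M Y\<^esub>b\<in>I - {a}. k b \<star> f b)"
  proof -
    have "I = insert a (I - {a})" using a by blast
    moreover have "(\<Oplus>\<^bsub>Hom C M Y\<^esub>b\<in>insert a (I - {a}). k b \<star> f b)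
        = (k a \<star> f a) \<oplus>\<^bsub>Hom C M Y\<^esub> (\<Oplus>\<^bsub>Hom C M Y\<^esub>b\<in>I - {a}. k b \<star> f b)"
      using a kf fin homD by (intro N.finsum_insert) blast+
    ultimately show ?thesis by simp
  qed
  also have "k a = nul (X a) Y" unfolding k_def w(2) using ha by auto
  also have "nul (X a) Y \<star> f a = nul M Y" using f(1)[OF a] Yo by simp
  also have "nul M Y \<oplus>\<^bsub>Hom C M Y\<^esub> (\<Oplus>\<^bsub>Hom C M Y\<^esub>b\<in>I - {a}. k b \<star> f b) = (\<Oplus>\<^bsub>Hom C M Y\<^esub>b\<in>I - {a}. k b \<star> f b)"
    by (rule N.l_zero, rule N.finsum_closed) (use kf homD in blast)
  finally show "\<exists>h. (\<forall>b\<in>I - {a}. \<guillemotleft>h b : X b \<rightarrow> Y\<guillemotright>) \<and> g = (\<Oplus>\<^bsub>Hom C M Y\<^esub>b\<in>I - {a}. h b \<star> f b)"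
    using k by blast
qed (use F in \<open>auto simp: approx_family_def\<close>)

text \<open>This is the classical fact that \<open>1 - yx\<close> and \<open>1 - xy\<close> are
  invertible together: if \<open>u\<close> inverts the first, then \<open>1 + xuy\<close> inverts
  the second. It moves invertibility from a summand \<open>X\<close> to the whole sum
  \<open>S\<close>.\<close>

lemma inverse_swap:
  assumes x: "\<guillemotleft>x : X \<rightarrow> S\<guillemotright>" and y: "\<guillemotleft>y : S \<rightarrow> X\<guillemotright>" and u: "\<guillemotleft>u : X \<rightarrow> X\<guillemotright>"
    and inv: "u \<star> (idm X \<boxminus> (y \<star> x)) = idm X" "(idm X \<boxminus> (y \<star> x)) \<star> u = idm X"
  obtains v where "\<guillemotleft>v : S \<rightarrow> S\<guillemotright>" "v \<star> (idm S \<boxminus> (x \<star> y)) = idm S" "(idm S \<boxminus> (x \<star> y)) \<star> v = idm S"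
proof -
  note [simp] = x y u
  have o[simp]: "X \<in> Obj C" "S \<in> Obj C" using homD[OF x] by auto
  have "u \<boxminus> (u \<star> y \<star> x) = idm X" "u \<boxminus> (y \<star> x \<star> u) = idm X"
    using inv by simp_all
  then have u1: "u = idm X \<boxplus> (u \<star> y \<star> x)" "u = idm X \<boxplus> (y \<star> x \<star> u)"
    using add_minus_cancel(1)[of u "u \<star> y \<star> x"] add_minus_cancel(1)[of u "y \<star> x \<star> u"] by simp_all
  \<comment> \<open>Sandwiching the two equations \<open>u = 1 + uyx\<close> and
    \<open>u = 1 + yxu\<close> between \<open>x\<close> and \<open>y\<close> yields
    \<open>b = a + ba = a + ab\<close>. These two identities say that \<open>1 + b\<close> is a left
    and a right inverse of \<open>1 - a\<close>.\<close>
  define a where "a = x \<star> y"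
  define b where "b = x \<star> u \<star> y"
  have ab[simp]: "\<guillemotleft>a : S \<rightarrow> S\<guillemotright>" "\<guillemotleft>b : S \<rightarrow> S\<guillemotright>" by (simp_all add: a_def b_def)
  have "x \<star> (idm X \<boxplus> (u \<star> y \<star> x)) \<star> y = a \<boxplus> (b \<star> a)"
    "x \<star> (idm X \<boxplus> (y \<star> x \<star> u)) \<star> y = a \<boxplus> (a \<star> b)"
    by (simp_all add: comp_plus_distrib a_def b_def)
  then have b: "b = a \<boxplus> (b \<star> a)" "b = a \<boxplus> (a \<star> b)"
    using arg_cong[OF u1(1), of "\<lambda>z. x \<star> z \<star> y"] arg_cong[OF u1(2), of "\<lambda>z. x \<star> z \<star> y"]
    unfolding b_def by metis+
  have "(idm S \<boxplus> b) \<star> (idm S \<boxminus> a) = (idm S \<boxplus> b) \<boxminus> (a \<boxplus> (b \<star> a))"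
    by (simp add: comp_plus_distrib)
  then have 1: "(idm S \<boxplus> b) \<star> (idm S \<boxminus> a) = idm S"
    unfolding b(1)[symmetric] by (simp add: add_minus_cancel(2))
  have "a \<star> (idm S \<boxplus> b) = a \<boxplus> (a \<star> b)" by (simp add: comp_plus_distrib)
  then have "(idm S \<boxminus> a) \<star> (idm S \<boxplus> b) = (idm S \<boxplus> b) \<boxminus> (a \<boxplus> (a \<star> b))"
    using comp_minus_distrib(2)[of "idm S" a "idm S \<boxplus> b"] by simp
  then have 2: "(idm S \<boxminus> a) \<star> (idm S \<boxplus> b) = idm S"
    unfolding b(2)[symmetric] by (simp add: add_minus_cancel(2))
  show thesis
    by (rule that[of "idm S \<boxplus> b"]) (use 1 2 in \<open>simp_all add: a_def\<close>)
qed

text \<open>An approximating family of least cardinality admits no redundant component. If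
  \<open>\<phi>\<close> fixes the resulting map \<open>F\<close>, then
  \<open>r = idm S \<boxminus> \<phi>\<close> kills \<open>F\<close>, and irredundancy forces every
  diagonal entry of \<open>r\<close> to be a nonunit. Since the summands have local endomorphism
  rings, this makes \<open>idm S \<boxminus> r\<close>, which is \<open>\<phi>\<close>, invertible.
  Its inverse again fixes \<open>F\<close>.\<close>

lemma minimal_left_approx:
  assumes B: "subcategory C B" and cov: "covariantly_finite C B" and M: "M \<in> Obj C"
  obtains Y f where "Y \<in> B" "left_approx C B M Y f"
    "\<And>\<phi>. \<lbrakk>\<guillemotleft>\<phi> : Y \<rightarrow> Y\<guillemotright>; \<phi> \<star> f = f\<rbrakk> \<Longrightarrow> \<exists>\<psi>. \<guillemotleft>\<psi> : Y \<rightarrow> Y\<guillemotright> \<and> \<phi> \<star> \<psi> = idm Y \<and> \<psi> \<star> f = f"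
proof -
  have BO: "B \<subseteq> Obj C" using B by (simp add: subcategory_def)
  obtain Y0 f0 where "Y0 \<in> B" "left_approx C B M Y0 f0"
    using cov M unfolding covariantly_finite_def left_approx_def by blast
  then have "\<exists>I X f. approx_family M B I X f" using ex_approx_family B M by blast
  then have "\<exists>n I X f. approx_family M B I X f \<and> card I = n" by blast
  then obtain n where "\<exists>I X f. approx_family M B I X f \<and> card I = n"
    and least: "\<And>k. k < n \<Longrightarrow> \<not> (\<exists>I X f. approx_family M B I X f \<and> card I = k)"
    by (rule exists_least_iff[THEN iffD1, elim_format]) blast
  then obtain I X f where F: "approx_family M B I X f" and n: "card I = n" by blast
  have fin: "finite I" and XB: "\<forall>a\<in>I. X a \<in> B" and f: "\<And>a. a \<in> I \<Longrightarrow> \<guillemotleft>f a : M \<rightarrow> X a\<guillemotright>"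
    and loc: "\<And>a. a \<in> I \<Longrightarrow> local_ring (End_ring C (X a))"
    using F unfolding approx_family_def by blast+
  have irr: "\<not> approx_family M B (I - {a}) X f" if "a \<in> I" for a
  proof -
    have "card (I - {a}) < n" using card_Diff1_less[OF fin that] n by simp
    from least[OF this] show ?thesis by blast
  qed
  obtain S where S: "direct_sum C I X S" using ex_direct_sum[OF fin] XB BO by blast
  obtain i p where "finite I" "S \<in> Obj C" "\<forall>a\<in>I. X a \<in> Obj C"
    "\<forall>a\<in>I. \<guillemotleft>i a : X a \<rightarrow> S\<guillemotright>" "\<forall>a\<in>I. \<guillemotleft>p a : S \<rightarrow> X a\<guillemotright>"
    "\<forall>a\<in>I. p a \<star> i a = idm (X a)" "\<forall>a\<in>I. \<forall>b\<in>I. a \<noteq> b \<longrightarrow> p b \<star> i a = nul (X a) (X b)"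
    "(\<Oplus>\<^bsub>Hom C S S\<^esub>a\<in>I. i a \<star> p a) = idm S"
    by (rule direct_sum_homs[OF S])
  note [simp] = this(2) and Xo = this(3)[THEN bspec]
    and ip = this(4-6)[THEN bspec] this(7)[rule_format] this(8)
  have SB: "S \<in> B" using S XB B unfolding subcategory_def by blast
  have if1: "\<guillemotleft>i a \<star> f a : M \<rightarrow> S\<guillemotright>" if "a \<in> I" for a using comp_hom[OF f[OF that] ip(1)[OF that]] .
  have ipm: "\<guillemotleft>i a \<star> p a : S \<rightarrow> S\<guillemotright>" if "a \<in> I" for a using comp_hom[OF ip(2,1)[OF that]] .
  define F where "F = (\<Oplus>\<^bsub>Hom C M S\<^esub>a\<in>I. i a \<star> f a)"
  have Fm: "\<guillemotleft>F : M \<rightarrow> S\<guillemotright>" unfolding F_def by (rule comp_finsum(1)[OF fin if1 M]) simp_all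
  have gF: "g \<star> F = (\<Oplus>\<^bsub>Hom C M Y\<^esub>a\<in>I. (g \<star> i a) \<star> f a)" if g: "\<guillemotleft>g : S \<rightarrow> Y\<guillemotright>" for g Y
  proof -
    have Y: "Y \<in> Obj C" using g by auto
    interpret N: abelian_group "Hom C M Y" using M Y by (simp add: hom_abelian)
    have "g \<star> F = (\<Oplus>\<^bsub>Hom C M Y\<^esub>a\<in>I. g \<star> i a \<star> f a)"
      unfolding F_def by (rule comp_finsum(2)[OF fin if1 M _ g]) simp_all
    also have "\<dots> = (\<Oplus>\<^bsub>Hom C M Y\<^esub>a\<in>I. (g \<star> i a) \<star> f a)"
    proof (rule N.finsum_cong')
      show "(\<lambda>a. (g \<star> i a) \<star> f a) \<in> I \<rightarrow> arr C M Y"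
        using homD[OF comp_hom[OF f comp_hom[OF ip(1) g]]] by blast
      show "g \<star> i a \<star> f a = (g \<star> i a) \<star> f a" if "a \<in> I" for a
        using f[OF that] ip(1)[OF that] g by simp
    qed simp
    finally show ?thesis .
  qed
  have pF: "p a \<star> F = f a" if a: "a \<in> I" for a
  proof -
    interpret N: abelian_group "Hom C M (X a)" using M Xo[OF a] by (simp add: hom_abelian)
    have "p a \<star> F = (\<Oplus>\<^bsub>Hom C M (X a)\<^esub>b\<in>I. (p a \<star> i b) \<star> f b)" by (rule gF[OF ip(2)[OF a]])
    also have "\<dots> = (\<Oplus>\<^bsub>Hom C M (X a)\<^esub>b\<in>I. if a = b then f a else nul M (X a))"
    proof (rule N.finsum_cong')
      show "(\<lambda>b. if a = b then f a else nul M (X a)) \<in> I \<rightarrow> arr C M (X a)"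
        using homD[OF f[OF a]] by auto
      show "(p a \<star> i b) \<star> f b = (if a = b then f a else nul M (X a))" if b: "b \<in> I" for b
        using ip(3)[OF b] ip(4)[OF b a] f[OF b] Xo[OF a] by auto
    qed simp
    also have "\<dots> = f a"
      by (rule N.finsum_singleton[OF a fin, of "\<lambda>_. f a"]) (use homD[OF f[OF a]] in blast)
    finally show ?thesis .
  qed
  have approx: "left_approx C B M S F"
    unfolding left_approx_def
  proof (intro conjI ballI)
    fix Y g assume Y: "Y \<in> B" and "g \<in> arr C M Y"
    then have "\<guillemotleft>g : M \<rightarrow> Y\<guillemotright>" using M BO arr_iff by blast
    then obtain h where "\<forall>a\<in>I. \<guillemotleft>h a : X a \<rightarrow> Y\<guillemotright>"
      and g: "g = (\<Oplus>\<^bsub>Hom C M Y\<^esub>a\<in>I. h a \<star> f a)"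
      by (rule approx_familyD[OF F(1) Y])
    note h = this(1)[THEN bspec]
    have Yo: "Y \<in> Obj C" using Y BO by blast
    interpret N: abelian_group "Hom C M Y" using M Yo by (simp add: hom_abelian)
    have hp: "\<guillemotleft>h a \<star> p a : S \<rightarrow> Y\<guillemotright>" if "a \<in> I" for a using comp_hom[OF ip(2)[OF that] h[OF that]] .
    define H where "H = (\<Oplus>\<^bsub>Hom C S Y\<^esub>a\<in>I. h a \<star> p a)"
    have "H \<star> F = (\<Oplus>\<^bsub>Hom C M Y\<^esub>a\<in>I. (h a \<star> p a) \<star> F)"
      unfolding H_def by (rule comp_finsum(3)[OF fin hp _ Yo Fm]) simp_all
    also have "\<dots> = g" unfolding g
    proof (rule N.finsum_cong')
      show "(\<lambda>a. h a \<star> f a) \<in> I \<rightarrow> arr C M Y" using homD[OF comp_hom[OF f h]] by blast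
      show "(h a \<star> p a) \<star> F = h a \<star> f a" if a: "a \<in> I" for a
        using pF[OF a] h[OF a] ip(2)[OF a] Fm by simp
    qed simp
    finally show "\<exists>h\<in>arr C S Y. h \<star> F = g"
      using homD[OF comp_finsum(1)[OF fin hp _ Yo]] unfolding H_def by auto
  qed (use homD[OF Fm] in blast)
  \<comment> \<open>If a diagonal entry of \<open>r\<close> had an inverse \<open>u\<close>, the row
    \<open>q = u \<star> p a \<star> r\<close> would kill \<open>F\<close> and have coefficient one
    at \<open>a\<close>. It would be a relation that removes the component \<open>a\<close>, against
    the minimal cardinality.\<close>
  have nonunit: "\<nexists>u. \<guillemotleft>u : X a \<rightarrow> X a\<guillemotright> \<and> u \<star> (p a \<star> r \<star> i a) = idm (X a) \<and> (p a \<star> r \<star> i a) \<star> u = idm (X a)"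
    if a: "a \<in> I" and r: "\<guillemotleft>r : S \<rightarrow> S\<guillemotright>" "r \<star> F = nul M S" for a r
  proof
    assume "\<exists>u. \<guillemotleft>u : X a \<rightarrow> X a\<guillemotright> \<and> u \<star> (p a \<star> r \<star> i a) = idm (X a) \<and> (p a \<star> r \<star> i a) \<star> u = idm (X a)"
    then obtain u where u: "\<guillemotleft>u : X a \<rightarrow> X a\<guillemotright>" "u \<star> p a \<star> r \<star> i a = idm (X a)" by blast
    define q where "q = u \<star> p a \<star> r"
    have q: "\<guillemotleft>q : S \<rightarrow> X a\<guillemotright>" unfolding q_def using u(1) ip(2)[OF a] r(1) by simp
    have "q \<star> F = nul M (X a)"
      unfolding q_def using u(1) ip(2)[OF a] r Fm M by simp
    moreover have "q \<star> i a = idm (X a)"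
      unfolding q_def using u ip(1,2)[OF a] r by simp
    ultimately have "approx_family M B (I - {a}) X f"
      using gF[OF q] comp_hom[OF ip(1) q]
      by (intro approx_family_remove[OF BO F(1) M a, of "\<lambda>b. q \<star> i b"]) auto
    then show False using irr[OF a] by blast
  qed
  \<comment> \<open>Elimination of one summand at a time. The statement ranges over all
    \<open>J\<close> and keeps \<open>r\<close> arbitrary among the maps that kill \<open>F\<close>,
    so that the nonunit property can be applied to \<open>v \<star> r\<close>, with \<open>v\<close>
    the inverse found for the smaller set.\<close>
  have unit: "\<exists>v. \<guillemotleft>v : S \<rightarrow> S\<guillemotright> \<and> v \<star> (idm S \<boxminus> (r \<star> (\<Oplus>\<^bsub>Hom C S S\<^esub>a\<in>J. i a \<star> p a))) = idm S \<and>
      (idm S \<boxminus> (r \<star> (\<Oplus>\<^bsub>Hom C S S\<^esub>a\<in>J. i a \<star> p a))) \<star> v = idm S"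
    if "J \<subseteq> I" and r: "\<guillemotleft>r : S \<rightarrow> S\<guillemotright>" "r \<star> F = nul M S" for J r
    using finite_subset[OF that(1) fin] that(1)
  proof (induction J rule: finite_induct)
    case empty
    interpret N: abelian_group "Hom C S S" by (simp add: hom_abelian)
    show ?case using r by (intro exI[of _ "idm S"]) simp
  next
    case (insert a J)
    interpret N: abelian_group "Hom C S S" by (simp add: hom_abelian)
    define e where "e = (\<Oplus>\<^bsub>Hom C S S\<^esub>a\<in>J. i a \<star> p a)"
    have e: "\<guillemotleft>e : S \<rightarrow> S\<guillemotright>" unfolding e_def
      by (rule comp_finsum(1)) (use insert ipm in auto)
    have a: "a \<in> I" using insert by blast
    note [simp] = e ipm[OF a] ip(1,2)[OF a] r(1) Fm M
    have e': "(\<Oplus>\<^bsub>Hom C S S\<^esub>a\<in>insert a J. i a \<star> p a) = (i a \<star> p a) \<boxplus> e"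
    proof -
      have "(\<lambda>a. i a \<star> p a) \<in> J \<rightarrow> arr C S S" "i a \<star> p a \<in> arr C S S"
        using ipm homD insert by blast+
      from N.finsum_insert[OF insert(1,2) this] show ?thesis
        using plus_hom(1)[OF ipm[OF a] e] by (simp add: e_def)
    qed
    obtain v where v: "\<guillemotleft>v : S \<rightarrow> S\<guillemotright>" "v \<star> (idm S \<boxminus> (r \<star> e)) = idm S" "(idm S \<boxminus> (r \<star> e)) \<star> v = idm S"
      using insert unfolding e_def by blast
    note [simp] = v(1)
    have r': "\<guillemotleft>v \<star> r : S \<rightarrow> S\<guillemotright>" "(v \<star> r) \<star> F = nul M S" using r by simp_all
    have "\<guillemotleft>p a \<star> (v \<star> r) \<star> i a : X a \<rightarrow> X a\<guillemotright>" by simp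
    then obtain u where "\<guillemotleft>u : X a \<rightarrow> X a\<guillemotright>" "u \<star> (idm (X a) \<boxminus> (p a \<star> (v \<star> r) \<star> i a)) = idm (X a)"
      "(idm (X a) \<boxminus> (p a \<star> (v \<star> r) \<star> i a)) \<star> u = idm (X a)"
      using local_End_unit[OF loc[OF a]] nonunit[OF a r'] by metis
    then obtain w where w: "\<guillemotleft>w : S \<rightarrow> S\<guillemotright>" "w \<star> (idm S \<boxminus> (((v \<star> r) \<star> i a) \<star> p a)) = idm S"
      "(idm S \<boxminus> (((v \<star> r) \<star> i a) \<star> p a)) \<star> w = idm S"
      using inverse_swap[of "(v \<star> r) \<star> i a" "X a" S "p a" u] by auto
    note [simp] = w(1)
    \<comment> \<open>Adding one idempotent multiplies by one more factor: with \<open>v\<close>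
      inverse to \<open>1 - re\<close>, one has
      \<open>1 - r(e + i p) = (1 - re)(1 - v r i p)\<close>. The second factor is invertible by
      swapping \<open>v r i\<close> with \<open>p\<close>, which leads back to the local ring at
      \<open>a\<close>.\<close>
    have "(idm S \<boxminus> (r \<star> e)) \<star> (idm S \<boxminus> (((v \<star> r) \<star> i a) \<star> p a))
        = (idm S \<boxminus> (r \<star> e)) \<boxminus> (((idm S \<boxminus> (r \<star> e)) \<star> v) \<star> (r \<star> i a \<star> p a))"
      by (simp del: comp_minus_distrib(2))
    also have "\<dots> = idm S \<boxminus> ((r \<star> e) \<boxplus> (r \<star> i a \<star> p a))"
      unfolding v(3) by (subst minus_minus_plus[of _ S S]) simp_all
    also have "\<dots> = idm S \<boxminus> (r \<star> ((i a \<star> p a) \<boxplus> e))"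
      by (simp add: comp_plus_distrib add_minus_cancel(4)[of "r \<star> e"])
    finally have eq: "idm S \<boxminus> (r \<star> ((i a \<star> p a) \<boxplus> e))
        = (idm S \<boxminus> (r \<star> e)) \<star> (idm S \<boxminus> (((v \<star> r) \<star> i a) \<star> p a))" by simp
    define A where "A = idm S \<boxminus> (r \<star> e)"
    define D where "D = idm S \<boxminus> (((v \<star> r) \<star> i a) \<star> p a)"
    have [simp]: "\<guillemotleft>A : S \<rightarrow> S\<guillemotright>" "\<guillemotleft>D : S \<rightarrow> S\<guillemotright>" by (simp_all add: A_def D_def)
    note AD = v(2,3)[folded A_def] w(2,3)[folded D_def]
    have "(w \<star> v) \<star> (A \<star> D) = idm S" "(A \<star> D) \<star> (w \<star> v) = idm S"
      using AD by (simp_all add: comp_reassoc[OF AD(1)] comp_reassoc[OF AD(4)])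
    then show ?case unfolding e' eq A_def[symmetric] D_def[symmetric]
      by (intro exI[of _ "w \<star> v"]) simp
  qed
  show thesis
  proof (rule that[OF SB approx])
    fix \<phi> assume \<phi>: "\<guillemotleft>\<phi> : S \<rightarrow> S\<guillemotright>" "\<phi> \<star> F = F"
    note [simp] = \<phi>(1) Fm
    have r: "\<guillemotleft>idm S \<boxminus> \<phi> : S \<rightarrow> S\<guillemotright>" "(idm S \<boxminus> \<phi>) \<star> F = nul M S" using \<phi>(2) by simp_all
    \<comment> \<open>For \<open>J = I\<close> the idempotents add up to the identity, so the
      elimination yields an inverse of \<open>\<phi>\<close> itself.\<close>
    have "idm S \<boxminus> ((idm S \<boxminus> \<phi>) \<star> idm S) = \<phi>" by (simp add: add_minus_cancel)
    then obtain v where v: "\<guillemotleft>v : S \<rightarrow> S\<guillemotright>" "v \<star> \<phi> = idm S" "\<phi> \<star> v = idm S"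
      using unit[OF order_refl r] unfolding ip(5) by auto
    have "v \<star> F = v \<star> \<phi> \<star> F" using \<phi> by simp
    then have "v \<star> F = F" using v by (simp add: comp_reassoc[OF v(2)])
    then show "\<exists>\<psi>. \<guillemotleft>\<psi> : S \<rightarrow> S\<guillemotright> \<and> \<phi> \<star> \<psi> = idm S \<and> \<psi> \<star> F = F" using v by blast
  qed
qed

end

section \<open>Extension closed subcategories\<close>

lemma full_subcat_simps [simp]:
  "Obj (full_subcat C B) = B" "Hom (full_subcat C B) = Hom C" "ident (full_subcat C B) = ident C"
  "g \<cdot>\<^bsub>full_subcat C B\<^esub> f = g \<cdot>\<^bsub>C\<^esub> f"
  by (simp_all add: full_subcat_def)

lemma inherited_exact_iff [simp]:
  "(X, i, Y, p, Z) \<in> inherited_exact E B \<longleftrightarrow> (X, i, Y, p, Z) \<in> E \<and> X \<in> B \<and> Y \<in> B \<and> Z \<in> B"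
  by (simp add: inherited_exact_def)

lemma op_full_subcat: "op_cat (full_subcat C B) = full_subcat (op_cat C) B"
  by (simp add: op_cat_def full_subcat_def fun_eq_iff)

lemma op_inherited_exact: "op_exact (inherited_exact E B) = inherited_exact (op_exact E) B"
  by (auto simp: op_exact_def inherited_exact_def)

lemma (in k_category) iso_arr_sym: "(\<exists>f. iso_arr C X Y f) \<Longrightarrow> \<exists>f. iso_arr C Y X f"
  using iso_arr_inverse by blast

lemma (in k_category) subcategory_op:
  assumes "subcategory C B"
  shows "subcategory (op_cat C) B"
proof -
  have *: "\<forall>X\<in>B. \<forall>Y\<in>Obj C. (\<exists>f. iso_arr C Y X f) \<longrightarrow> Y \<in> B"
    using assms iso_arr_sym unfolding subcategory_def by blast
  show ?thesis
    using assms unfolding subcategory_def op_cat_simps iso_arr_op direct_sum_op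
    by (elim conjE, intro conjI *) assumption+
qed

lemma extension_closed_op: "extension_closed E B \<Longrightarrow> extension_closed (op_exact E) B"
  unfolding extension_closed_def op_exact_def by fast

section \<open>Additive and Krull-Schmidt structure of full subcategories\<close>

lemma k_category_full_subcat:
  assumes "k_category K C" "B \<subseteq> Obj C"
  shows "k_category K (full_subcat C B)"
proof -
  interpret k_category K C by fact
  have o: "X \<in> Obj C" if "X \<in> B" for X using that assms(2) by blast
  show ?thesis
    apply (intro k_category.intro k_category_axioms.intro; (simp only: full_subcat_simps)?)
    subgoal by unfold_locales
    subgoal by (intro hom_module o)
    subgoal using hom_disjoint o by blast
    subgoal by (intro ident_closed o)
    subgoal by (rule comp_closed[OF o o o])
    subgoal by (rule comp_assoc[OF o o o o])
    subgoal by (rule ident_left[OF o o])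
    subgoal by (rule ident_right[OF o o])
    subgoal by (rule comp_add_left[OF o o o])
    subgoal by (rule comp_add_right[OF o o o])
    subgoal by (rule comp_smult_left[OF o o o])
    subgoal by (rule comp_smult_right[OF o o o])
    done
qed

lemma iso_arr_full_subcat [simp]: "iso_arr (full_subcat C B) X Y f \<longleftrightarrow> iso_arr C X Y f"
  by (simp add: iso_arr_def)

lemma direct_sum_full_subcat:
  "\<lbrakk>direct_sum C I X S; S \<in> B; \<forall>a\<in>I. X a \<in> B\<rbrakk> \<Longrightarrow> direct_sum (full_subcat C B) I X S"
  by (simp add: direct_sum_def)

lemma additive_category_full_subcat:
  assumes "additive_category K C" "subcategory C B"
  shows "additive_category K (full_subcat C B)"
proof -
  interpret additive_category K C by fact
  have BO: "B \<subseteq> Obj C" using assms(2) by (simp add: subcategory_def)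
  interpret D: k_category K "full_subcat C B"
    by (rule k_category_full_subcat[OF _ BO]) unfold_locales
  show ?thesis
  proof (unfold_locales, simp only: full_subcat_simps)
    fix I :: "nat set" and X assume I: "finite I" "\<forall>a\<in>I. X a \<in> B"
    then obtain S where S: "direct_sum C I X S" using ex_direct_sum BO by blast
    then have "S \<in> B" using assms(2) I unfolding subcategory_def by blast
    then show "\<exists>S. direct_sum (full_subcat C B) I X S"
      using direct_sum_full_subcat[OF S] I by blast
  qed
qed

lemma krull_schmidt_category_full_subcat:
  assumes "krull_schmidt_category K C" "subcategory C B"
  shows "krull_schmidt_category K (full_subcat C B)"
proof -
  interpret krull_schmidt_category K C by fact
  have BO: "B \<subseteq> Obj C" using assms(2) by (simp add: subcategory_def)
  interpret D: additive_category K "full_subcat C B"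
    by (rule additive_category_full_subcat[OF _ assms(2)]) unfold_locales
  have End: "End_ring (full_subcat C B) X = End_ring C X" for X
    by (simp add: End_ring_def full_subcat_def)
  show ?thesis
  proof (unfold_locales, simp only: full_subcat_simps End)
    fix S assume S: "S \<in> B"
    obtain I :: "nat set" and X where X: "direct_sum C I X S" "\<forall>a\<in>I. local_ring (End_ring C (X a))"
      using krull_schmidt S BO by blast
    have XB: "\<forall>a\<in>I. X a \<in> B" using X(1) S assms(2) unfolding subcategory_def by blast
    show "\<exists>(I :: nat set) X. direct_sum (full_subcat C B) I X S \<and>
        (\<forall>a\<in>I. local_ring (End_ring C (X a)))"
      by (intro exI conjI, rule direct_sum_full_subcat[OF X(1) S XB], rule X(2))
  qed
qed

section \<open>The inherited exact structure\<close>

locale extension_closed_subcategory = exact_category +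
  fixes B
  assumes subcat: "subcategory C B"
    and ext_closed: "extension_closed E B"
begin

lemma B_obj: "X \<in> B \<Longrightarrow> X \<in> Obj C"
  using subcat unfolding subcategory_def by blast

lemma ext_closedD: "\<lbrakk>(X, i, Y, p, Z) \<in> E; X \<in> B; Z \<in> B\<rbrakk> \<Longrightarrow> Y \<in> B"
  using ext_closed unfolding extension_closed_def by blast

lemma arr_B_iff: "\<lbrakk>X \<in> B; Y \<in> B\<rbrakk> \<Longrightarrow> f \<in> arr C X Y \<longleftrightarrow> \<guillemotleft>f : X \<rightarrow> Y\<guillemotright>"
  using arr_iff B_obj by blast

text \<open>The cokernel of an identity is a zero object, that is, a direct sum of the empty family,
  so closure under finite sums places it in \<open>B\<close>.\<close>

lemma inherited_inflation_ident:
  assumes "X \<in> B"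
  shows "inflation (inherited_exact E B) X X (idm X)"
proof -
  obtain p Z where E: "(X, idm X, X, p, Z) \<in> E"
    using inflation_ident[OF B_obj[OF assms]] by (auto simp: inflation_def)
  note m = conflD[OF E]
  have "p = nul X Z" using m by simp
  then have "idm Z \<star> p = nul Z Z \<star> p" using m by simp
  then have z: "idm Z = nul Z Z" using confl_epi[OF E, of "idm Z" Z "nul Z Z"] m by simp
  interpret Z: abelian_group "Hom C Z Z" using m by (simp add: hom_abelian)
  have "direct_sum C ({} :: nat set) (\<lambda>_. X) Z"
    unfolding direct_sum_def using m z by simp
  then have "Z \<in> B" using subcat unfolding subcategory_def by blast
  then show ?thesis using E assms by (auto simp: inflation_def)
qed

text \<open>
  The pushout of \<open>j\<close> along the cokernel of \<open>i\<close> is a cokernel of \<open>j \<circ> i\<close>, and it is an extension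
  of the cokernel of \<open>j\<close> by the cokernel of \<open>i\<close>.
\<close>

lemma inherited_inflation_comp:
  assumes "inflation (inherited_exact E B) X Y i" "inflation (inherited_exact E B) Y W j"
  shows "inflation (inherited_exact E B) X W (j \<star> i)"
proof -
  obtain p Z where E1: "(X, i, Y, p, Z) \<in> E" and B1: "X \<in> B" "Y \<in> B" "Z \<in> B"
    using assms(1) by (auto simp: inflation_def)
  obtain q V where E2: "(Y, j, W, q, V) \<in> E" and B2: "W \<in> B" "V \<in> B"
    using assms(2) by (auto simp: inflation_def)
  note m1 = conflD[OF E1] and m2 = conflD[OF E2]
  have "inflation E X W (j \<star> i)"
    using inflation_comp E1 E2 unfolding inflation_def by blast
  then obtain r U where E3: "(X, j \<star> i, W, r, U) \<in> E" by (auto simp: inflation_def)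
  obtain P j' p' q' where P: "P \<in> Obj C" and po: "is_pushout C Y W Z P j p j' p'"
    and E4: "(Z, j', P, q', V) \<in> E"
    by (rule pushout_conflation[OF E2 m1(5)])
  note Q = pushoutD[OF po m2(1,2) m1(3) P]
  have PB: "P \<in> B" using ext_closedD[OF E4] B1 B2 by blast
  have "is_cokernel C X W P (j \<star> i) p'"
    unfolding is_cokernel_def
  proof (intro conjI ballI impI)
    have "p' \<star> j \<star> i = j' \<star> p \<star> i"
      using Q(1-4) m1(4,5) m2(4) by (simp add: comp_reassoc[OF Q(5)[symmetric]])
    also have "\<dots> = nul X P" using Q(3) m1 by simp
    finally show "p' \<star> j \<star> i = nul X P" .
    show "j \<star> i \<in> arr C X W" "p' \<in> arr C W P" 
      using homD[OF comp_hom[OF m1(4) m2(4)]] homD[OF Q(4)] by blast+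
    fix T g assume "T \<in> Obj C" "g \<in> arr C W T" and g0: "g \<star> j \<star> i = nul X T"
    then have g: "\<guillemotleft>g : W \<rightarrow> T\<guillemotright>" and T: "T \<in> Obj C" using m2 arr_iff by auto
    \<comment> \<open>A map \<open>g\<close> that kills the composite factors on \<open>Y\<close>
      through \<open>p\<close>; the factor \<open>u\<close> and \<open>g\<close> glue to a map on
      the pushout. Uniqueness holds because a map on the pushout is fixed by its value along
      \<open>p'\<close>: its value along \<open>j'\<close> is then determined, as \<open>p\<close>
      is epic.\<close>
    obtain u where u: "\<guillemotleft>u : Z \<rightarrow> T\<guillemotright>" "u \<star> p = g \<star> j"
      by (rule confl_coker[OF E1, of "g \<star> j" T]) (use g m1 m2 g0 in auto)
    obtain h where h: "\<guillemotleft>h : P \<rightarrow> T\<guillemotright>" "h \<star> j' = u" "h \<star> p' = g"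
      using Q(6)[OF u(1) g u(2)] by blast
    have "h' = h" if h': "\<guillemotleft>h' : P \<rightarrow> T\<guillemotright>" "h' \<star> p' = g" for h'
    proof (rule Q(7)[OF h'(1) h(1)])
      have "h' \<star> j' \<star> p = h' \<star> p' \<star> j" unfolding Q(5) by simp
      also have "\<dots> = h \<star> p' \<star> j"
        using h'(1) h(1) Q(4) m2(4) by (simp add: comp_reassoc[OF h'(2)] comp_reassoc[OF h(3)])
      also have "\<dots> = h \<star> j' \<star> p" unfolding Q(5) by simp
      finally have "(h' \<star> j') \<star> p = (h \<star> j') \<star> p" using Q(3) h(1) h'(1) m1(5) by simp
      then show "h' \<star> j' = h \<star> j'"
        using confl_epi[OF E1, of "h' \<star> j'" T "h \<star> j'"] h'(1) h(1) Q(3) by simp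
      show "h' \<star> p' = h \<star> p'" using h' h by simp
    qed
    then show "\<exists>!h. h \<in> arr C P T \<and> h \<star> p' = g"
      using h arr_iff[OF P T] by blast
  qed
  then have "(X, j \<star> i, W, p', P) \<in> E" using conflation_replace_coker[OF E3] P by blast
  then show ?thesis using B1 B2 PB by (auto simp: inflation_def)
qed

text \<open>The pushout formed in C is an extension of \<open>Z\<close> by \<open>X'\<close>, both
  in \<open>B\<close>, so it lies in \<open>B\<close>; its universal property persists when fewer
  objects are tested.\<close>

lemma inherited_inflation_pushout:
  assumes "inflation (inherited_exact E B) X Y i" "X' \<in> B" "f \<in> arr C X X'"
  shows "\<exists>Y'\<in>B. \<exists>i' f'. is_pushout (full_subcat C B) X Y X' Y' i f i' f' \<and>
    inflation (inherited_exact E B) X' Y' i'"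
proof -
  obtain p Z where E: "(X, i, Y, p, Z) \<in> E" and B: "X \<in> B" "Y \<in> B" "Z \<in> B"
    using assms(1) by (auto simp: inflation_def)
  have f: "\<guillemotleft>f : X \<rightarrow> X'\<guillemotright>" using assms B arr_B_iff by blast
  obtain Y' i' f' p' where Y': "is_pushout C X Y X' Y' i f i' f'" "(X', i', Y', p', Z) \<in> E"
    by (rule pushout_conflation[OF E f])
  then have "Y' \<in> B" using ext_closedD assms B by blast
  moreover have "is_pushout (full_subcat C B) X Y X' Y' i f i' f'"
    using Y'(1) B_obj by (simp add: is_pushout_def)
  ultimately show ?thesis using Y' B assms(2) by (auto simp: inflation_def)
qed

lemma extension_closed_subcategory_op:
  "extension_closed_subcategory K (op_cat C) (op_exact E) B"
proof -
  interpret op: exact_category K "op_cat C" "op_exact E"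
    by (rule exact_category_op) unfold_locales
  show ?thesis
    by unfold_locales (rule subcategory_op[OF subcat], rule extension_closed_op[OF ext_closed])
qed

text \<open>Fullness keeps kernels and cokernels, and the axioms on deflations are those on
  inflations for the opposite category, in which \<open>B\<close> is again extension closed.\<close>

lemma exact_category_inherited:
  "exact_category K (full_subcat C B) (inherited_exact E B)"
proof -
  interpret op: extension_closed_subcategory K "op_cat C" "op_exact E" B
    by (rule extension_closed_subcategory_op)
  interpret D: additive_category K "full_subcat C B"
    by (rule additive_category_full_subcat[OF _ subcat]) unfold_locales
  note op_defs = op_inherited_exact[symmetric] op_full_subcat[symmetric]
  show ?thesis
  proof (unfold_locales; (simp only: full_subcat_simps iso_arr_full_subcat)?)
    fix X i Y p Z assume "(X, i, Y, p, Z) \<in> inherited_exact E B"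
    then have E: "(X, i, Y, p, Z) \<in> E" and B: "X \<in> B" "Y \<in> B" "Z \<in> B" by auto
    show "X \<in> B \<and> Y \<in> B \<and> Z \<in> B \<and>
        is_kernel (full_subcat C B) X Y Z i p \<and> is_cokernel (full_subcat C B) X Y Z i p"
      using conflation[OF E] B B_obj by (simp add: is_kernel_def is_cokernel_def)
  next
    fix X i Y p Z X' Y' Z' i' p' a b c
    assume "(X, i, Y, p, Z) \<in> inherited_exact E B" "X' \<in> B" "Y' \<in> B" "Z' \<in> B"
      "i' \<in> arr C X' Y'" "p' \<in> arr C Y' Z'" "iso_arr C X X' a" "iso_arr C Y Y' b" "iso_arr C Z Z' c"
      "b \<star> i = i' \<star> a" "c \<star> p = p' \<star> b"
    then show "(X', i', Y', p', Z') \<in> inherited_exact E B"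
      using conflation_iso[of X i Y p Z X' Y' Z' i' p' a b c] B_obj by simp
  next
    fix X assume "X \<in> B"
    then show "inflation (inherited_exact E B) X X (idm X)" "deflation (inherited_exact E B) X X (idm X)"
      using inherited_inflation_ident op.inherited_inflation_ident unfolding op_defs by simp_all
  next
    fix X Y i Z j assume "inflation (inherited_exact E B) X Y i" "inflation (inherited_exact E B) Y Z j"
    then show "inflation (inherited_exact E B) X Z (j \<star> i)" by (rule inherited_inflation_comp)
  next
    fix X Y i Z j assume "deflation (inherited_exact E B) X Y i" "deflation (inherited_exact E B) Y Z j"
    then show "deflation (inherited_exact E B) X Z (j \<star> i)"
      using op.inherited_inflation_comp[of Z Y j X i] unfolding op_defs by simp
  next
    fix X Y i X' f assume "inflation (inherited_exact E B) X Y i" "X' \<in> B" "f \<in> arr C X X'"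
    then show "\<exists>Y'\<in>B. \<exists>i' f'. is_pushout (full_subcat C B) X Y X' Y' i f i' f' \<and>
      inflation (inherited_exact E B) X' Y' i'" by (rule inherited_inflation_pushout)
  next
    fix Y Z p Z' f assume "deflation (inherited_exact E B) Y Z p" "Z' \<in> B" "f \<in> arr C Z' Z"
    then show "\<exists>Y'\<in>B. \<exists>p' f'. is_pullback (full_subcat C B) Y Z Y' Z' p f p' f' \<and>
      deflation (inherited_exact E B) Y' Z' p'"
      using op.inherited_inflation_pushout[of Z Y p Z' f] unfolding op_defs by simp
  qed
qed

end

section \<open>Enough projectives and injectives in the subcategory\<close>

context extension_closed_subcategory
begin

text \<open>
  Wakamatsu's lemma: push out a projective presentation of \<open>Z\<close> along a minimal left approximation
  of its kernel. A conflation ending in the pushout object splits, since the approximation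
  lifts along it.
\<close>

lemma wakamatsu_splitting:
  assumes E1: "(L, k, P, \<pi>, Z) \<in> E" and P: "projective C E P"
    and f: "left_approx C B L A f" "A \<in> B"
    and minimal: "\<And>\<phi>. \<lbrakk>\<guillemotleft>\<phi> : A \<rightarrow> A\<guillemotright>; \<phi> \<star> f = f\<rbrakk> \<Longrightarrow> \<exists>\<psi>. \<guillemotleft>\<psi> : A \<rightarrow> A\<guillemotright> \<and> \<phi> \<star> \<psi> = idm A \<and> \<psi> \<star> f = f"
    and po: "is_pushout C L P A Q k f j g" "Q \<in> Obj C"
    and E2: "(X, i, Y, p, Q) \<in> E" and X: "X \<in> B"
  obtains s where "\<guillemotleft>s : Q \<rightarrow> Y\<guillemotright>" "p \<star> s = idm Q"
proof -
  note m1 = conflD[OF E1] and m2 = conflD[OF E2]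
  note A = B_obj[OF f(2)]
  note Po = pushoutD[OF po(1) m1(1,2) A po(2)]
  obtain g' where g': "\<guillemotleft>g' : P \<rightarrow> Y\<guillemotright>" "p \<star> g' = g"
  proof -
    have "deflation E Y Q p" using E2 by (auto simp: deflation_def)
    then obtain g' where "g' \<in> arr C P Y" "p \<star> g' = g"
      using P homD[OF Po(4)] unfolding projective_def by blast
    with that homI[OF m1(2) m2(2)] show thesis by blast
  qed
  obtain Y' p' j' i' where Y': "Y' \<in> Obj C" and pb: "is_pullback C Y Q Y' A p j p' j'"
    and E3: "(X, i', Y', p', A) \<in> E"
    by (rule pullback_conflation[OF E2 Po(3)])
  note Pb = pullbackD[OF pb m2(2,3) Y' A]
  have "j \<star> f = p \<star> (g' \<star> k)"
    unfolding Po(5) using g' Po m2 by (simp add: comp_reassoc[OF g'(2)])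
  then obtain l where l: "\<guillemotleft>l : L \<rightarrow> Y'\<guillemotright>" "p' \<star> l = f" "j' \<star> l = g' \<star> k"
    using Pb(6)[of f L "g' \<star> k"] Po g' by auto
  \<comment> \<open>The pullback is an extension of \<open>A\<close> by \<open>X\<close>, hence an
    admissible target for the approximation \<open>f\<close>: the lift \<open>l\<close> of
    \<open>f\<close> extends from \<open>L\<close> to \<open>A\<close>.\<close>
  have YB: "Y' \<in> B" using ext_closedD[OF E3 X f(2)] .
  obtain m where m: "\<guillemotleft>m : A \<rightarrow> Y'\<guillemotright>" "m \<star> f = l"
  proof -
    have "l \<in> arr C L Y'" using homD[OF l(1)] by blast
    then obtain m where "m \<in> arr C A Y'" "m \<star> f = l" using f YB unfolding left_approx_def by blast
    with that homI[OF A Y'] show thesis by blast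
  qed
  \<comment> \<open>The composite \<open>p' \<star> m\<close> need not be the identity, but it fixes
    \<open>f\<close>. Minimality corrects it: \<open>m \<star> \<psi>\<close> is a section of
    \<open>p'\<close> whose restriction along \<open>f\<close> is still \<open>l\<close>.\<close>
  have "\<guillemotleft>p' \<star> m : A \<rightarrow> A\<guillemotright>" "(p' \<star> m) \<star> f = f" using m Pb Po l by simp_all
  from minimal[OF this] obtain \<psi> where \<psi>: "\<guillemotleft>\<psi> : A \<rightarrow> A\<guillemotright>" "(p' \<star> m) \<star> \<psi> = idm A" "\<psi> \<star> f = f"
    by blast
  have "p \<star> j' \<star> m \<star> \<psi> = j \<star> p' \<star> m \<star> \<psi>"
    using Pb(1-4) m(1) \<psi>(1) by (simp add: comp_reassoc[OF Pb(5)[symmetric]])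
  also have "\<dots> = j" using \<psi>(1,2) Pb(3) m(1) Po(3) by simp
  finally have pj: "p \<star> j' \<star> m \<star> \<psi> = j" .
  \<comment> \<open>The section is glued on the pushout: on \<open>A\<close> it is
    \<open>j' \<star> m \<star> \<psi>\<close>, on \<open>P\<close> it is the lift \<open>g'\<close>
    given by projectivity, and the two agree on \<open>L\<close>.\<close>
  have "(j' \<star> m \<star> \<psi>) \<star> f = g' \<star> k" using \<psi> Pb m Po l by simp
  then obtain s where s: "\<guillemotleft>s : Q \<rightarrow> Y\<guillemotright>" "s \<star> j = j' \<star> m \<star> \<psi>" "s \<star> g = g'"
    using Po(6)[of "j' \<star> m \<star> \<psi>" Y g'] \<psi> Pb m g' by auto
  have "p \<star> s = idm Q"
  proof (rule Po(7)[of _ Q])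
    show "(p \<star> s) \<star> j = idm Q \<star> j" using s m2 Po pj by simp
    show "(p \<star> s) \<star> g = idm Q \<star> g" using s m2 Po g' by simp
  qed (use s m2 in simp_all)
  with s that show thesis by blast
qed

text \<open>Pulling a deflation back along \<open>h\<close> turns the lifting of \<open>h\<close>
  into the splitting of a conflation that ends in \<open>Q\<close> and has the same kernel.\<close>

lemma inherited_projectiveI:
  assumes Q: "Q \<in> B"
    and split: "\<And>X i Y p. \<lbrakk>(X, i, Y, p, Q) \<in> E; X \<in> B\<rbrakk> \<Longrightarrow> \<exists>s. \<guillemotleft>s : Q \<rightarrow> Y\<guillemotright> \<and> p \<star> s = idm Q"
  shows "projective (full_subcat C B) (inherited_exact E B) Q"
  unfolding projective_def full_subcat_simps
proof (intro conjI allI impI Q)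
  fix Y W p h assume "deflation (inherited_exact E B) Y W p \<and> h \<in> arr C Q W"
  then obtain X i where E: "(X, i, Y, p, W) \<in> E" and B: "X \<in> B" "Y \<in> B" "W \<in> B"
    and h: "\<guillemotleft>h : Q \<rightarrow> W\<guillemotright>"
    using arr_B_iff[OF Q] by (auto simp: deflation_def)
  obtain Y' p' h' i' where Y': "Y' \<in> Obj C" and pb: "is_pullback C Y W Y' Q p h p' h'"
    and E3: "(X, i', Y', p', Q) \<in> E"
    by (rule pullback_conflation[OF E h])
  note Pb = pullbackD[OF pb conflD(2,3)[OF E] Y' B_obj[OF Q]]
  obtain s where s: "\<guillemotleft>s : Q \<rightarrow> Y'\<guillemotright>" "p' \<star> s = idm Q" using split[OF E3 B(1)] by blast
  have "p \<star> h' \<star> s = h \<star> p' \<star> s" 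
    using Pb(1-4) s(1) by (simp add: comp_reassoc[OF Pb(5)[symmetric]])
  then have "p \<star> h' \<star> s = h" using s h by simp
  then show "\<exists>g\<in>arr C Q Y. p \<star> g = h" using homD[OF comp_hom[OF s(1) Pb(4)]] by blast
qed

end

lemma enough_projectives_inherited:
  assumes "krull_schmidt_category K C" "extension_closed_subcategory K C E B"
    and "enough_projectives C E" "covariantly_finite C B"
  shows "enough_projectives (full_subcat C B) (inherited_exact E B)"
  unfolding enough_projectives_def full_subcat_simps
proof
  interpret krull_schmidt_category K C by fact
  interpret extension_closed_subcategory K C E B by fact
  fix Z assume Z: "Z \<in> B"
  obtain P \<pi> where P: "projective C E P" "deflation E P Z \<pi>"
    using assms(3) B_obj[OF Z] unfolding enough_projectives_def by blast
  then obtain L k where E1: "(L, k, P, \<pi>, Z) \<in> E" by (auto simp: deflation_def)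
  obtain A f where A: "A \<in> B" and f: "left_approx C B L A f"
    and minimal: "\<And>\<phi>. \<lbrakk>\<guillemotleft>\<phi> : A \<rightarrow> A\<guillemotright>; \<phi> \<star> f = f\<rbrakk> \<Longrightarrow> \<exists>\<psi>. \<guillemotleft>\<psi> : A \<rightarrow> A\<guillemotright> \<and> \<phi> \<star> \<psi> = idm A \<and> \<psi> \<star> f = f"
    by (rule minimal_left_approx[OF subcat assms(4) conflD(1)[OF E1]]) blast
  have "\<guillemotleft>f : L \<rightarrow> A\<guillemotright>"
    using f homI[OF conflD(1)[OF E1] B_obj[OF A]] by (simp add: left_approx_def)
  then obtain Q j g q where Q: "Q \<in> Obj C" and po: "is_pushout C L P A Q k f j g"
    and E2: "(A, j, Q, q, Z) \<in> E"
    by (rule pushout_conflation[OF E1])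
  have QB: "Q \<in> B" using ext_closedD[OF E2 A Z] .
  have "projective (full_subcat C B) (inherited_exact E B) Q"
  proof (rule inherited_projectiveI[OF QB])
    fix X i Y p assume E3: "(X, i, Y, p, Q) \<in> E" and X: "X \<in> B"
    show "\<exists>s. \<guillemotleft>s : Q \<rightarrow> Y\<guillemotright> \<and> p \<star> s = idm Q"
      by (rule wakamatsu_splitting[OF E1 P(1) f A minimal po Q E3 X]) blast+
  qed
  moreover have "deflation (inherited_exact E B) Q Z q"
    using E2 A QB Z by (auto simp: deflation_def)
  ultimately show "\<exists>P p. projective (full_subcat C B) (inherited_exact E B) P \<and>
      deflation (inherited_exact E B) P Z p" by blast
qed

lemma enough_projectives_op: "enough_projectives (op_cat C) (op_exact E) \<longleftrightarrow> enough_injectives C E"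
  by (simp add: enough_projectives_def enough_injectives_def)

lemma covariantly_finite_op: "covariantly_finite (op_cat C) B \<longleftrightarrow> contravariantly_finite C B"
  by (simp add: covariantly_finite_def contravariantly_finite_def)

lemma enough_injectives_inherited:
  assumes "krull_schmidt_category K C" "extension_closed_subcategory K C E B"
    and "enough_injectives C E" "contravariantly_finite C B"
  shows "enough_injectives (full_subcat C B) (inherited_exact E B)"
  using enough_projectives_inherited[of K "op_cat C" "op_exact E" B] assms krull_schmidt_category_op
    extension_closed_subcategory.extension_closed_subcategory_op
  by (metis enough_projectives_op covariantly_finite_op op_full_subcat op_inherited_exact)

section \<open>Quotient modules\<close>

locale quotient_of_module = module K M
  for K :: "('k, 'x) ring_scheme" (structure) and M :: "('k, 'm) module" (structure) +
  fixes N
  assumes submod: "submodule N K M"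
begin

lemma abelian_subgroup: "abelian_subgroup N M"
proof (rule abelian_subgroupI3)
  show "additive_subgroup N M"
    using submod by (auto intro: additive_subgroupI simp: submodule_def)
qed unfold_locales

interpretation N: abelian_subgroup N M
  by (rule abelian_subgroup)

lemma coset_eq_iff:
  assumes "x \<in> carrier M" "y \<in> carrier M"
  shows "N +>\<^bsub>M\<^esub> x = N +>\<^bsub>M\<^esub> y \<longleftrightarrow> x \<ominus>\<^bsub>M\<^esub> y \<in> N"
proof -
  have "N +>\<^bsub>M\<^esub> x = N +>\<^bsub>M\<^esub> y \<longleftrightarrow> x \<in> N +>\<^bsub>M\<^esub> y"
  proof
    assume "N +>\<^bsub>M\<^esub> x = N +>\<^bsub>M\<^esub> y"
    then show "x \<in> N +>\<^bsub>M\<^esub> y" by (intro N.a_repr_independenceD[OF assms(1)]) (rule sym)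
  qed (rule N.a_repr_independence'[OF _ assms(2), symmetric])
  then show ?thesis using N.a_rcos_module[OF assms(2,1)] by (simp add: minus_eq)
qed

lemma mem_coset_iff:
  assumes "x \<in> carrier M"
  shows "y \<in> N +>\<^bsub>M\<^esub> x \<longleftrightarrow> y \<in> carrier M \<and> N +>\<^bsub>M\<^esub> y = N +>\<^bsub>M\<^esub> x"
  using assms N.a_elemrcos_carrier N.a_repr_independence' N.a_rcos_self by metis

lemma quotient_carrier: "carrier (quotient_module M N) = (\<lambda>x. N +>\<^bsub>M\<^esub> x) ` carrier M"
  by (auto simp: quotient_module_def A_RCOSETS_def' a_r_coset_def')

lemma quotient_add:
  "\<lbrakk>x \<in> carrier M; y \<in> carrier M\<rbrakk> \<Longrightarrow>
    (N +>\<^bsub>M\<^esub> x) \<oplus>\<^bsub>quotient_module M N\<^esub> (N +>\<^bsub>M\<^esub> y) = N +>\<^bsub>M\<^esub> (x \<oplus>\<^bsub>M\<^esub> y)"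
  using N.a_rcos_sum by (simp add: quotient_module_def)

lemma quotient_zero: "\<zero>\<^bsub>quotient_module M N\<^esub> = N +>\<^bsub>M\<^esub> \<zero>\<^bsub>M\<^esub>"
  using N.a_rcos_const[OF N.zero_closed] by (simp add: quotient_module_def)

text \<open>The scalar multiple of a coset is a union over its elements. All members of the union
  coincide, because two elements of the coset differ by an element of \<open>N\<close> and
  \<open>N\<close> is closed under scalars.\<close>

lemma quotient_smult:
  assumes c: "c \<in> carrier K" and x: "x \<in> carrier M"
  shows "c \<odot>\<^bsub>quotient_module M N\<^esub> (N +>\<^bsub>M\<^esub> x) = N +>\<^bsub>M\<^esub> (c \<odot>\<^bsub>M\<^esub> x)"
proof -
  have "N +>\<^bsub>M\<^esub> (c \<odot>\<^bsub>M\<^esub> y) = N +>\<^bsub>M\<^esub> (c \<odot>\<^bsub>M\<^esub> x)" if "y \<in> N +>\<^bsub>M\<^esub> x" for y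
  proof -
    have "y \<in> carrier M" "N +>\<^bsub>M\<^esub> y = N +>\<^bsub>M\<^esub> x" using that mem_coset_iff[OF x] by blast+
    then have y: "y \<in> carrier M" "y \<ominus>\<^bsub>M\<^esub> x \<in> N" using coset_eq_iff[OF _ x] by blast+
    have "c \<odot>\<^bsub>M\<^esub> (y \<ominus>\<^bsub>M\<^esub> x) \<in> N" using submodule.smult_closed[OF submod c y(2)] .
    then have "(c \<odot>\<^bsub>M\<^esub> y) \<ominus>\<^bsub>M\<^esub> (c \<odot>\<^bsub>M\<^esub> x) \<in> N"
      using c x y by (simp add: minus_eq smult_r_distr smult_r_minus)
    then show ?thesis using coset_eq_iff c x y by simp
  qed
  then have "(\<Union>y\<in>N +>\<^bsub>M\<^esub> x. N +>\<^bsub>M\<^esub> (c \<odot>\<^bsub>M\<^esub> y)) = N +>\<^bsub>M\<^esub> (c \<odot>\<^bsub>M\<^esub> x)"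
    by (intro UN_constant_eq[OF N.a_rcos_self[OF x]] ballI)
  then show ?thesis by (simp add: quotient_module_def)
qed

lemma module_quotient: "module K (quotient_module M N)"
proof (rule moduleI)
  let ?Q = "quotient_module M N"
  note q = quotient_carrier quotient_add quotient_zero quotient_smult
  show "cring K" by unfold_locales
  show "abelian_group ?Q"
  proof (rule abelian_groupI)
    fix U assume "U \<in> carrier ?Q"
    then obtain x where x: "x \<in> carrier M" "U = N +>\<^bsub>M\<^esub> x" by (auto simp: q)
    then have "(N +>\<^bsub>M\<^esub> (\<ominus>\<^bsub>M\<^esub> x)) \<oplus>\<^bsub>?Q\<^esub> U = \<zero>\<^bsub>?Q\<^esub>" by (simp add: q M.l_neg)
    then show "\<exists>V\<in>carrier ?Q. V \<oplus>\<^bsub>?Q\<^esub> U = \<zero>\<^bsub>?Q\<^esub>" using x by (auto simp: quotient_carrier)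
  qed (auto simp: q M.a_ac)
qed (auto simp: quotient_carrier quotient_add quotient_smult smult_l_distr smult_r_distr smult_assoc1)

end

section \<open>The stable category of a Frobenius category\<close>

lemma stable_cat_simps:
  "Obj (stable_cat C E) = Obj C"
  "Hom (stable_cat C E) X Y = quotient_module (Hom C X Y) (proj_maps C E X Y)"
  by (simp_all add: stable_cat_def)

context exact_category
begin

lemma projective_lift:
  assumes "projective C E P" "deflation E Y Z p" "\<guillemotleft>f : P \<rightarrow> Z\<guillemotright>"
  obtains g where "\<guillemotleft>g : P \<rightarrow> Y\<guillemotright>" "p \<star> g = f"
proof -
  have "Y \<in> Obj C" "P \<in> Obj C" using assms conflD homD by (auto simp: deflation_def)
  moreover obtain g where "g \<in> arr C P Y" "p \<star> g = f"
    using assms homD[OF assms(3)] unfolding projective_def by blast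
  ultimately show thesis using that homI by blast
qed

lemma injective_extend:
  assumes "injective C E Q" "inflation E X Y i" "\<guillemotleft>f : X \<rightarrow> Q\<guillemotright>"
  obtains g where "\<guillemotleft>g : Y \<rightarrow> Q\<guillemotright>" "g \<star> i = f"
proof -
  have "Y \<in> Obj C" "Q \<in> Obj C" using assms conflD homD by (auto simp: inflation_def)
  moreover obtain g where "g \<in> arr C Y Q" "g \<star> i = f"
    using assms homD[OF assms(3)] unfolding injective_def by blast
  ultimately show thesis using that homI by blast
qed

lemma proj_mapsE:
  assumes "f \<in> proj_maps C E X Y" "X \<in> Obj C" "Y \<in> Obj C"
  obtains P g h where "projective C E P" "\<guillemotleft>g : X \<rightarrow> P\<guillemotright>" "\<guillemotleft>h : P \<rightarrow> Y\<guillemotright>" "f = h \<star> g" "\<guillemotleft>f : X \<rightarrow> Y\<guillemotright>"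
proof -
  obtain P g h where P: "projective C E P" "g \<in> arr C X P" "h \<in> arr C P Y" "f = h \<star> g"
    using assms(1) unfolding proj_maps_def by blast
  then have "P \<in> Obj C" by (simp add: projective_def)
  then have "\<guillemotleft>g : X \<rightarrow> P\<guillemotright>" "\<guillemotleft>h : P \<rightarrow> Y\<guillemotright>" using P assms homI by blast+
  with that P show thesis using comp_hom by blast
qed

lemma proj_mapsI:
  "\<lbrakk>projective C E P; \<guillemotleft>g : X \<rightarrow> P\<guillemotright>; \<guillemotleft>h : P \<rightarrow> Y\<guillemotright>\<rbrakk> \<Longrightarrow> h \<star> g \<in> proj_maps C E X Y"
  unfolding proj_maps_def using homD by blast

text \<open>A single deflation onto \<open>Y\<close> from a projective detects all maps through
  projectives, since a map from any other projective to \<open>Y\<close> lifts along it. A condition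
  quantified over all projectives thus becomes membership in the image of one map.\<close>

lemma proj_maps_iff_lift:
  assumes "projective C E P" "deflation E P Y p" "X \<in> Obj C"
  shows "f \<in> proj_maps C E X Y \<longleftrightarrow> (\<exists>g. \<guillemotleft>g : X \<rightarrow> P\<guillemotright> \<and> p \<star> g = f)"
proof
  have p: "\<guillemotleft>p : P \<rightarrow> Y\<guillemotright>" "Y \<in> Obj C" using assms conflD by (auto simp: deflation_def)
  show "f \<in> proj_maps C E X Y" if "\<exists>g. \<guillemotleft>g : X \<rightarrow> P\<guillemotright> \<and> p \<star> g = f"
    using that proj_mapsI[OF assms(1) _ p(1)] by blast
  assume "f \<in> proj_maps C E X Y"
  then obtain P' g h where P': "projective C E P'" "\<guillemotleft>g : X \<rightarrow> P'\<guillemotright>" "\<guillemotleft>h : P' \<rightarrow> Y\<guillemotright>" "f = h \<star> g"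
    by (rule proj_mapsE[OF _ assms(3) p(2)])
  obtain l where l: "\<guillemotleft>l : P' \<rightarrow> P\<guillemotright>" "p \<star> l = h" by (rule projective_lift[OF P'(1) assms(2) P'(3)])
  have "p \<star> l \<star> g = f" using l(1) p(1) P'(2,4) by (simp add: comp_reassoc[OF l(2)])
  then show "\<exists>g. \<guillemotleft>g : X \<rightarrow> P\<guillemotright> \<and> p \<star> g = f" using comp_hom[OF P'(2) l(1)] by blast
qed

lemma proj_maps_comp_left:
  assumes "f \<in> proj_maps C E X Y" "X \<in> Obj C" "\<guillemotleft>g : Y \<rightarrow> Z\<guillemotright>"
  shows "g \<star> f \<in> proj_maps C E X Z"
proof -
  have Y: "Y \<in> Obj C" using homD[OF assms(3)] by blast
  obtain P u h where P: "projective C E P" "\<guillemotleft>u : X \<rightarrow> P\<guillemotright>" "\<guillemotleft>h : P \<rightarrow> Y\<guillemotright>" "f = h \<star> u"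
    by (rule proj_mapsE[OF assms(1,2) Y])
  have "(g \<star> h) \<star> u \<in> proj_maps C E X Z" by (rule proj_mapsI[OF P(1,2) comp_hom[OF P(3) assms(3)]])
  then show ?thesis using P assms by simp
qed

lemma proj_maps_comp_right:
  assumes "f \<in> proj_maps C E Y Z" "Z \<in> Obj C" "\<guillemotleft>g : X \<rightarrow> Y\<guillemotright>"
  shows "f \<star> g \<in> proj_maps C E X Z"
proof -
  have Y: "Y \<in> Obj C" using homD[OF assms(3)] by blast
  obtain P u h where P: "projective C E P" "\<guillemotleft>u : Y \<rightarrow> P\<guillemotright>" "\<guillemotleft>h : P \<rightarrow> Z\<guillemotright>" "f = h \<star> u"
    by (rule proj_mapsE[OF assms(1) Y assms(2)])
  have "h \<star> u \<star> g \<in> proj_maps C E X Z" by (rule proj_mapsI[OF P(1) comp_hom[OF assms(3) P(2)] P(3)])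
  then show ?thesis using P assms by simp
qed

lemma conflation_extend:
  assumes E1: "(X, i, Y, p, Z) \<in> E" and E2: "(X', i', I, p', T) \<in> E" and I: "injective C E I"
    and f: "\<guillemotleft>f : X \<rightarrow> X'\<guillemotright>"
  obtains u t where "\<guillemotleft>u : Y \<rightarrow> I\<guillemotright>" "\<guillemotleft>t : Z \<rightarrow> T\<guillemotright>" "u \<star> i = i' \<star> f" "t \<star> p = p' \<star> u"
proof -
  note m1 = conflD[OF E1] and m2 = conflD[OF E2]
  have "inflation E X Y i" using E1 by (auto simp: inflation_def)
  then obtain u where u: "\<guillemotleft>u : Y \<rightarrow> I\<guillemotright>" "u \<star> i = i' \<star> f"
    by (rule injective_extend[OF I _ comp_hom[OF f m2(4)]])
  have "(p' \<star> u) \<star> i = p' \<star> i' \<star> f" using u m1(4) m2(5) by simp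
  also have "\<dots> = nul X T" using m2 f by (simp add: comp_reassoc[OF m2(6)])
  finally obtain t where "\<guillemotleft>t : Z \<rightarrow> T\<guillemotright>" "t \<star> p = p' \<star> u"
    by (rule confl_coker[OF E1 comp_hom[OF u(1) m2(5)]])
  with that u show thesis by blast
qed

text \<open>The difference of the middle maps kills \<open>i\<close> and so descends along
  \<open>p\<close> to \<open>v\<close>; the third maps then differ by \<open>p' \<star> v\<close>,
  which factors through \<open>I\<close>. For injective \<open>I\<close> over a Frobenius category
  they agree stably, and this is the source of all well-definedness and naturality statements about
  shifts.\<close>

lemma conflation_extend_unique:
  assumes E1: "(X, i, Y, p, Z) \<in> E" and E2: "(X', i', I, p', T) \<in> E"
    and u: "\<guillemotleft>u : Y \<rightarrow> I\<guillemotright>" "\<guillemotleft>u' : Y \<rightarrow> I\<guillemotright>" "u \<star> i = u' \<star> i"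
    and t: "\<guillemotleft>t : Z \<rightarrow> T\<guillemotright>" "\<guillemotleft>t' : Z \<rightarrow> T\<guillemotright>" "t \<star> p = p' \<star> u" "t' \<star> p = p' \<star> u'"
  obtains v where "\<guillemotleft>v : Z \<rightarrow> I\<guillemotright>" "t \<boxminus> t' = p' \<star> v"
proof -
  note m1 = conflD[OF E1] and m2 = conflD[OF E2]
  have "(u \<boxminus> u') \<star> i = nul X I" using u m1 m2 by simp
  then obtain v where v: "\<guillemotleft>v : Z \<rightarrow> I\<guillemotright>" "v \<star> p = u \<boxminus> u'"
    by (rule confl_coker[OF E1 plus_hom(4)[OF u(1,2)]])
  have "(t \<boxminus> t') \<star> p = (p' \<star> u) \<boxminus> (p' \<star> u')" using t m1(5) by simp
  also have "\<dots> = (p' \<star> v) \<star> p" using v u m1(5) m2(5) by simp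
  finally have "t \<boxminus> t' = p' \<star> v"
    by (rule confl_epi[OF E1 plus_hom(4)[OF t(1,2)] comp_hom[OF v(1) m2(5)]])
  with that v show thesis by blast
qed

end

context frobenius_category
begin

lemma inj_proj: "injective C E P \<Longrightarrow> projective C E P"
  using proj_iff_inj by blast

text \<open>Through one fixed deflation from a projective onto \<open>Y\<close>, these maps form the
  image of a linear map. Sums are handled in this way without forming direct sums of
  projectives.\<close>

lemma proj_maps_submodule:
  assumes X: "X \<in> Obj C" and Y: "Y \<in> Obj C"
  shows "submodule (proj_maps C E X Y) K (Hom C X Y)"
proof -
  obtain P p where P: "projective C E P" "deflation E P Y p"
    using enough_proj Y unfolding enough_projectives_def by blast
  have p: "\<guillemotleft>p : P \<rightarrow> Y\<guillemotright>" "P \<in> Obj C" using P conflD by (auto simp: deflation_def)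
  have iff: "f \<in> proj_maps C E X Y \<longleftrightarrow> (\<exists>g. \<guillemotleft>g : X \<rightarrow> P\<guillemotright> \<and> p \<star> g = f)" for f
    by (rule proj_maps_iff_lift[OF P X])
  interpret M: module K "Hom C X Y" using X Y by (rule hom_module)
  have sub: "proj_maps C E X Y \<subseteq> arr C X Y"
  proof
    fix f assume "f \<in> proj_maps C E X Y"
    then have "\<guillemotleft>f : X \<rightarrow> Y\<guillemotright>" by (rule proj_mapsE[OF _ X Y])
    then show "f \<in> arr C X Y" using homD by blast
  qed
  have sm: "c \<odot>\<^bsub>Hom C X Y\<^esub> f \<in> proj_maps C E X Y" if c: "c \<in> carrier K" and f: "f \<in> proj_maps C E X Y" for c f
  proof -
    obtain g where g: "\<guillemotleft>g : X \<rightarrow> P\<guillemotright>" "p \<star> g = f" using f iff by blast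
    have "p \<star> (c \<odot>\<^bsub>Hom C X P\<^esub> g) = c \<odot>\<^bsub>Hom C X Y\<^esub> f"
      using comp_smult_right[OF X p(2) Y _ _ c] homD[OF g(1)] homD[OF p(1)] g(2) by blast
    then show ?thesis using smult_hom[OF g(1) c] iff by blast
  qed
  show ?thesis
  proof (rule M.submoduleI[OF sub])
    show "nul X Y \<in> proj_maps C E X Y" unfolding iff using p X by (intro exI[of _ "nul X P"]) simp
    show "f \<oplus>\<^bsub>Hom C X Y\<^esub> g \<in> proj_maps C E X Y"
      if f: "f \<in> proj_maps C E X Y" and g: "g \<in> proj_maps C E X Y" for f g
    proof -
      obtain f' where f': "\<guillemotleft>f' : X \<rightarrow> P\<guillemotright>" "p \<star> f' = f" using f iff by blast
      obtain g' where g': "\<guillemotleft>g' : X \<rightarrow> P\<guillemotright>" "p \<star> g' = g" using g iff by blast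
      have "p \<star> (f' \<boxplus> g') = f \<boxplus> g" using comp_plus_distrib(1)[of f' g' p] f' g' p by simp
      moreover have "f \<boxplus> g = f \<oplus>\<^bsub>Hom C X Y\<^esub> g"
        using plus_hom(1)[of f X Y g] comp_hom[OF f'(1) p(1)] comp_hom[OF g'(1) p(1)] f'(2) g'(2) by metis
      ultimately show ?thesis using plus_hom(2)[OF f'(1) g'(1)] iff by metis
    qed
    show "\<ominus>\<^bsub>Hom C X Y\<^esub> f \<in> proj_maps C E X Y" if f: "f \<in> proj_maps C E X Y" for f
      using sm[of "\<ominus> \<one>" f] f sub M.smult_l_minus[of \<one> f] M.smult_one[of f] by auto
  qed (rule sm)
qed

lemma quotient_of_hom:
  "\<lbrakk>X \<in> Obj C; Y \<in> Obj C\<rbrakk> \<Longrightarrow> quotient_of_module K (Hom C X Y) (proj_maps C E X Y)"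
  by (intro quotient_of_module.intro quotient_of_module_axioms.intro hom_module proj_maps_submodule)

abbreviation cls where "cls \<equiv> stable_class C E"

lemma stable_class_eq_iff:
  assumes "X \<in> Obj C" "Y \<in> Obj C" "f \<in> arr C X Y" "g \<in> arr C X Y"
  shows "cls X Y f = cls X Y g \<longleftrightarrow> f \<ominus>\<^bsub>Hom C X Y\<^esub> g \<in> proj_maps C E X Y"
  unfolding stable_class_def using quotient_of_module.coset_eq_iff[OF quotient_of_hom] assms by blast

lemma stable_class_eqI:
  assumes "\<guillemotleft>f : X \<rightarrow> Y\<guillemotright>" "\<guillemotleft>g : X \<rightarrow> Y\<guillemotright>" "f \<boxminus> g \<in> proj_maps C E X Y"
  shows "cls X Y f = cls X Y g"
  using stable_class_eq_iff[of X Y f g] assms(3) homD[OF assms(1)] homD[OF assms(2)]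
    plus_hom(3)[OF assms(1,2)] by simp

lemma stable_class_eqD:
  assumes "cls X Y f = cls X Y g" "\<guillemotleft>f : X \<rightarrow> Y\<guillemotright>" "\<guillemotleft>g : X \<rightarrow> Y\<guillemotright>"
  shows "f \<boxminus> g \<in> proj_maps C E X Y"
  using stable_class_eq_iff[of X Y f g] assms(1) homD[OF assms(2)] homD[OF assms(3)]
    plus_hom(3)[OF assms(2,3)] by simp

lemma mem_stable_class_iff:
  assumes "X \<in> Obj C" "Y \<in> Obj C" "f \<in> arr C X Y"
  shows "g \<in> cls X Y f \<longleftrightarrow> g \<in> arr C X Y \<and> cls X Y g = cls X Y f"
  unfolding stable_class_def using quotient_of_module.mem_coset_iff[OF quotient_of_hom] assms by blast

lemma mem_stable_classD:
  assumes "g \<in> cls X Y f" "\<guillemotleft>f : X \<rightarrow> Y\<guillemotright>"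
  shows "\<guillemotleft>g : X \<rightarrow> Y\<guillemotright>" "g \<boxminus> f \<in> proj_maps C E X Y"
proof -
  have o: "X \<in> Obj C" "Y \<in> Obj C" "f \<in> arr C X Y" using homD[OF assms(2)] by blast+
  have g: "g \<in> arr C X Y" "cls X Y g = cls X Y f"
    using assms(1) mem_stable_class_iff[OF o] by blast+
  show g': "\<guillemotleft>g : X \<rightarrow> Y\<guillemotright>" by (rule homI[OF o(1,2) g(1)])
  show "g \<boxminus> f \<in> proj_maps C E X Y" by (rule stable_class_eqD[OF g(2) g' assms(2)])
qed

lemma stable_carrier:
  assumes "X \<in> Obj C" "Y \<in> Obj C"
  shows "arr (stable_cat C E) X Y = cls X Y ` arr C X Y"
  unfolding stable_cat_simps stable_class_def
  using quotient_of_module.quotient_carrier[OF quotient_of_hom[OF assms]] by simp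

lemma stable_add:
  assumes "X \<in> Obj C" "Y \<in> Obj C" "f \<in> arr C X Y" "g \<in> arr C X Y"
  shows "cls X Y f \<oplus>\<^bsub>Hom (stable_cat C E) X Y\<^esub> cls X Y g = cls X Y (f \<oplus>\<^bsub>Hom C X Y\<^esub> g)"
  unfolding stable_cat_simps stable_class_def
  using quotient_of_module.quotient_add[OF quotient_of_hom] assms by simp

lemma stable_smult:
  assumes "X \<in> Obj C" "Y \<in> Obj C" "f \<in> arr C X Y" "c \<in> carrier K"
  shows "c \<odot>\<^bsub>Hom (stable_cat C E) X Y\<^esub> cls X Y f = cls X Y (c \<odot>\<^bsub>Hom C X Y\<^esub> f)"
  unfolding stable_cat_simps stable_class_def
  using quotient_of_module.quotient_smult[OF quotient_of_hom] assms by simp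

lemma stable_module:
  "\<lbrakk>X \<in> Obj C; Y \<in> Obj C\<rbrakk> \<Longrightarrow> module K (Hom (stable_cat C E) X Y)"
  unfolding stable_cat_simps by (rule quotient_of_module.module_quotient[OF quotient_of_hom])

text \<open>The union that defines composition runs over representatives and over objects.
  Disjointness of the morphism spaces fixes the outer objects, and maps through projectives form a
  two-sided ideal, so only one class occurs.\<close>

lemma stable_comp:
  assumes o: "X \<in> Obj C" "Y \<in> Obj C" "Z \<in> Obj C" and a: "f \<in> arr C X Y" "g \<in> arr C Y Z"
  shows "cls Y Z g \<cdot>\<^bsub>stable_cat C E\<^esub> cls X Y f = cls X Z (g \<star> f)"
proof -
  have f: "\<guillemotleft>f : X \<rightarrow> Y\<guillemotright>" and g: "\<guillemotleft>g : Y \<rightarrow> Z\<guillemotright>" using o a homI by blast+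
  have eq: "cls X Z (g' \<star> f') = cls X Z (g \<star> f)" if "f' \<in> cls X Y f" "g' \<in> cls Y Z g" for f' g'
  proof -
    note f' = mem_stable_classD[OF that(1) f] and g' = mem_stable_classD[OF that(2) g]
    have "(g' \<star> f') \<boxminus> (g \<star> f') = (g' \<boxminus> g) \<star> f'" using f' g g' by simp
    then have 1: "cls X Z (g' \<star> f') = cls X Z (g \<star> f')"
      using proj_maps_comp_right[OF g'(2) o(3) f'(1)]
      by (intro stable_class_eqI[OF comp_hom[OF f'(1) g'(1)] comp_hom[OF f'(1) g]]) simp
    have "(g \<star> f') \<boxminus> (g \<star> f) = g \<star> (f' \<boxminus> f)" using f f' g by simp
    then have 2: "cls X Z (g \<star> f') = cls X Z (g \<star> f)"
      using proj_maps_comp_left[OF f'(2) o(1) g]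
      by (intro stable_class_eqI[OF comp_hom[OF f'(1) g] comp_hom[OF f g]]) simp
    show ?thesis using 1 2 by simp
  qed
  have "{cls X' Z' (g' \<star> f') | X' Y' Z' f' g'. X' \<in> Obj C \<and> Y' \<in> Obj C \<and> Z' \<in> Obj C \<and>
      f' \<in> cls X Y f \<and> f' \<in> arr C X' Y' \<and> g' \<in> cls Y Z g \<and> g' \<in> arr C Y' Z'} = {cls X Z (g \<star> f)}"
    (is "?L = _")
  proof (intro equalityI subsetI)
    fix U assume "U \<in> ?L"
    then obtain X' Y' Z' f' g' where U: "U = cls X' Z' (g' \<star> f')"
      and o': "X' \<in> Obj C" "Y' \<in> Obj C" "Z' \<in> Obj C"
      and f': "f' \<in> cls X Y f" "f' \<in> arr C X' Y'" and g': "g' \<in> cls Y Z g" "g' \<in> arr C Y' Z'"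
      by blast
    have "f' \<in> arr C X Y" "g' \<in> arr C Y Z"
      using f'(1) g'(1) mem_stable_class_iff o a by blast+
    then have "X' = X" "Z' = Z" using f'(2) g'(2) o o' hom_disjoint by blast+
    then show "U \<in> {cls X Z (g \<star> f)}" using U eq[OF f'(1) g'(1)] by simp
  next
    fix U assume "U \<in> {cls X Z (g \<star> f)}"
    moreover have "f \<in> cls X Y f" "g \<in> cls Y Z g" using mem_stable_class_iff o a by blast+
    ultimately show "U \<in> ?L" using o a by blast
  qed
  then show ?thesis unfolding stable_cat_def by simp
qed

lemma inj_conflation:
  assumes "X \<in> Obj C"
  obtains i I p T where "inj_conflation C E X = (i, I, p, T)" "shift_obj C E X = T"
    "injective C E I" "(X, i, I, p, T) \<in> E"
proof -
  obtain I i where I: "injective C E I" "inflation E X I i"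
    using enough_inj assms unfolding enough_injectives_def by blast
  then obtain p T where "(X, i, I, p, T) \<in> E" by (auto simp: inflation_def)
  with I(1) have "case (i, I, p, T) of (i, I, p, T) \<Rightarrow> injective C E I \<and> (X, i, I, p, T) \<in> E" by simp
  then have *: "case inj_conflation C E X of (i, I, p, T) \<Rightarrow> injective C E I \<and> (X, i, I, p, T) \<in> E"
    unfolding inj_conflation_def by (rule someI)
  obtain i I p T where "inj_conflation C E X = (i, I, p, T)" by (cases "inj_conflation C E X")
  with that * show thesis by (simp add: shift_obj_def)
qed

lemma shift_obj_closed: "X \<in> Obj C \<Longrightarrow> shift_obj C E X \<in> Obj C"
  using inj_conflation conflD(3) by metis

text \<open>Any extension of \<open>f\<close> to the chosen conflations computes the shifted map:
  another extension, or another representative of the class of \<open>f\<close>, changes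
  \<open>t\<close> only by a map through the injective \<open>J\<close>.\<close>

lemma shift_arr_class:
  assumes X: "inj_conflation C E X = (i, I, p, T)" "(X, i, I, p, T) \<in> E"
    and Y: "inj_conflation C E Y = (j, J, q, S)" "injective C E J" "(Y, j, J, q, S) \<in> E"
    and f: "\<guillemotleft>f : X \<rightarrow> Y\<guillemotright>" and u: "\<guillemotleft>u : I \<rightarrow> J\<guillemotright>" "u \<star> i = j \<star> f"
    and t: "\<guillemotleft>t : T \<rightarrow> S\<guillemotright>" "t \<star> p = q \<star> u"
  shows "shift_arr C E X Y (cls X Y f) = cls T S t"
proof -
  note mX = conflD[OF X(2)] and mY = conflD[OF Y(3)]
  have fa: "f \<in> arr C X Y" using homD[OF f] by blast
  have eq: "cls T S t' = cls T S t"
    if f': "f' \<in> cls X Y f" and u': "u' \<in> arr C I J" "u' \<star> i = j \<star> f'"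
      and t': "t' \<in> arr C T S" "t' \<star> p = q \<star> u'" for f' u' t'
  proof -
    have m': "\<guillemotleft>u' : I \<rightarrow> J\<guillemotright>" "\<guillemotleft>t' : T \<rightarrow> S\<guillemotright>" using u' t' homI mX mY by blast+
    note f'' = mem_stable_classD[OF f' f]
    obtain P g h where P: "projective C E P" "\<guillemotleft>g : X \<rightarrow> P\<guillemotright>" "\<guillemotleft>h : P \<rightarrow> Y\<guillemotright>" "f' \<boxminus> f = h \<star> g"
      by (rule proj_mapsE[OF f''(2) mX(1) mY(1)])
    have "inflation E X I i" using X(2) by (auto simp: inflation_def)
    then obtain g' where g': "\<guillemotleft>g' : I \<rightarrow> P\<guillemotright>" "g' \<star> i = g"
      using injective_extend[OF _ _ P(2)] P(1) proj_iff_inj by blast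
    \<comment> \<open>The projective \<open>P\<close> is also injective, so the first factor
      \<open>g\<close> of \<open>f' \<boxminus> f\<close> extends along \<open>i\<close>. The map
      \<open>w\<close> restricts along \<open>i\<close> like \<open>u' \<boxminus> u\<close> and is
      killed by \<open>q\<close>; comparing the two as extensions of the same map compares
      \<open>t' \<boxminus> t\<close> with zero.\<close>
    define w where "w = j \<star> h \<star> g'"
    have w: "\<guillemotleft>w : I \<rightarrow> J\<guillemotright>" unfolding w_def using P g' mY by simp
    have "(u' \<boxminus> u) \<star> i = j \<star> (f' \<boxminus> f)" using m' u u' f f'' mX mY by simp
    also have "\<dots> = w \<star> i" unfolding P(4) w_def using P(2,3) g' mX mY by simp
    finally have ui: "(u' \<boxminus> u) \<star> i = w \<star> i" .
    have qw: "q \<star> w = nul I S"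
      unfolding w_def using comp_reassoc[OF mY(6), of "h \<star> g'"] P g' mY by simp
    have 1: "(t' \<boxminus> t) \<star> p = q \<star> (u' \<boxminus> u)" using m' t t' u mX mY by simp
    have 2: "nul T S \<star> p = q \<star> w" "\<guillemotleft>nul T S : T \<rightarrow> S\<guillemotright>" using qw mX mY by simp_all
    obtain v where v: "\<guillemotleft>v : T \<rightarrow> J\<guillemotright>" "(t' \<boxminus> t) \<boxminus> nul T S = q \<star> v"
      by (rule conflation_extend_unique[OF X(2) Y(3) plus_hom(4)[OF m'(1) u(1)] w ui
          plus_hom(4)[OF m'(2) t(1)] 2(2) 1 2(1)])
    have "t' \<boxminus> t = q \<star> v" using v m' t by simp
    then have "t' \<boxminus> t \<in> proj_maps C E T S"
      using proj_mapsI[OF inj_proj[OF Y(2)] v(1) mY(5)] by simp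
    then show ?thesis by (rule stable_class_eqI[OF m'(2) t(1)])
  qed
  have "{cls T S t' | f' u' t'. f' \<in> cls X Y f \<and> f' \<in> arr C X Y \<and> u' \<in> arr C I J \<and> t' \<in> arr C T S \<and>
      u' \<star> i = j \<star> f' \<and> t' \<star> p = q \<star> u'} = {cls T S t}" (is "?L = _")
  proof (intro equalityI subsetI)
    fix U assume "U \<in> {cls T S t}"
    moreover have "f \<in> cls X Y f" using mem_stable_class_iff[OF mX(1) mY(1) fa] fa by blast
    ultimately show "U \<in> ?L" using fa homD[OF u(1)] homD[OF t(1)] u t by blast
  qed (use eq in blast)
  then show ?thesis unfolding shift_arr_def X(1) Y(1) by simp
qed

end

section \<open>Vanishing of extensions\<close>

context frobenius_category
begin

text \<open>This is the vanishing of Ext1(A, Y), stated on maps before passing to cosets.\<close>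

definition ext_vanishes where
  "ext_vanishes A Y \<longleftrightarrow> arr C A (shift_obj C E Y) \<subseteq> proj_maps C E A (shift_obj C E Y)"

lemma ext_vanishes_iff_lift:
  assumes "A \<in> Obj C" "inj_conflation C E Y = (i, I, p, T)" "injective C E I" "(Y, i, I, p, T) \<in> E"
  shows "ext_vanishes A Y \<longleftrightarrow> (\<forall>f. \<guillemotleft>f : A \<rightarrow> T\<guillemotright> \<longrightarrow> (\<exists>w. \<guillemotleft>w : A \<rightarrow> I\<guillemotright> \<and> p \<star> w = f))"
proof -
  note m = conflD[OF assms(4)]
  have T: "shift_obj C E Y = T" using assms(2) by (simp add: shift_obj_def)
  have "deflation E I T p" using assms(4) by (auto simp: deflation_def)
  then have "f \<in> proj_maps C E A T \<longleftrightarrow> (\<exists>w. \<guillemotleft>w : A \<rightarrow> I\<guillemotright> \<and> p \<star> w = f)" for f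
    by (rule proj_maps_iff_lift[OF inj_proj[OF assms(3)] _ assms(1)])
  then show ?thesis unfolding ext_vanishes_def T subset_iff arr_iff[OF assms(1) m(3)] by presburger
qed

text \<open>The dual of a zero module has a single element, and the Calabi-Yau duality maps it
  bijectively onto Ext1 with the arguments exchanged.\<close>

lemma ext_vanishes_sym:
  assumes cy: "two_calabi_yau K C E" and A: "A \<in> Obj C" and Y: "Y \<in> Obj C" and v: "ext_vanishes A Y"
  shows "ext_vanishes Y A"
proof -
  let ?M = "Ext1 C E A Y" and ?N = "Ext1 C E Y A"
  have M_def: "?M = Hom (stable_cat C E) A (shift_obj C E Y)"
    and N_def: "?N = Hom (stable_cat C E) Y (shift_obj C E A)" by (simp_all add: Ext1_def)
  note sY = shift_obj_closed[OF Y] and sA = shift_obj_closed[OF A]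
  interpret M: module K ?M unfolding M_def by (rule stable_module[OF A sY])
  have M_zero: "x = \<zero>\<^bsub>?M\<^esub>" if x: "x \<in> carrier ?M" for x
  proof -
    have "y = cls A (shift_obj C E Y) (nul A (shift_obj C E Y))" if y: "y \<in> carrier ?M" for y
    proof -
      obtain f where f: "f \<in> arr C A (shift_obj C E Y)" "y = cls A (shift_obj C E Y) f"
        using y unfolding M_def stable_carrier[OF A sY] by blast
      note fm = homI[OF A sY f(1)]
      have "f \<boxminus> nul A (shift_obj C E Y) \<in> proj_maps C E A (shift_obj C E Y)"
        using v f(1) fm unfolding ext_vanishes_def by auto
      then show ?thesis unfolding f(2) by (intro stable_class_eqI[OF fm]) (use A sY in simp_all)
    qed
    from this[OF x] this[OF M.zero_closed] show ?thesis by simp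
  qed
  \<comment> \<open>Functionals are extensional, so they are determined by their values on the
    module; its only element is zero, where additivity forces the value zero.\<close>
  have dual: "\<phi> = \<psi>" if "\<phi> \<in> carrier (dual K ?M)" "\<psi> \<in> carrier (dual K ?M)" for \<phi> \<psi>
  proof -
    have z: "\<chi> \<in> extensional (carrier ?M)" "\<chi> \<zero>\<^bsub>?M\<^esub> = \<zero>" if "\<chi> \<in> carrier (dual K ?M)" for \<chi>
    proof -
      have d: "\<chi> \<in> carrier ?M \<rightarrow>\<^sub>E carrier K"
        "\<forall>x\<in>carrier ?M. \<forall>y\<in>carrier ?M. \<chi> (x \<oplus>\<^bsub>?M\<^esub> y) = \<chi> x \<oplus> \<chi> y"
        using that unfolding dual_def by simp_all
      have *: "\<chi> \<in> carrier ?M \<rightarrow>\<^sub>E carrier K" "\<chi> (\<zero>\<^bsub>?M\<^esub> \<oplus>\<^bsub>?M\<^esub> \<zero>\<^bsub>?M\<^esub>) = \<chi> \<zero>\<^bsub>?M\<^esub> \<oplus> \<chi> \<zero>\<^bsub>?M\<^esub>"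
        using d by (blast, blast)
      then have c: "\<chi> \<zero>\<^bsub>?M\<^esub> \<in> carrier K" using M.M.zero_closed by blast
      show "\<chi> \<in> extensional (carrier ?M)" using * by (simp add: PiE_def)
      show "\<chi> \<zero>\<^bsub>?M\<^esub> = \<zero>" using *(2) c by (metis M.M.l_zero M.M.zero_closed add.r_cancel_one)
    qed
    show ?thesis
      by (rule extensionalityI[OF z(1)[OF that(1)] z(1)[OF that(2)]])
        (use M_zero z(2)[OF that(1)] z(2)[OF that(2)] in metis)
  qed
  obtain \<Phi> where "linear_iso K (dual K ?M) ?N \<Phi>"
    using cy A Y unfolding two_calabi_yau_def by blast
  then have im: "carrier ?N = \<Phi> ` carrier (dual K ?M)"
    unfolding linear_iso_def bij_betw_def by blast
  have N: "x = y" if "x \<in> carrier ?N" "y \<in> carrier ?N" for x y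
    using that dual unfolding im by blast
  show ?thesis
    unfolding ext_vanishes_def
  proof
    fix f assume f: "f \<in> arr C Y (shift_obj C E A)"
    note fm = homI[OF Y sA f]
    have n: "\<guillemotleft>nul Y (shift_obj C E A) : Y \<rightarrow> shift_obj C E A\<guillemotright>" using Y sA by simp
    have "cls Y (shift_obj C E A) f = cls Y (shift_obj C E A) (nul Y (shift_obj C E A))"
      by (rule N) (use f homD[OF n] in \<open>auto simp: N_def stable_carrier[OF Y sA]\<close>)
    from stable_class_eqD[OF this fm n] show "f \<in> proj_maps C E Y (shift_obj C E A)"
      using fm by auto
  qed
qed

end

section \<open>Relative projectives and injectives through vanishing of extensions\<close>

locale frobenius_subcategory = frobenius_category + extension_closed_subcategory
begin

abbreviation D where "D \<equiv> full_subcat C B"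
abbreviation F where "F \<equiv> inherited_exact E B"

text \<open>A map from \<open>Q\<close> to the shift of \<open>Y\<close> is an extension of
  \<open>Q\<close> by \<open>Y\<close>, obtained by pullback, and it factors through the injective
  term iff this extension splits. By extension closure all these conflations belong to the
  subcategory, where splitting them is projectivity.\<close>

lemma projective_inherited_iff:
  assumes Q: "Q \<in> B"
  shows "projective D F Q \<longleftrightarrow> (\<forall>Y\<in>B. ext_vanishes Q Y)"
proof (intro iffI ballI)
  fix Y assume P: "projective D F Q" and Y: "Y \<in> B"
  obtain i I p T where I: "inj_conflation C E Y = (i, I, p, T)" "injective C E I" "(Y, i, I, p, T) \<in> E"
    by (rule inj_conflation[OF B_obj[OF Y]])
  note m = conflD[OF I(3)]
  show "ext_vanishes Q Y"
    unfolding ext_vanishes_iff_lift[OF B_obj[OF Q] I]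
  proof (intro allI impI)
    fix f assume f: "\<guillemotleft>f : Q \<rightarrow> T\<guillemotright>"
    obtain Y' p' f' i' where Y': "Y' \<in> Obj C" and pb: "is_pullback C I T Y' Q p f p' f'"
      and E3: "(Y, i', Y', p', Q) \<in> E"
      by (rule pullback_conflation[OF I(3) f])
    note Pb = pullbackD[OF pb m(2,3) Y' B_obj[OF Q]]
    have YB: "Y' \<in> B" by (rule ext_closedD[OF E3 Y Q])
    have "deflation F Y' Q p'" using E3 Y YB Q by (auto simp: deflation_def)
    moreover have "idm Q \<in> arr D Q Q" using ident_closed[OF B_obj[OF Q]] by simp
    ultimately obtain s where "s \<in> arr C Q Y'" and ps: "p' \<star> s = idm Q"
      using P unfolding projective_def full_subcat_simps by blast
    then have s: "\<guillemotleft>s : Q \<rightarrow> Y'\<guillemotright>" using homI[OF B_obj[OF Q] Y'] by blast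
    have "p \<star> f' \<star> s = f \<star> p' \<star> s"
      using Pb(1-4) s(1) by (simp add: comp_reassoc[OF Pb(5)[symmetric]])
    then have "p \<star> f' \<star> s = f" using ps f by simp
    then show "\<exists>w. \<guillemotleft>w : Q \<rightarrow> I\<guillemotright> \<and> p \<star> w = f" using comp_hom[OF s Pb(4)] by blast
  qed
next
  assume v: "\<forall>Y\<in>B. ext_vanishes Q Y"
  show "projective D F Q"
  proof (rule inherited_projectiveI[OF Q])
    fix X i Y p assume E1: "(X, i, Y, p, Q) \<in> E" and X: "X \<in> B"
    obtain j I q T where I: "inj_conflation C E X = (j, I, q, T)" "injective C E I" "(X, j, I, q, T) \<in> E"
      by (rule inj_conflation[OF B_obj[OF X]])
    note m1 = conflD[OF E1] and m2 = conflD[OF I(3)]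
    have id: "\<guillemotleft>idm X : X \<rightarrow> X\<guillemotright>" "\<guillemotleft>idm Q : Q \<rightarrow> Q\<guillemotright>" using m1 by simp_all
    obtain u t where u: "\<guillemotleft>u : Y \<rightarrow> I\<guillemotright>" "u \<star> i = j \<star> idm X" and t: "\<guillemotleft>t : Q \<rightarrow> T\<guillemotright>" "t \<star> p = q \<star> u"
      by (rule conflation_extend[OF E1 I(3,2) id(1)])
    obtain w where w: "\<guillemotleft>w : Q \<rightarrow> I\<guillemotright>" "q \<star> w = t"
      using bspec[OF v X] t(1) unfolding ext_vanishes_iff_lift[OF B_obj[OF Q] I] by blast
    have "u \<star> i = j" "t \<star> idm Q = q \<star> w" using u t w m2 by simp_all
    then obtain g where "\<guillemotleft>g : Q \<rightarrow> Y\<guillemotright>" "p \<star> g = idm Q"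
      using conflation_map_lift[OF E1 I(3) u(1) _ t id(2) w(1)] by blast
    then show "\<exists>s. \<guillemotleft>s : Q \<rightarrow> Y\<guillemotright> \<and> p \<star> s = idm Q" by blast
  qed
qed

text \<open>The shift now belongs to \<open>Q\<close> itself, so one injective conflation of
  \<open>Q\<close> serves for all \<open>Y\<close>. Extensions of \<open>Y\<close> by
  \<open>Q\<close> are split by retractions onto \<open>Q\<close> rather than by sections, and these
  are converted into lifts along \<open>p\<close> and back.\<close>

lemma injective_inherited_iff:
  assumes Q: "Q \<in> B"
  shows "injective D F Q \<longleftrightarrow> (\<forall>Y\<in>B. ext_vanishes Y Q)"
proof -
  obtain i I p T where I: "inj_conflation C E Q = (i, I, p, T)" "injective C E I" "(Q, i, I, p, T) \<in> E"
    by (rule inj_conflation[OF B_obj[OF Q]])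
  note m = conflD[OF I(3)]
  show ?thesis
  proof (intro iffI ballI)
    fix Y assume inj: "injective D F Q" and Y: "Y \<in> B"
    show "ext_vanishes Y Q"
      unfolding ext_vanishes_iff_lift[OF B_obj[OF Y] I]
    proof (intro allI impI)
      fix f assume f: "\<guillemotleft>f : Y \<rightarrow> T\<guillemotright>"
      obtain Z z f' i' where Z: "Z \<in> Obj C" and pb: "is_pullback C I T Z Y p f z f'"
        and E3: "(Q, i', Z, z, Y) \<in> E" and fi: "f' \<star> i' = i"
        by (rule pullback_conflation[OF I(3) f])
      note m3 = conflD[OF E3]
      note Pb = pullbackD[OF pb m(2,3) Z B_obj[OF Y]]
      have ZB: "Z \<in> B" by (rule ext_closedD[OF E3 Q Y])
      have "inflation F Q Z i'" using E3 Y ZB Q by (auto simp: inflation_def)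
      moreover have "idm Q \<in> arr D Q Q" using ident_closed[OF B_obj[OF Q]] by simp
      ultimately obtain r where "r \<in> arr C Z Q" and ri: "r \<star> i' = idm Q"
        using inj unfolding injective_def full_subcat_simps by blast
      then have r: "\<guillemotleft>r : Z \<rightarrow> Q\<guillemotright>" using homI[OF Z B_obj[OF Q]] by blast
      \<comment> \<open>The retraction \<open>r\<close> of the pulled back extension is used to
        correct \<open>f'\<close>: the difference with \<open>i \<star> r\<close> kills
        \<open>i'\<close> and so descends to \<open>Y\<close>. As \<open>p \<star> i\<close> is
        zero, the correction is invisible after \<open>p\<close>, and the descended map lifts
        \<open>f\<close>.\<close>
      have "(f' \<boxminus> (i \<star> r)) \<star> i' = nul Q I" using Pb(4) r m(4) m3(4) fi ri by simp
      then obtain d where d: "\<guillemotleft>d : Y \<rightarrow> I\<guillemotright>" "d \<star> z = f' \<boxminus> (i \<star> r)"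
        by (rule confl_coker[OF E3 plus_hom(4)[OF Pb(4) comp_hom[OF r m(4)]]])
      have "(p \<star> d) \<star> z = p \<star> (f' \<boxminus> (i \<star> r))" using d m(5) m3(5) by simp
      also have "\<dots> = p \<star> f'" using Pb(4) r m by (simp add: comp_reassoc[OF m(6)])
      finally have "(p \<star> d) \<star> z = f \<star> z" unfolding Pb(5) .
      then have "p \<star> d = f" by (rule confl_epi[OF E3 comp_hom[OF d(1) m(5)] f])
      then show "\<exists>w. \<guillemotleft>w : Y \<rightarrow> I\<guillemotright> \<and> p \<star> w = f" using d(1) by blast
    qed
  next
    assume v: "\<forall>Y\<in>B. ext_vanishes Y Q"
    show "injective D F Q"
      unfolding injective_def full_subcat_simps
    proof (intro conjI allI impI Q)
      fix X Y j f assume "inflation F X Y j \<and> f \<in> arr C X Q"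
      then obtain q Z where E1: "(X, j, Y, q, Z) \<in> E" and BB: "X \<in> B" "Y \<in> B" "Z \<in> B"
        and f: "\<guillemotleft>f : X \<rightarrow> Q\<guillemotright>"
        using arr_B_iff[OF _ Q] by (auto simp: inflation_def)
      note m1 = conflD[OF E1]
      obtain P j' f' q' where P: "P \<in> Obj C" and po: "is_pushout C X Y Q P j f j' f'"
        and E2: "(Q, j', P, q', Z) \<in> E"
        by (rule pushout_conflation[OF E1 f])
      note m2 = conflD[OF E2]
      note Po = pushoutD[OF po m1(1,2) m2(1,2)]
      have id: "\<guillemotleft>idm Q : Q \<rightarrow> Q\<guillemotright>" using m by simp
      obtain u t where u: "\<guillemotleft>u : P \<rightarrow> I\<guillemotright>" "u \<star> j' = i \<star> idm Q" and t: "\<guillemotleft>t : Z \<rightarrow> T\<guillemotright>" "t \<star> q' = p \<star> u"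
        by (rule conflation_extend[OF E2 I(3,2) id])
      obtain w where w: "\<guillemotleft>w : Z \<rightarrow> I\<guillemotright>" "p \<star> w = t"
        using bspec[OF v BB(3)] t(1) unfolding ext_vanishes_iff_lift[OF B_obj[OF BB(3)] I] by blast
      \<comment> \<open>The maps \<open>u\<close> and \<open>w \<star> q'\<close> agree after
        \<open>p\<close>, so they differ by a map \<open>r\<close> into \<open>Q\<close>. It
        restricts to the identity along \<open>j'\<close>, since \<open>q' \<star> j'\<close> is
        zero; composed with the pushout map \<open>f'\<close> this retraction extends
        \<open>f\<close> along \<open>j\<close>.\<close>
      have wq: "\<guillemotleft>w \<star> q' : P \<rightarrow> I\<guillemotright>" using w m2 by simp
      have "p \<star> w \<star> q' = t \<star> q'" using w(1) m(5) m2(5) by (simp add: comp_reassoc[OF w(2)])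
      then have "p \<star> (u \<boxminus> (w \<star> q')) = nul P T" using u(1) t wq m m2 by simp
      then obtain r where r: "\<guillemotleft>r : P \<rightarrow> Q\<guillemotright>" "i \<star> r = u \<boxminus> (w \<star> q')"
        by (rule confl_ker[OF I(3) plus_hom(4)[OF u(1) wq]])
      have "i \<star> r \<star> j' = (u \<boxminus> (w \<star> q')) \<star> j'"
        using r(1) m(4) m2(4) by (simp add: comp_reassoc[OF r(2)])
      also have "\<dots> = i \<star> idm Q" using u w(1) m2 m by simp
      finally have rj: "r \<star> j' = idm Q" by (rule confl_mono[OF I(3) comp_hom[OF m2(4) r(1)] id])
      have "(r \<star> f') \<star> j = r \<star> j' \<star> f" using r(1) Po(1-4) by (simp add: Po(5))
      also have "\<dots> = f" using r(1) Po(1-4) f by (simp add: comp_reassoc[OF rj])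
      finally show "\<exists>g\<in>arr C Y Q. g \<star> j = f" using homD[OF comp_hom[OF Po(4) r(1)]] by blast
    qed
  qed
qed

lemma projective_iff_injective_inherited:
  assumes "two_calabi_yau K C E"
  shows "projective D F Q \<longleftrightarrow> injective D F Q"
proof (cases "Q \<in> B")
  case True
  then show ?thesis
    using projective_inherited_iff injective_inherited_iff ext_vanishes_sym[OF assms] B_obj by blast
qed (simp add: projective_def injective_def)

lemma frobenius_inherited:
  assumes "two_calabi_yau K C E" "krull_schmidt_category K C" "functorially_finite C B"
  shows "frobenius_category K D F"
proof -
  interpret D: exact_category K D F by (rule exact_category_inherited)
  have "extension_closed_subcategory K C E B" by unfold_locales
  then show ?thesis
    using assms enough_projectives_inherited[of K C E B] enough_injectives_inherited[of K C E B]
      enough_proj enough_inj projective_iff_injective_inherited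
    by unfold_locales (auto simp: functorially_finite_def)
qed

end

section \<open>Linear isomorphisms, duals and finite dimension\<close>

lemma linear_iso_trans:
  assumes "linear_iso K M N f" "linear_iso K N P g"
  shows "linear_iso K M P (\<lambda>x. g (f x))"
proof -
  have "f x \<in> carrier N" if "x \<in> carrier M" for x
    using assms(1) that bij_betwE unfolding linear_iso_def by blast
  moreover have "bij_betw (g \<circ> f) (carrier M) (carrier P)"
    using assms bij_betw_trans unfolding linear_iso_def by blast
  ultimately show ?thesis using assms by (simp add: linear_iso_def comp_def)
qed

lemma linear_iso_inv:
  assumes "linear_iso K M N f" "module K M"
  shows "linear_iso K N M (inv_into (carrier M) f)"
proof -
  interpret M: module K M by fact
  let ?g = "inv_into (carrier M) f"
  have b: "bij_betw f (carrier M) (carrier N)" using assms by (simp add: linear_iso_def)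
  have g: "?g x \<in> carrier M" "f (?g x) = x" if "x \<in> carrier N" for x
    using that b bij_betw_imp_surj_on[OF b] by (auto intro: inv_into_into f_inv_into_f)
  have gf: "?g (f x) = x" if "x \<in> carrier M" for x
    using that b by (simp add: bij_betw_inv_into_left)
  have "?g (x \<oplus>\<^bsub>N\<^esub> y) = ?g x \<oplus>\<^bsub>M\<^esub> ?g y" if "x \<in> carrier N" "y \<in> carrier N" for x y
  proof -
    have "f (?g x \<oplus>\<^bsub>M\<^esub> ?g y) = x \<oplus>\<^bsub>N\<^esub> y" using assms(1) g that by (simp add: linear_iso_def)
    then show ?thesis using gf[of "?g x \<oplus>\<^bsub>M\<^esub> ?g y"] g that by simp
  qed
  moreover have "?g (c \<odot>\<^bsub>N\<^esub> x) = c \<odot>\<^bsub>M\<^esub> ?g x" if "c \<in> carrier K" "x \<in> carrier N" for c x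
  proof -
    have "f (c \<odot>\<^bsub>M\<^esub> ?g x) = c \<odot>\<^bsub>N\<^esub> x" using assms(1) g that by (simp add: linear_iso_def)
    then show ?thesis using gf[of "c \<odot>\<^bsub>M\<^esub> ?g x"] g that by simp
  qed
  ultimately show ?thesis using bij_betw_inv_into[OF b] by (simp add: linear_iso_def)
qed

lemma dual_comp_closed:
  assumes "linear_iso K N M g" "module K N" "\<phi> \<in> carrier (dual K M)"
  shows "(\<lambda>x\<in>carrier N. \<phi> (g x)) \<in> carrier (dual K N)"
proof -
  interpret N: module K N by fact
  have "g x \<in> carrier M" if "x \<in> carrier N" for x
    using assms(1) that bij_betwE unfolding linear_iso_def by blast
  then show ?thesis using assms(1,3) by (auto simp: dual_def linear_iso_def)
qed

text \<open>The transpose of the inverse of \<open>g\<close> inverts the transpose; functionals are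
  extensional, so both composites need to be compared on carriers only.\<close>

lemma linear_iso_dual:
  assumes g: "linear_iso K N M g" and N: "module K N" and M: "module K M"
  shows "linear_iso K (dual K M) (dual K N) (\<lambda>\<phi>. \<lambda>x\<in>carrier N. \<phi> (g x))"
proof -
  interpret N: module K N by fact
  interpret M: module K M by fact
  let ?h = "inv_into (carrier N) g"
  note h = linear_iso_inv[OF g N]
  have b: "bij_betw g (carrier N) (carrier M)" using g by (simp add: linear_iso_def)
  have gN: "g x \<in> carrier M" "?h (g x) = x" if "x \<in> carrier N" for x
    using that bij_betwE[OF b] bij_betw_inv_into_left[OF b] by blast+
  have hM: "?h x \<in> carrier N" "g (?h x) = x" if "x \<in> carrier M" for x
    using that bij_betwE[OF bij_betw_inv_into[OF b]] bij_betw_inv_into_right[OF b] by blast+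
  have ext: "(\<lambda>x\<in>carrier P. \<phi> x) = \<phi>" if "\<phi> \<in> carrier (dual K P)" for \<phi> :: "'c \<Rightarrow> 'a" and P
    using that by (auto simp: dual_def)
  have bij: "bij_betw (\<lambda>\<phi>. \<lambda>x\<in>carrier N. \<phi> (g x)) (carrier (dual K M)) (carrier (dual K N))"
  proof (rule bij_betwI[where g = "\<lambda>\<phi>. \<lambda>x\<in>carrier M. \<phi> (?h x)"])
    show "(\<lambda>\<phi>. \<lambda>x\<in>carrier N. \<phi> (g x)) \<in> carrier (dual K M) \<rightarrow> carrier (dual K N)"
      using dual_comp_closed[OF g N] by blast
    show "(\<lambda>\<phi>. \<lambda>x\<in>carrier M. \<phi> (?h x)) \<in> carrier (dual K N) \<rightarrow> carrier (dual K M)"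
      using dual_comp_closed[OF h M] by blast
    show "(\<lambda>x\<in>carrier M. (\<lambda>x\<in>carrier N. \<phi> (g x)) (?h x)) = \<phi>" if "\<phi> \<in> carrier (dual K M)" for \<phi>
    proof -
      have "\<phi> \<in> extensional (carrier M)" using that by (simp add: dual_def PiE_def)
      then show ?thesis using hM by (intro extensionalityI[of _ "carrier M"]) auto
    qed
    show "(\<lambda>x\<in>carrier N. (\<lambda>x\<in>carrier M. \<psi> (?h x)) (g x)) = \<psi>" if "\<psi> \<in> carrier (dual K N)" for \<psi>
    proof -
      have "\<psi> \<in> extensional (carrier N)" using that by (simp add: dual_def PiE_def)
      then show ?thesis using gN by (intro extensionalityI[of _ "carrier N"]) auto
    qed
  qed
  then show ?thesis unfolding linear_iso_def
    by (intro conjI ballI) (auto simp: dual_def gN intro!: restrict_ext)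
qed

lemma finite_dim_surj:
  assumes M: "module K M" and N: "module K N" and fin: "finite_dim K M"
    and h: "h ` carrier M = carrier N"
    and add: "\<And>x y. \<lbrakk>x \<in> carrier M; y \<in> carrier M\<rbrakk> \<Longrightarrow> h (x \<oplus>\<^bsub>M\<^esub> y) = h x \<oplus>\<^bsub>N\<^esub> h y"
    and smult: "\<And>c x. \<lbrakk>c \<in> carrier K; x \<in> carrier M\<rbrakk> \<Longrightarrow> h (c \<odot>\<^bsub>M\<^esub> x) = c \<odot>\<^bsub>N\<^esub> h x"
  shows "finite_dim K N"
proof -
  interpret M: module K M by fact
  interpret N: module K N by fact
  obtain S where S: "finite S" "S \<subseteq> carrier M"
    and span: "carrier M = {\<Oplus>\<^bsub>M\<^esub>s\<in>S. c s \<odot>\<^bsub>M\<^esub> s | c. c \<in> S \<rightarrow> carrier K}"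
    using fin unfolding finite_dim_def by blast
  let ?T = "h ` S"
  have hc: "h x \<in> carrier N" if "x \<in> carrier M" for x using that h by blast
  have T: "finite ?T" "?T \<subseteq> carrier N" using S hc by auto
  have h0: "h \<zero>\<^bsub>M\<^esub> = \<zero>\<^bsub>N\<^esub>"
    using smult[of "\<zero>\<^bsub>K\<^esub>" "\<zero>\<^bsub>M\<^esub>"] hc[of "\<zero>\<^bsub>M\<^esub>"] by simp
  have sub: "\<exists>d\<in>?T \<rightarrow> carrier K. h (\<Oplus>\<^bsub>M\<^esub>s\<in>S'. c s \<odot>\<^bsub>M\<^esub> s) = (\<Oplus>\<^bsub>N\<^esub>t\<in>?T. d t \<odot>\<^bsub>N\<^esub> t)"
    if c: "c \<in> S \<rightarrow> carrier K" and "S' \<subseteq> S" for c S'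
    using finite_subset[OF that(2) S(1)] that(2)
  proof (induction S' rule: finite_induct)
    case empty
    have "(\<Oplus>\<^bsub>N\<^esub>t\<in>?T. \<zero>\<^bsub>K\<^esub> \<odot>\<^bsub>N\<^esub> t) = (\<Oplus>\<^bsub>N\<^esub>t\<in>?T. \<zero>\<^bsub>N\<^esub>)"
      by (rule N.finsum_cong') (use T in auto)
    then show ?case using h0 by (intro bexI[of _ "\<lambda>_. \<zero>\<^bsub>K\<^esub>"]) auto
  next
    case (insert s S')
    then obtain d where d: "d \<in> ?T \<rightarrow> carrier K"
      "h (\<Oplus>\<^bsub>M\<^esub>s\<in>S'. c s \<odot>\<^bsub>M\<^esub> s) = (\<Oplus>\<^bsub>N\<^esub>t\<in>?T. d t \<odot>\<^bsub>N\<^esub> t)" by auto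
    have s: "s \<in> carrier M" "c s \<in> carrier K" "h s \<in> ?T" "h s \<in> carrier N" using insert S c hc by auto
    have cS: "(\<lambda>s. c s \<odot>\<^bsub>M\<^esub> s) \<in> S' \<rightarrow> carrier M"
      using insert(4) S(2) c by (intro funcsetI M.smult_closed) blast+
    \<comment> \<open>The map \<open>h\<close> may identify generators, so the new coefficient is
      added to the one already collected at \<open>h s\<close>.\<close>
    define d' where "d' = d(h s := d (h s) \<oplus>\<^bsub>K\<^esub> c s)"
    have d': "d' \<in> ?T \<rightarrow> carrier K" using d(1) s(2,3) unfolding d'_def by (auto simp: Pi_iff)
    have "h (\<Oplus>\<^bsub>M\<^esub>s\<in>insert s S'. c s \<odot>\<^bsub>M\<^esub> s) = h ((c s \<odot>\<^bsub>M\<^esub> s) \<oplus>\<^bsub>M\<^esub> (\<Oplus>\<^bsub>M\<^esub>s\<in>S'. c s \<odot>\<^bsub>M\<^esub> s))"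
      using insert s cS by (subst M.finsum_insert) auto
    also have "\<dots> = (c s \<odot>\<^bsub>N\<^esub> h s) \<oplus>\<^bsub>N\<^esub> (\<Oplus>\<^bsub>N\<^esub>t\<in>?T. d t \<odot>\<^bsub>N\<^esub> t)"
      using s M.finsum_closed[OF cS] by (simp add: add smult d(2))
    also have "c s \<odot>\<^bsub>N\<^esub> h s = (\<Oplus>\<^bsub>N\<^esub>t\<in>?T. if h s = t then c s \<odot>\<^bsub>N\<^esub> t else \<zero>\<^bsub>N\<^esub>)"
      by (rule N.finsum_singleton[OF s(3) T(1), of "\<lambda>t. c s \<odot>\<^bsub>N\<^esub> t", symmetric])
        (use T(2) s(2) in auto)
    also have "\<dots> \<oplus>\<^bsub>N\<^esub> (\<Oplus>\<^bsub>N\<^esub>t\<in>?T. d t \<odot>\<^bsub>N\<^esub> t)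
        = (\<Oplus>\<^bsub>N\<^esub>t\<in>?T. (if h s = t then c s \<odot>\<^bsub>N\<^esub> t else \<zero>\<^bsub>N\<^esub>) \<oplus>\<^bsub>N\<^esub> (d t \<odot>\<^bsub>N\<^esub> t))"
      by (rule N.finsum_addf[symmetric]) (use T s d in auto)
    also have "\<dots> = (\<Oplus>\<^bsub>N\<^esub>t\<in>?T. d' t \<odot>\<^bsub>N\<^esub> t)"
    proof (rule N.finsum_cong')
      show "(\<lambda>t. d' t \<odot>\<^bsub>N\<^esub> t) \<in> ?T \<rightarrow> carrier N" using d' T by auto
      fix t assume t: "t \<in> ?T"
      then have t': "t \<in> carrier N" "d t \<in> carrier K" using T d by auto
      show "(if h s = t then c s \<odot>\<^bsub>N\<^esub> t else \<zero>\<^bsub>N\<^esub>) \<oplus>\<^bsub>N\<^esub> (d t \<odot>\<^bsub>N\<^esub> t) = d' t \<odot>\<^bsub>N\<^esub> t"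
        using t' s by (auto simp: d'_def N.smult_l_distr N.a_comm)
    qed simp
    finally show ?case using d' by blast
  qed
  have "carrier N = {\<Oplus>\<^bsub>N\<^esub>t\<in>?T. d t \<odot>\<^bsub>N\<^esub> t | d. d \<in> ?T \<rightarrow> carrier K}"
  proof (intro equalityI subsetI)
    fix y assume "y \<in> carrier N"
    then obtain x where x: "x \<in> carrier M" "y = h x" using h by blast
    obtain c where c: "c \<in> S \<rightarrow> carrier K" "x = (\<Oplus>\<^bsub>M\<^esub>s\<in>S. c s \<odot>\<^bsub>M\<^esub> s)"
      using x(1) unfolding span by blast
    from sub[OF c(1) order_refl] x(2) c(2) show "y \<in> {\<Oplus>\<^bsub>N\<^esub>t\<in>?T. d t \<odot>\<^bsub>N\<^esub> t | d. d \<in> ?T \<rightarrow> carrier K}" by blast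
  next
    fix y assume "y \<in> {\<Oplus>\<^bsub>N\<^esub>t\<in>?T. d t \<odot>\<^bsub>N\<^esub> t | d. d \<in> ?T \<rightarrow> carrier K}"
    then obtain d where d: "d \<in> ?T \<rightarrow> carrier K" "y = (\<Oplus>\<^bsub>N\<^esub>t\<in>?T. d t \<odot>\<^bsub>N\<^esub> t)" by blast
    show "y \<in> carrier N" unfolding d(2) by (rule N.finsum_closed) (use d T in auto)
  qed
  then show ?thesis unfolding finite_dim_def using T by blast
qed

section \<open>Comparison of extensions\<close>

lemma (in frobenius_category) Ext1_map_class:
  assumes o: "A \<in> Obj C" "A' \<in> Obj C" "Y \<in> Obj C" "Y' \<in> Obj C"
    and a: "a \<in> arr C A' A" and x: "x \<in> arr C A (shift_obj C E Y)"
    and t: "t \<in> arr C (shift_obj C E Y) (shift_obj C E Y')"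
      "shift_arr C E Y Y' (cls Y Y' b) = cls (shift_obj C E Y) (shift_obj C E Y') t"
  shows "Ext1_map C E Y Y' (cls A' A a) (cls Y Y' b) (cls A (shift_obj C E Y) x)
    = cls A' (shift_obj C E Y') (t \<star> x \<star> a)"
proof -
  note s = shift_obj_closed[OF o(3)] shift_obj_closed[OF o(4)]
  have "x \<star> a \<in> arr C A' (shift_obj C E Y)" using comp_closed[OF o(2,1) s(1) a x] .
  then show ?thesis
    unfolding Ext1_map_def t(2) stable_comp[OF o(2,1) s(1) a x]
    using stable_comp[OF o(2) s _ t(1)] by simp
qed

section \<open>The comparison map between the two shifts\<close>

locale frobenius_pair = frobenius_subcategory +
  assumes DF: "frobenius_category K (full_subcat C B) (inherited_exact E B)"
begin

interpretation D: frobenius_category K D F by (rule DF)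

abbreviation dcls where "dcls \<equiv> stable_class D F"
abbreviation sC where "sC \<equiv> shift_obj C E"
abbreviation sD where "sD \<equiv> shift_obj D F"

lemma D_hom: "\<lbrakk>X \<in> B; Y \<in> B\<rbrakk> \<Longrightarrow> D.in_hom f X Y \<longleftrightarrow> \<guillemotleft>f : X \<rightarrow> Y\<guillemotright>"
  using D.arr_iff[of X Y f] arr_B_iff[of X Y f] unfolding full_subcat_simps by blast

lemma dcls_eq_iff:
  assumes "X \<in> B" "Y \<in> B" "\<guillemotleft>f : X \<rightarrow> Y\<guillemotright>" "\<guillemotleft>g : X \<rightarrow> Y\<guillemotright>"
  shows "dcls X Y f = dcls X Y g \<longleftrightarrow> f \<boxminus> g \<in> proj_maps D F X Y"
  using D.stable_class_eq_iff[of X Y f g] assms(1,2) homD[OF assms(3)] homD[OF assms(4)]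
    plus_hom(3)[OF assms(3,4)] unfolding full_subcat_simps by simp

lemma mem_dclsD:
  assumes "g \<in> dcls X Y f" "X \<in> B" "Y \<in> B" "\<guillemotleft>f : X \<rightarrow> Y\<guillemotright>"
  shows "\<guillemotleft>g : X \<rightarrow> Y\<guillemotright>" "g \<boxminus> f \<in> proj_maps D F X Y"
proof -
  have "f \<in> arr C X Y" using homD[OF assms(4)] by blast
  then have g: "g \<in> arr C X Y" "dcls X Y g = dcls X Y f"
    using D.mem_stable_class_iff[of X Y f g] assms(1-3) unfolding full_subcat_simps by blast+
  show g': "\<guillemotleft>g : X \<rightarrow> Y\<guillemotright>" using g(1) arr_B_iff assms by blast
  show "g \<boxminus> f \<in> proj_maps D F X Y" using g(2) dcls_eq_iff[OF assms(2,3) g' assms(4)] by blast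
qed

lemma dcls_self:
  assumes "X \<in> B" "Y \<in> B" "\<guillemotleft>f : X \<rightarrow> Y\<guillemotright>"
  shows "f \<in> dcls X Y f"
  using D.mem_stable_class_iff[of X Y f f] assms(1,2) homD[OF assms(3)] unfolding full_subcat_simps by blast

lemma stable_D_carrier: "\<lbrakk>X \<in> B; Y \<in> B\<rbrakk> \<Longrightarrow> arr (stable_cat D F) X Y = dcls X Y ` arr C X Y"
  using D.stable_carrier[of X Y] by simp

text \<open>A projective \<open>P\<close> of C is also injective in C, so a map from
  \<open>X\<close> to \<open>P\<close> extends along an embedding of \<open>X\<close> into an
  injective \<open>I\<close> of the subcategory. The factorisation through \<open>P\<close>, which
  may lie outside \<open>B\<close>, is thereby replaced by one through \<open>I\<close>.\<close>

lemma proj_maps_subset: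
  assumes "X \<in> B" "Y \<in> B"
  shows "proj_maps C E X Y \<subseteq> proj_maps D F X Y"
proof
  fix f assume "f \<in> proj_maps C E X Y"
  then obtain P g h where P: "projective C E P" "\<guillemotleft>g : X \<rightarrow> P\<guillemotright>" "\<guillemotleft>h : P \<rightarrow> Y\<guillemotright>" "f = h \<star> g"
    by (rule proj_mapsE[OF _ B_obj[OF assms(1)] B_obj[OF assms(2)]])
  obtain I i where I: "injective D F I" "inflation F X I i"
    using D.enough_inj assms(1) unfolding enough_injectives_def full_subcat_simps by blast
  then obtain p Z where E: "(X, i, I, p, Z) \<in> E" and IB: "I \<in> B" by (auto simp: inflation_def)
  note m = conflD[OF E]
  have "inflation E X I i" using E by (auto simp: inflation_def)
  then obtain g' where g': "\<guillemotleft>g' : I \<rightarrow> P\<guillemotright>" "g' \<star> i = g"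
    using injective_extend[OF _ _ P(2)] P(1) proj_iff_inj by blast
  have "f = (h \<star> g') \<star> i" using P g' m by simp
  moreover have "(h \<star> g') \<cdot>\<^bsub>D\<^esub> i \<in> proj_maps D F X Y"
    by (rule D.proj_mapsI[OF D.inj_proj[OF I(1)]])
      (use D_hom[OF assms(1) IB] D_hom[OF IB assms(2)] m(4) comp_hom[OF g'(1) P(3)] in blast)+
  ultimately show "f \<in> proj_maps D F X Y" by simp
qed

lemma D_proj_maps_iff_lift:
  assumes "injective D F I" "(Y, i, I, p, T) \<in> F" "A \<in> B"
  shows "f \<in> proj_maps D F A T \<longleftrightarrow> (\<exists>g. \<guillemotleft>g : A \<rightarrow> I\<guillemotright> \<and> p \<star> g = f)"
proof -
  have "deflation F I T p" "I \<in> B" using assms(2) by (auto simp: deflation_def)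
  then show ?thesis
    using D.proj_maps_iff_lift[OF D.inj_proj[OF assms(1)], of T p A f] D_hom[OF assms(3) \<open>I \<in> B\<close>] assms(3)
    unfolding full_subcat_simps by blast
qed

lemma D_inj_conflation:
  assumes "Y \<in> B"
  obtains i I p T where "inj_conflation D F Y = (i, I, p, T)" "sD Y = T" "injective D F I"
    "(Y, i, I, p, T) \<in> F" "(Y, i, I, p, T) \<in> E" "I \<in> B" "T \<in> B"
  using D.inj_conflation[of Y] assms by (metis full_subcat_simps(1) inherited_exact_iff)

lemma sD_B: "Y \<in> B \<Longrightarrow> sD Y \<in> B"
  by (erule D_inj_conflation) metis

text \<open>The comparison map from the shift in the subcategory to the shift in C: the identity of
  \<open>Y\<close> is extended to the two chosen injective conflations, and \<open>t\<close> is
  induced on the third terms. It is unique only up to maps through \<open>J\<close>, hence the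
  arbitrary choice of one.\<close>

definition comparison_data where
  "comparison_data Y t = (\<exists>i I p T j J q S u.
     inj_conflation D F Y = (i, I, p, T) \<and> inj_conflation C E Y = (j, J, q, S) \<and>
     \<guillemotleft>u : I \<rightarrow> J\<guillemotright> \<and> \<guillemotleft>t : T \<rightarrow> S\<guillemotright> \<and> u \<star> i = j \<and> t \<star> p = q \<star> u)"

definition comparison where "comparison Y = (SOME t. comparison_data Y t)"

lemma comparisonE:
  assumes "Y \<in> B"
  obtains i I p T j J q S u where
    "inj_conflation D F Y = (i, I, p, T)" "sD Y = T" "injective D F I" "(Y, i, I, p, T) \<in> F"
    "(Y, i, I, p, T) \<in> E" "I \<in> B" "T \<in> B"
    "inj_conflation C E Y = (j, J, q, S)" "sC Y = S" "injective C E J" "(Y, j, J, q, S) \<in> E"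
    "\<guillemotleft>u : I \<rightarrow> J\<guillemotright>" "\<guillemotleft>comparison Y : T \<rightarrow> S\<guillemotright>" "u \<star> i = j" "comparison Y \<star> p = q \<star> u"
proof -
  obtain i I p T where d: "inj_conflation D F Y = (i, I, p, T)" "sD Y = T" "injective D F I"
    "(Y, i, I, p, T) \<in> F" "(Y, i, I, p, T) \<in> E" "I \<in> B" "T \<in> B"
    by (rule D_inj_conflation[OF assms])
  obtain j J q S where c: "inj_conflation C E Y = (j, J, q, S)" "sC Y = S" "injective C E J"
    "(Y, j, J, q, S) \<in> E"
    by (rule inj_conflation[OF B_obj[OF assms]])
  have id: "\<guillemotleft>idm Y : Y \<rightarrow> Y\<guillemotright>" using B_obj[OF assms] by simp
  obtain u t where u: "\<guillemotleft>u : I \<rightarrow> J\<guillemotright>" "\<guillemotleft>t : T \<rightarrow> S\<guillemotright>" "u \<star> i = j \<star> idm Y" "t \<star> p = q \<star> u"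
    by (rule conflation_extend[OF d(5) c(4,3) id])
  have "u \<star> i = j" using u conflD(4)[OF c(4)] by simp
  then have "comparison_data Y t" unfolding comparison_data_def using d(1) c(1) u by blast
  then have "comparison_data Y (comparison Y)" unfolding comparison_def by (rule someI)
  then obtain u where "\<guillemotleft>u : I \<rightarrow> J\<guillemotright>" "\<guillemotleft>comparison Y : T \<rightarrow> S\<guillemotright>" "u \<star> i = j" "comparison Y \<star> p = q \<star> u"
    unfolding comparison_data_def d(1) c(1) prod.inject by blast
  with that[OF d c] show thesis by blast
qed

lemma comparison_hom: "Y \<in> B \<Longrightarrow> \<guillemotleft>comparison Y : sD Y \<rightarrow> sC Y\<guillemotright>"
  by (erule comparisonE) metis

text \<open>The map of conflations is the identity on \<open>Y\<close>, so its right-hand square has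
  the lifting property of a pullback: \<open>d\<close> lifts along \<open>p\<close> as soon as its
  image lifts along \<open>q\<close>. The two directions give injectivity and well-definedness of
  the comparison of Ext1.\<close>

lemma comparison_proj_iff:
  assumes A: "A \<in> B" and Y: "Y \<in> B" and d: "\<guillemotleft>d : A \<rightarrow> sD Y\<guillemotright>"
  shows "comparison Y \<star> d \<in> proj_maps C E A (sC Y) \<longleftrightarrow> d \<in> proj_maps D F A (sD Y)"
proof -
  obtain i I p T j J q S u where D: "inj_conflation D F Y = (i, I, p, T)" "sD Y = T" "injective D F I"
    "(Y, i, I, p, T) \<in> F" "(Y, i, I, p, T) \<in> E" "I \<in> B" "T \<in> B"
    and c: "inj_conflation C E Y = (j, J, q, S)" "sC Y = S" "injective C E J" "(Y, j, J, q, S) \<in> E"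
    and u: "\<guillemotleft>u : I \<rightarrow> J\<guillemotright>" "\<guillemotleft>comparison Y : T \<rightarrow> S\<guillemotright>" "u \<star> i = j" "comparison Y \<star> p = q \<star> u"
    by (rule comparisonE[OF Y])
  note m = conflD[OF D(5)] and m' = conflD[OF c(4)]
  note d = d[unfolded D(2)]
  have "deflation E J S q" using c(4) by (auto simp: deflation_def)
  then have C_iff: "f \<in> proj_maps C E A S \<longleftrightarrow> (\<exists>w. \<guillemotleft>w : A \<rightarrow> J\<guillemotright> \<and> q \<star> w = f)" for f
    by (rule proj_maps_iff_lift[OF inj_proj[OF c(3)] _ B_obj[OF A]])
  note D_iff = D_proj_maps_iff_lift[OF D(3,4) A]
  show ?thesis
    unfolding D(2) c(2)
  proof
    assume "d \<in> proj_maps D F A T"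
    then obtain g where g: "\<guillemotleft>g : A \<rightarrow> I\<guillemotright>" "p \<star> g = d" unfolding D_iff by blast
    have "q \<star> u \<star> g = (comparison Y \<star> p) \<star> g" unfolding u(4) using g(1) u(1) m' by simp
    also have "\<dots> = comparison Y \<star> d" using g u(2) m by simp
    finally show "comparison Y \<star> d \<in> proj_maps C E A S"
      unfolding C_iff using comp_hom[OF g(1) u(1)] by blast
  next
    assume "comparison Y \<star> d \<in> proj_maps C E A S"
    then obtain w where w: "\<guillemotleft>w : A \<rightarrow> J\<guillemotright>" "comparison Y \<star> d = q \<star> w" unfolding C_iff by metis
    obtain g where "\<guillemotleft>g : A \<rightarrow> I\<guillemotright>" "p \<star> g = d"
      by (rule conflation_map_lift[OF D(5) c(4) u(1,3,2,4) d w])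
    then show "d \<in> proj_maps D F A T" unfolding D_iff by blast
  qed
qed

text \<open>A map \<open>A \<rightarrow> Y[1]\<close> classifies an extension of \<open>A\<close> by \<open>Y\<close>, which lies in the subcategory.\<close>

lemma comparison_surj:
  assumes A: "A \<in> B" and Y: "Y \<in> B" and f: "\<guillemotleft>f : A \<rightarrow> sC Y\<guillemotright>"
  obtains f' where "\<guillemotleft>f' : A \<rightarrow> sD Y\<guillemotright>" "(comparison Y \<star> f') \<boxminus> f \<in> proj_maps C E A (sC Y)"
proof -
  obtain i I p T j J q S u where D: "inj_conflation D F Y = (i, I, p, T)" "sD Y = T" "injective D F I"
    "(Y, i, I, p, T) \<in> F" "(Y, i, I, p, T) \<in> E" "I \<in> B" "T \<in> B"
    and c: "inj_conflation C E Y = (j, J, q, S)" "sC Y = S" "injective C E J" "(Y, j, J, q, S) \<in> E"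
    and u: "\<guillemotleft>u : I \<rightarrow> J\<guillemotright>" "\<guillemotleft>comparison Y : T \<rightarrow> S\<guillemotright>" "u \<star> i = j" "comparison Y \<star> p = q \<star> u"
    by (rule comparisonE[OF Y])
  note m = conflD[OF D(5)] and m' = conflD[OF c(4)]
  note f = f[unfolded c(2)]
  obtain Z z g k where Z: "Z \<in> Obj C" and pb: "is_pullback C J S Z A q f z g"
    and E3: "(Y, k, Z, z, A) \<in> E" and gk: "g \<star> k = j"
    by (rule pullback_conflation[OF c(4) f])
  note Pb = pullbackD[OF pb m'(2,3) Z B_obj[OF A]] and m3 = conflD[OF E3]
  have ZB: "Z \<in> B" by (rule ext_closedD[OF E3 Y A])
  have F3: "(Y, k, Z, z, A) \<in> F" using E3 Y ZB A by simp
  have id: "D.in_hom (idm Y) Y Y" using D_hom[OF Y Y] B_obj[OF Y] by simp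
  \<comment> \<open>The extension classified by \<open>f\<close> is a conflation of the subcategory,
    so it also maps to the injective conflation chosen there; the induced map \<open>f'\<close>
    classifies the same extension in the subcategory.\<close>
  obtain v f' where v': "D.in_hom v Z I" "D.in_hom f' A T" "v \<cdot>\<^bsub>D\<^esub> k = i \<cdot>\<^bsub>D\<^esub> idm Y" "f' \<cdot>\<^bsub>D\<^esub> z = p \<cdot>\<^bsub>D\<^esub> v"
    by (rule D.conflation_extend[OF F3 D(4,3) id])
  have v: "\<guillemotleft>v : Z \<rightarrow> I\<guillemotright>" "\<guillemotleft>f' : A \<rightarrow> T\<guillemotright>"
    using v'(1,2) D_hom ZB D(6,7) A by blast+
  have vk: "v \<star> k = i" "f' \<star> z = p \<star> v" using v'(3,4) m by simp_all
  \<comment> \<open>Both \<open>u \<star> v\<close> and \<open>g\<close> extend \<open>j\<close>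
    along \<open>k\<close>. They induce the comparison of \<open>f'\<close> and the map
    \<open>f\<close> on \<open>A\<close>, which therefore differ by a map through
    \<open>J\<close>.\<close>
  have "(u \<star> v) \<star> k = u \<star> i" using u(1) v(1) m3 vk(1) by simp
  then have 1: "(u \<star> v) \<star> k = g \<star> k" unfolding gk u(3) .
  have "(comparison Y \<star> f') \<star> z = comparison Y \<star> p \<star> v" using u(2) v(2) m3 vk(2) by simp
  also have "\<dots> = q \<star> u \<star> v" using u(1,2) v(1) m m' by (simp add: comp_reassoc[OF u(4)])
  finally obtain w where w: "\<guillemotleft>w : A \<rightarrow> J\<guillemotright>" "(comparison Y \<star> f') \<boxminus> f = q \<star> w"
    by (rule conflation_extend_unique[OF E3 c(4) comp_hom[OF v(1) u(1)] Pb(4) 1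
          comp_hom[OF v(2) u(2)] f _ Pb(5)])
  have "(comparison Y \<star> f') \<boxminus> f \<in> proj_maps C E A S"
    unfolding w(2) by (rule proj_mapsI[OF inj_proj[OF c(3)] w(1) m'(5)])
  with v(2) show thesis by (intro that[of f'] ; simp only: D(2) c(2))
qed

text \<open>Both ways around the square come from maps \<open>I\<close> to \<open>J'\<close> that
  extend \<open>j' \<star> b\<close> along \<open>i\<close>, so they agree up to a map through the
  injective \<open>J'\<close>. Commutativity can be expected only modulo projectives, since each
  shift rests on arbitrary choices.\<close>

lemma comparison_natural:
  assumes Y: "Y \<in> B" "Y' \<in> B" and b: "\<guillemotleft>b : Y \<rightarrow> Y'\<guillemotright>"
  obtains tD tC where "\<guillemotleft>tD : sD Y \<rightarrow> sD Y'\<guillemotright>" "\<guillemotleft>tC : sC Y \<rightarrow> sC Y'\<guillemotright>"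
    "shift_arr D F Y Y' (dcls Y Y' b) = dcls (sD Y) (sD Y') tD"
    "shift_arr C E Y Y' (cls Y Y' b) = cls (sC Y) (sC Y') tC"
    "(comparison Y' \<star> tD) \<boxminus> (tC \<star> comparison Y) \<in> proj_maps C E (sD Y) (sC Y')"
proof -
  obtain i I p T j J q S u where D: "inj_conflation D F Y = (i, I, p, T)" "sD Y = T" "injective D F I"
    "(Y, i, I, p, T) \<in> F" "(Y, i, I, p, T) \<in> E" "I \<in> B" "T \<in> B"
    and c: "inj_conflation C E Y = (j, J, q, S)" "sC Y = S" "injective C E J" "(Y, j, J, q, S) \<in> E"
    and u: "\<guillemotleft>u : I \<rightarrow> J\<guillemotright>" "\<guillemotleft>comparison Y : T \<rightarrow> S\<guillemotright>" "u \<star> i = j" "comparison Y \<star> p = q \<star> u"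
    by (rule comparisonE[OF Y(1)])
  obtain i' I' p' T' j' J' q' S' u' where D': "inj_conflation D F Y' = (i', I', p', T')" "sD Y' = T'"
    "injective D F I'" "(Y', i', I', p', T') \<in> F" "(Y', i', I', p', T') \<in> E" "I' \<in> B" "T' \<in> B"
    and c': "inj_conflation C E Y' = (j', J', q', S')" "sC Y' = S'" "injective C E J'"
    "(Y', j', J', q', S') \<in> E"
    and u': "\<guillemotleft>u' : I' \<rightarrow> J'\<guillemotright>" "\<guillemotleft>comparison Y' : T' \<rightarrow> S'\<guillemotright>" "u' \<star> i' = j'" "comparison Y' \<star> p' = q' \<star> u'"
    by (rule comparisonE[OF Y(2)])
  note m = conflD[OF D(5)] and n = conflD[OF c(4)] and m' = conflD[OF D'(5)] and n' = conflD[OF c'(4)]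
  have bD: "D.in_hom b Y Y'" using D_hom[OF Y] b by blast
  obtain uD tD where dD: "D.in_hom uD I I'" "D.in_hom tD T T'" "uD \<cdot>\<^bsub>D\<^esub> i = i' \<cdot>\<^bsub>D\<^esub> b"
    "tD \<cdot>\<^bsub>D\<^esub> p = p' \<cdot>\<^bsub>D\<^esub> uD"
    by (rule D.conflation_extend[OF D(4) D'(4,3) bD])
  have d: "\<guillemotleft>uD : I \<rightarrow> I'\<guillemotright>" "\<guillemotleft>tD : T \<rightarrow> T'\<guillemotright>" "uD \<star> i = i' \<star> b" "tD \<star> p = p' \<star> uD"
    using dD D_hom D(6,7) D'(6,7) by simp_all
  obtain uC tC where e: "\<guillemotleft>uC : J \<rightarrow> J'\<guillemotright>" "\<guillemotleft>tC : S \<rightarrow> S'\<guillemotright>" "uC \<star> j = j' \<star> b" "tC \<star> q = q' \<star> uC"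
    by (rule conflation_extend[OF c(4) c'(4,3) b])
  have sD': "shift_arr D F Y Y' (dcls Y Y' b) = dcls T T' tD"
    by (rule D.shift_arr_class[OF D(1,4) D'(1,3,4) bD dD(1,3,2,4)])
  have sC': "shift_arr C E Y Y' (cls Y Y' b) = cls S S' tC"
    by (rule shift_arr_class[OF c(1,4) c'(1,3,4) b e(1,3,2,4)])
  have "(u' \<star> uD) \<star> i = j' \<star> b"
    using u'(1) d(1) m m' b d(3) by (simp add: comp_reassoc[OF u'(3)])
  moreover have "(uC \<star> u) \<star> i = j' \<star> b" using u(1,3) e(1,3) m by simp
  ultimately have 1: "(u' \<star> uD) \<star> i = (uC \<star> u) \<star> i" by simp
  have 2: "(comparison Y' \<star> tD) \<star> p = q' \<star> u' \<star> uD"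
    using u'(1,2) d(1,2,4) m m' n' by (simp add: comp_reassoc[OF u'(4)])
  have 3: "(tC \<star> comparison Y) \<star> p = q' \<star> uC \<star> u"
    using u(1,2,4) e(1,2) m n n' by (simp add: comp_reassoc[OF e(4)])
  obtain w where w: "\<guillemotleft>w : T \<rightarrow> J'\<guillemotright>" "(comparison Y' \<star> tD) \<boxminus> (tC \<star> comparison Y) = q' \<star> w"
    by (rule conflation_extend_unique[OF D(5) c'(4) comp_hom[OF d(1) u'(1)] comp_hom[OF u(1) e(1)] 1
          comp_hom[OF d(2) u'(2)] comp_hom[OF u(2) e(2)] 2 3])
  have "(comparison Y' \<star> tD) \<boxminus> (tC \<star> comparison Y) \<in> proj_maps C E T S'"
    unfolding w(2) by (rule proj_mapsI[OF inj_proj[OF c'(3)] w(1) n'(5)])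
  then show thesis
    by (intro that[of tD tC]) (use D(2) D'(2) c(2) c'(2) d(2) e(2) sD' sC' in simp_all)
qed

section \<open>The isomorphism of extension spaces and its naturality\<close>

definition ext_iso where
  "ext_iso A Y \<xi> = (\<Union>f\<in>\<xi>. cls A (sC Y) (comparison Y \<star> f))"

lemma ext_iso_class:
  assumes A: "A \<in> B" and Y: "Y \<in> B" and f: "\<guillemotleft>f : A \<rightarrow> sD Y\<guillemotright>"
  shows "ext_iso A Y (dcls A (sD Y) f) = cls A (sC Y) (comparison Y \<star> f)"
  unfolding ext_iso_def
proof (rule UN_constant_eq[OF dcls_self[OF A sD_B[OF Y] f]], rule ballI)
  fix g assume g: "g \<in> dcls A (sD Y) f"
  note g = mem_dclsD[OF g A sD_B[OF Y] f] and t = comparison_hom[OF Y]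
  have "comparison Y \<star> (g \<boxminus> f) \<in> proj_maps C E A (sC Y)"
    using g(2) comparison_proj_iff[OF A Y plus_hom(4)[OF g(1) f]] by blast
  then show "cls A (sC Y) (comparison Y \<star> g) = cls A (sC Y) (comparison Y \<star> f)"
    by (intro stable_class_eqI[OF comp_hom[OF g(1) t] comp_hom[OF f t]]) (use g(1) f t in simp)
qed

lemma Ext1_D_cases:
  assumes A: "A \<in> B" and Y: "Y \<in> B" and "\<xi> \<in> carrier (Ext1 D F A Y)"
  obtains f where "\<guillemotleft>f : A \<rightarrow> sD Y\<guillemotright>" "\<xi> = dcls A (sD Y) f"
  using assms(3) arr_B_iff[OF A sD_B[OF Y]] unfolding Ext1_def stable_D_carrier[OF A sD_B[OF Y]] by blast

lemma Ext1_D_class: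
  assumes A: "A \<in> B" and Y: "Y \<in> B" and "\<guillemotleft>f : A \<rightarrow> sD Y\<guillemotright>"
  shows "dcls A (sD Y) f \<in> carrier (Ext1 D F A Y)"
  using homD[OF assms(3)] unfolding Ext1_def stable_D_carrier[OF A sD_B[OF Y]] by blast

lemma Ext1_D_module: "\<lbrakk>A \<in> B; Y \<in> B\<rbrakk> \<Longrightarrow> module K (Ext1 D F A Y)"
  unfolding Ext1_def using D.stable_module[of A "sD Y"] sD_B by simp

lemma Ext1_C_module: "\<lbrakk>A \<in> B; Y \<in> B\<rbrakk> \<Longrightarrow> module K (Ext1 C E A Y)"
  unfolding Ext1_def using stable_module shift_obj_closed B_obj by blast

text \<open>Injectivity is the lifting half of \<open>comparison_proj_iff\<close>; surjectivity says
  that every extension in C of objects of \<open>B\<close> is one of the subcategory. Linearity is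
  bilinearity of composition with the comparison map.\<close>

lemma ext_iso_linear:
  assumes A: "A \<in> B" and Y: "Y \<in> B"
  shows "linear_iso K (Ext1 D F A Y) (Ext1 C E A Y) (ext_iso A Y)"
  unfolding linear_iso_def
proof (intro conjI ballI)
  note s = B_obj[OF A] shift_obj_closed[OF B_obj[OF Y]] and sd = A sD_B[OF Y] and t = comparison_hom[OF Y]
  have so: "sD Y \<in> Obj C" by (rule B_obj[OF sd(2)])
  note cl = ext_iso_class[OF A Y]
  have carrC: "carrier (Ext1 C E A Y) = cls A (sC Y) ` arr C A (sC Y)"
    unfolding Ext1_def by (rule stable_carrier[OF s])
  show "bij_betw (ext_iso A Y) (carrier (Ext1 D F A Y)) (carrier (Ext1 C E A Y))"
    unfolding bij_betw_def
  proof (intro conjI)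
    show "inj_on (ext_iso A Y) (carrier (Ext1 D F A Y))"
    proof (rule inj_onI)
      fix \<xi> \<eta> assume "\<xi> \<in> carrier (Ext1 D F A Y)" "\<eta> \<in> carrier (Ext1 D F A Y)"
        and eq: "ext_iso A Y \<xi> = ext_iso A Y \<eta>"
      then obtain f g where f: "\<guillemotleft>f : A \<rightarrow> sD Y\<guillemotright>" "\<xi> = dcls A (sD Y) f"
        and g: "\<guillemotleft>g : A \<rightarrow> sD Y\<guillemotright>" "\<eta> = dcls A (sD Y) g"
        using Ext1_D_cases[OF A Y] by metis
      have "cls A (sC Y) (comparison Y \<star> f) = cls A (sC Y) (comparison Y \<star> g)"
        using eq unfolding f(2) g(2) cl[OF f(1)] cl[OF g(1)] .
      from stable_class_eqD[OF this comp_hom[OF f(1) t] comp_hom[OF g(1) t]]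
      have "comparison Y \<star> (f \<boxminus> g) \<in> proj_maps C E A (sC Y)" using f(1) g(1) t by simp
      then have "f \<boxminus> g \<in> proj_maps D F A (sD Y)"
        using comparison_proj_iff[OF A Y plus_hom(4)[OF f(1) g(1)]] by blast
      then show "\<xi> = \<eta>" unfolding f(2) g(2) using dcls_eq_iff[OF sd f(1) g(1)] by blast
    qed
    show "ext_iso A Y ` carrier (Ext1 D F A Y) = carrier (Ext1 C E A Y)"
    proof (intro equalityI subsetI)
      fix \<eta> assume "\<eta> \<in> ext_iso A Y ` carrier (Ext1 D F A Y)"
      then obtain f where f: "\<guillemotleft>f : A \<rightarrow> sD Y\<guillemotright>" "\<eta> = ext_iso A Y (dcls A (sD Y) f)"
        using Ext1_D_cases[OF A Y] by blast
      show "\<eta> \<in> carrier (Ext1 C E A Y)"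
        unfolding f(2) cl[OF f(1)] carrC using homD[OF comp_hom[OF f(1) t]] by blast
    next
      fix \<eta> assume "\<eta> \<in> carrier (Ext1 C E A Y)"
      then obtain f where f: "f \<in> arr C A (sC Y)" "\<eta> = cls A (sC Y) f" unfolding carrC by blast
      note fm = homI[OF s f(1)]
      obtain f' where f': "\<guillemotleft>f' : A \<rightarrow> sD Y\<guillemotright>" "(comparison Y \<star> f') \<boxminus> f \<in> proj_maps C E A (sC Y)"
        by (rule comparison_surj[OF A Y fm])
      have "\<eta> = ext_iso A Y (dcls A (sD Y) f')"
        unfolding f(2) cl[OF f'(1)] by (rule stable_class_eqI[OF comp_hom[OF f'(1) t] fm f'(2), symmetric])
      then show "\<eta> \<in> ext_iso A Y ` carrier (Ext1 D F A Y)" using Ext1_D_class[OF A Y f'(1)] by blast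
    qed
  qed
  show "ext_iso A Y (\<xi> \<oplus>\<^bsub>Ext1 D F A Y\<^esub> \<eta>) = ext_iso A Y \<xi> \<oplus>\<^bsub>Ext1 C E A Y\<^esub> ext_iso A Y \<eta>"
    if \<xi>: "\<xi> \<in> carrier (Ext1 D F A Y)" and \<eta>: "\<eta> \<in> carrier (Ext1 D F A Y)" for \<xi> \<eta>
  proof -
    obtain f where f: "\<guillemotleft>f : A \<rightarrow> sD Y\<guillemotright>" "\<xi> = dcls A (sD Y) f" by (rule Ext1_D_cases[OF A Y \<xi>])
    obtain g where g: "\<guillemotleft>g : A \<rightarrow> sD Y\<guillemotright>" "\<eta> = dcls A (sD Y) g" by (rule Ext1_D_cases[OF A Y \<eta>])
    have fg: "f \<in> arr C A (sD Y)" "g \<in> arr C A (sD Y)" "comparison Y \<star> f \<in> arr C A (sC Y)"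
      "comparison Y \<star> g \<in> arr C A (sC Y)" "comparison Y \<in> arr C (sD Y) (sC Y)"
      using homD f(1) g(1) homD[OF comp_hom[OF f(1) t]] homD[OF comp_hom[OF g(1) t]] homD[OF t] by blast+
    have sum: "\<guillemotleft>f \<oplus>\<^bsub>Hom C A (sD Y)\<^esub> g : A \<rightarrow> sD Y\<guillemotright>"
      unfolding plus_hom(1)[OF f(1) g(1)] by (rule plus_hom(2)[OF f(1) g(1)])
    have "\<xi> \<oplus>\<^bsub>Ext1 D F A Y\<^esub> \<eta> = dcls A (sD Y) (f \<oplus>\<^bsub>Hom C A (sD Y)\<^esub> g)"
      unfolding f(2) g(2) Ext1_def using D.stable_add[of A "sD Y" f g] sd fg by simp
    then show ?thesis
      unfolding f(2) g(2) cl[OF f(1)] cl[OF g(1)]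
      using cl[OF sum] stable_add[OF s fg(3,4)] comp_add_right[OF s(1) so s(2) fg(1,2,5)]
      by (simp add: Ext1_def)
  qed
  show "ext_iso A Y (c \<odot>\<^bsub>Ext1 D F A Y\<^esub> \<xi>) = c \<odot>\<^bsub>Ext1 C E A Y\<^esub> ext_iso A Y \<xi>"
    if c: "c \<in> carrier K" and \<xi>: "\<xi> \<in> carrier (Ext1 D F A Y)" for c \<xi>
  proof -
    obtain f where f: "\<guillemotleft>f : A \<rightarrow> sD Y\<guillemotright>" "\<xi> = dcls A (sD Y) f" by (rule Ext1_D_cases[OF A Y \<xi>])
    have fa: "f \<in> arr C A (sD Y)" "comparison Y \<star> f \<in> arr C A (sC Y)" "comparison Y \<in> arr C (sD Y) (sC Y)"
      using homD f(1) homD[OF comp_hom[OF f(1) t]] homD[OF t] by blast+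
    have "c \<odot>\<^bsub>Ext1 D F A Y\<^esub> \<xi> = dcls A (sD Y) (c \<odot>\<^bsub>Hom C A (sD Y)\<^esub> f)"
      unfolding f(2) Ext1_def using D.stable_smult[of A "sD Y" f c] sd fa c by simp
    then show ?thesis
      unfolding f(2) cl[OF f(1)]
      using cl[OF smult_hom[OF f(1) c]] stable_smult[OF s fa(2) c] comp_smult_right[OF s(1) so s(2) fa(1,3) c]
      by (simp add: Ext1_def)
  qed
qed

text \<open>The comparison commutes with shifted maps up to maps through projectives. These are
  stable under composition with \<open>x \<star> a\<close>, so the discrepancy disappears in
  Ext1.\<close>

lemma Ext1_map_D:
  assumes A: "A \<in> B" "A' \<in> B" and Y: "Y \<in> B" "Y' \<in> B"
    and a: "\<guillemotleft>a : A' \<rightarrow> A\<guillemotright>" and b: "\<guillemotleft>b : Y \<rightarrow> Y'\<guillemotright>" and \<xi>: "\<xi> \<in> carrier (Ext1 D F A Y)"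
  shows "Ext1_map D F Y Y' (dcls A' A a) (dcls Y Y' b) \<xi> \<in> carrier (Ext1 D F A' Y')"
    and "ext_iso A' Y' (Ext1_map D F Y Y' (dcls A' A a) (dcls Y Y' b) \<xi>)
      = Ext1_map C E Y Y' (cls A' A a) (cls Y Y' b) (ext_iso A Y \<xi>)"
proof -
  obtain x where x: "\<guillemotleft>x : A \<rightarrow> sD Y\<guillemotright>" "\<xi> = dcls A (sD Y) x" by (rule Ext1_D_cases[OF A(1) Y(1) \<xi>])
  obtain tD tC where t: "\<guillemotleft>tD : sD Y \<rightarrow> sD Y'\<guillemotright>" "\<guillemotleft>tC : sC Y \<rightarrow> sC Y'\<guillemotright>"
    "shift_arr D F Y Y' (dcls Y Y' b) = dcls (sD Y) (sD Y') tD"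
    "shift_arr C E Y Y' (cls Y Y' b) = cls (sC Y) (sC Y') tC"
    "(comparison Y' \<star> tD) \<boxminus> (tC \<star> comparison Y) \<in> proj_maps C E (sD Y) (sC Y')"
    by (rule comparison_natural[OF Y b])
  note c = comparison_hom[OF Y(1)] and c' = comparison_hom[OF Y(2)]
  have arrs: "a \<in> arr C A' A" "x \<in> arr C A (sD Y)" "tD \<in> arr C (sD Y) (sD Y')"
    "tC \<in> arr C (sC Y) (sC Y')" "comparison Y \<star> x \<in> arr C A (sC Y)"
    using homD[OF a] homD[OF x(1)] homD[OF t(1)] homD[OF t(2)] homD[OF comp_hom[OF x(1) c]] by blast+
  have mD: "Ext1_map D F Y Y' (dcls A' A a) (dcls Y Y' b) \<xi> = dcls A' (sD Y') (tD \<star> x \<star> a)"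
    unfolding x(2) using D.Ext1_map_class[of A A' Y Y' a x tD b] A Y arrs t(3) by simp
  have mC: "Ext1_map C E Y Y' (cls A' A a) (cls Y Y' b) (ext_iso A Y \<xi>)
      = cls A' (sC Y') (tC \<star> (comparison Y \<star> x) \<star> a)"
    unfolding x(2) ext_iso_class[OF A(1) Y(1) x(1)]
    by (rule Ext1_map_class) (use A Y arrs t(4) B_obj in auto)
  have xa: "\<guillemotleft>x \<star> a : A' \<rightarrow> sD Y\<guillemotright>" by (rule comp_hom[OF a x(1)])
  have txa: "\<guillemotleft>tD \<star> x \<star> a : A' \<rightarrow> sD Y'\<guillemotright>" by (rule comp_hom[OF xa t(1)])
  show "Ext1_map D F Y Y' (dcls A' A a) (dcls Y Y' b) \<xi> \<in> carrier (Ext1 D F A' Y')"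
    unfolding mD by (rule Ext1_D_class[OF A(2) Y(2) txa])
  have m: "\<guillemotleft>comparison Y' \<star> tD \<star> x \<star> a : A' \<rightarrow> sC Y'\<guillemotright>" "\<guillemotleft>tC \<star> (comparison Y \<star> x) \<star> a : A' \<rightarrow> sC Y'\<guillemotright>"
    using comp_hom[OF txa c'] comp_hom[OF comp_hom[OF a comp_hom[OF x(1) c]] t(2)] by blast+
  have "((comparison Y' \<star> tD) \<boxminus> (tC \<star> comparison Y)) \<star> (x \<star> a) \<in> proj_maps C E A' (sC Y')"
    by (rule proj_maps_comp_right[OF t(5) shift_obj_closed[OF B_obj[OF Y(2)]] xa])
  then have "(comparison Y' \<star> tD \<star> x \<star> a) \<boxminus> (tC \<star> (comparison Y \<star> x) \<star> a) \<in> proj_maps C E A' (sC Y')"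
    using a x(1) t(1,2) c c' by simp
  then show "ext_iso A' Y' (Ext1_map D F Y Y' (dcls A' A a) (dcls Y Y' b) \<xi>)
      = Ext1_map C E Y Y' (cls A' A a) (cls Y Y' b) (ext_iso A Y \<xi>)"
    unfolding mD mC ext_iso_class[OF A(2) Y(2) txa] by (rule stable_class_eqI[OF m])
qed

text \<open>The new duality \<open>\<Psi>\<close> is \<open>\<Phi>\<close> conjugated by the
  comparison: the transpose \<open>T\<close> of \<open>\<tau>\<close> carries functionals over to C,
  \<open>\<Phi>\<close> is applied there, and \<open>\<tau>\<close> brings the result back.
  Naturality follows since the comparison commutes with the maps induced on Ext1.\<close>

lemma two_calabi_yau_inherited:
  assumes "two_calabi_yau K C E"
  shows "two_calabi_yau K D F"
proof -
  obtain \<Phi> where lin: "\<And>A Y. \<lbrakk>A \<in> Obj C; Y \<in> Obj C\<rbrakk> \<Longrightarrow>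
      linear_iso K (dual K (Ext1 C E A Y)) (Ext1 C E Y A) (\<Phi> A Y)"
    and nat: "\<And>A A' Y Y' a b \<phi>. \<lbrakk>A \<in> Obj C; A' \<in> Obj C; Y \<in> Obj C; Y' \<in> Obj C;
      a \<in> arr (stable_cat C E) A A'; b \<in> arr (stable_cat C E) Y' Y; \<phi> \<in> carrier (dual K (Ext1 C E A Y))\<rbrakk> \<Longrightarrow>
      \<Phi> A' Y' (\<lambda>\<xi>\<in>carrier (Ext1 C E A' Y'). \<phi> (Ext1_map C E Y' Y a b \<xi>))
        = Ext1_map C E A A' b a (\<Phi> A Y \<phi>)"
    using assms unfolding two_calabi_yau_def by metis
  define \<tau> where "\<tau> A Y = inv_into (carrier (Ext1 D F A Y)) (ext_iso A Y)" for A Y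
  have \<tau>: "linear_iso K (Ext1 C E A Y) (Ext1 D F A Y) (\<tau> A Y)" if "A \<in> B" "Y \<in> B" for A Y
    unfolding \<tau>_def by (rule linear_iso_inv[OF ext_iso_linear[OF that] Ext1_D_module[OF that]])
  have bij: "bij_betw (ext_iso A Y) (carrier (Ext1 D F A Y)) (carrier (Ext1 C E A Y))"
    if "A \<in> B" "Y \<in> B" for A Y
    using ext_iso_linear[OF that] unfolding linear_iso_def by blast
  have iso_closed: "ext_iso A Y \<xi> \<in> carrier (Ext1 C E A Y)"
    and \<tau>_iso: "\<tau> A Y (ext_iso A Y \<xi>) = \<xi>"
    if "A \<in> B" "Y \<in> B" "\<xi> \<in> carrier (Ext1 D F A Y)" for A Y \<xi>
    using bij_betwE[OF bij[OF that(1,2)]] bij_betw_inv_into_left[OF bij[OF that(1,2)]] that(3)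
    unfolding \<tau>_def by blast+
  have \<tau>_closed: "\<tau> A Y \<eta> \<in> carrier (Ext1 D F A Y)"
    and iso_\<tau>: "ext_iso A Y (\<tau> A Y \<eta>) = \<eta>"
    if "A \<in> B" "Y \<in> B" "\<eta> \<in> carrier (Ext1 C E A Y)" for A Y \<eta>
    using bij_betwE[OF bij_betw_inv_into[OF bij[OF that(1,2)]]]
      bij_betw_inv_into_right[OF bij[OF that(1,2)]] that(3) unfolding \<tau>_def by blast+
  define T where "T A Y \<phi> = (\<lambda>\<eta>\<in>carrier (Ext1 C E A Y). \<phi> (\<tau> A Y \<eta>))" for A Y and \<phi> :: "'d set \<Rightarrow> 'a"
  have T: "linear_iso K (dual K (Ext1 D F A Y)) (dual K (Ext1 C E A Y)) (T A Y)"
    if "A \<in> B" "Y \<in> B" for A Y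
    unfolding T_def by (rule linear_iso_dual[OF \<tau>[OF that] Ext1_C_module[OF that] Ext1_D_module[OF that]])
  define \<Psi> where "\<Psi> A Y \<phi> = \<tau> Y A (\<Phi> A Y (T A Y \<phi>))" for A Y \<phi>
  have "linear_iso K (dual K (Ext1 D F A Y)) (Ext1 D F Y A) (\<Psi> A Y)" if "A \<in> B" "Y \<in> B" for A Y
    unfolding \<Psi>_def
    by (rule linear_iso_trans[OF linear_iso_trans[OF T[OF that] lin[OF B_obj[OF that(1)] B_obj[OF that(2)]]]
          \<tau>[OF that(2,1)]])
  moreover have "\<Psi> A' Y' (\<lambda>\<xi>\<in>carrier (Ext1 D F A' Y'). \<phi> (Ext1_map D F Y' Y a b \<xi>))
      = Ext1_map D F A A' b a (\<Psi> A Y \<phi>)"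
    if AY: "A \<in> B" "A' \<in> B" "Y \<in> B" "Y' \<in> B" and a: "a \<in> arr (stable_cat D F) A A'"
      and b: "b \<in> arr (stable_cat D F) Y' Y" and \<phi>: "\<phi> \<in> carrier (dual K (Ext1 D F A Y))"
    for A A' Y Y' a b \<phi>
  proof -
    note o = AY[THEN B_obj]
    \<comment> \<open>A stable map of the subcategory has no well-defined class in C, because more
      maps may vanish in the subcategory. Any representative serves: on extensions of objects of
      \<open>B\<close>, the map it induces in C corresponds to the one induced by
      \<open>a\<close>.\<close>
    obtain a0 where a0: "a0 \<in> arr C A A'" "a = dcls A A' a0"
      using a unfolding stable_D_carrier[OF AY(1,2)] by blast
    obtain b0 where b0: "b0 \<in> arr C Y' Y" "b = dcls Y' Y b0"
      using b unfolding stable_D_carrier[OF AY(4,3)] by blast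
    note am = homI[OF o(1,2) a0(1)] and bm = homI[OF o(4,3) b0(1)]
    have ac: "cls A A' a0 \<in> arr (stable_cat C E) A A'" "cls Y' Y b0 \<in> arr (stable_cat C E) Y' Y"
      using stable_carrier[OF o(1,2)] stable_carrier[OF o(4,3)] a0(1) b0(1) by blast+
    have T\<phi>: "T A Y \<phi> \<in> carrier (dual K (Ext1 C E A Y))"
      using T[OF AY(1,3)] \<phi> bij_betwE unfolding linear_iso_def by blast
    have "T A' Y' (\<lambda>\<xi>\<in>carrier (Ext1 D F A' Y'). \<phi> (Ext1_map D F Y' Y a b \<xi>))
        = (\<lambda>\<eta>\<in>carrier (Ext1 C E A' Y'). T A Y \<phi> (Ext1_map C E Y' Y (cls A A' a0) (cls Y' Y b0) \<eta>))"
      unfolding T_def[of A' Y']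
    proof (rule restrict_ext)
      fix \<eta> assume \<eta>: "\<eta> \<in> carrier (Ext1 C E A' Y')"
      let ?\<xi> = "\<tau> A' Y' \<eta>"
      note \<xi> = \<tau>_closed[OF AY(2,4) \<eta>]
      \<comment> \<open>Every \<open>\<eta>\<close> is the image of
        \<open>\<tau> A' Y' \<eta>\<close> under the comparison, so the map induced on Ext1 in C can
        be computed in the subcategory.\<close>
      note m = Ext1_map_D[OF AY(2,1,4,3) am bm \<xi>, folded a0(2) b0(2)]
      have "Ext1_map C E Y' Y (cls A A' a0) (cls Y' Y b0) \<eta> = ext_iso A Y (Ext1_map D F Y' Y a b ?\<xi>)"
        using m(2) iso_\<tau>[OF AY(2,4) \<eta>] by simp
      then have "T A Y \<phi> (Ext1_map C E Y' Y (cls A A' a0) (cls Y' Y b0) \<eta>) = \<phi> (Ext1_map D F Y' Y a b ?\<xi>)"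
        unfolding T_def using iso_closed[OF AY(1,3) m(1)] \<tau>_iso[OF AY(1,3) m(1)] by simp
      then show "(\<lambda>\<xi>\<in>carrier (Ext1 D F A' Y'). \<phi> (Ext1_map D F Y' Y a b \<xi>)) ?\<xi>
          = T A Y \<phi> (Ext1_map C E Y' Y (cls A A' a0) (cls Y' Y b0) \<eta>)" using \<xi> by simp
    qed
    then have "\<Phi> A' Y' (T A' Y' (\<lambda>\<xi>\<in>carrier (Ext1 D F A' Y'). \<phi> (Ext1_map D F Y' Y a b \<xi>)))
        = Ext1_map C E A A' (cls Y' Y b0) (cls A A' a0) (\<Phi> A Y (T A Y \<phi>))"
      using nat[OF o ac T\<phi>] by simp
    also have "\<dots> = ext_iso Y' A' (Ext1_map D F A A' b a (\<Psi> A Y \<phi>))"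
    proof -
      have \<Phi>: "\<Phi> A Y (T A Y \<phi>) \<in> carrier (Ext1 C E Y A)"
        using lin[OF o(1,3)] T\<phi> bij_betwE unfolding linear_iso_def by blast
      have "\<Psi> A Y \<phi> \<in> carrier (Ext1 D F Y A)" "ext_iso Y A (\<Psi> A Y \<phi>) = \<Phi> A Y (T A Y \<phi>)"
        unfolding \<Psi>_def using \<tau>_closed[OF AY(3,1) \<Phi>] iso_\<tau>[OF AY(3,1) \<Phi>] by blast+
      with Ext1_map_D(2)[OF AY(3,4,1,2) bm am, of "\<Psi> A Y \<phi>"] a0(2) b0(2) show ?thesis by simp
    qed
    finally have eq: "\<Phi> A' Y' (T A' Y' (\<lambda>\<xi>\<in>carrier (Ext1 D F A' Y'). \<phi> (Ext1_map D F Y' Y a b \<xi>)))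
        = ext_iso Y' A' (Ext1_map D F A A' b a (\<Psi> A Y \<phi>))" .
    have \<Psi>c: "\<Psi> A Y \<phi> \<in> carrier (Ext1 D F Y A)"
      unfolding \<Psi>_def using lin[OF o(1,3)] T\<phi> bij_betwE
      by (intro \<tau>_closed[OF AY(3,1)]) (auto simp: linear_iso_def)
    have "Ext1_map D F A A' b a (\<Psi> A Y \<phi>) \<in> carrier (Ext1 D F Y' A')"
      using Ext1_map_D(1)[OF AY(3,4,1,2) bm am \<Psi>c] a0(2) b0(2) by simp
    then show ?thesis
      unfolding \<Psi>_def[of A' Y'] eq by (rule \<tau>_iso[OF AY(4,2)])
  qed
  ultimately show ?thesis
    unfolding two_calabi_yau_def full_subcat_simps by blast
qed

section \<open>Finiteness of the stable morphism spaces\<close>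

lemma hom_finite_inherited:
  assumes "hom_finite K (stable_cat C E)"
  shows "hom_finite K (stable_cat D F)"
  unfolding hom_finite_def
proof (intro ballI)
  fix X Y assume "X \<in> Obj (stable_cat D F)" "Y \<in> Obj (stable_cat D F)"
  then have B: "X \<in> B" "Y \<in> B" by (simp_all add: stable_cat_simps)
  note o = B[THEN B_obj]
  \<comment> \<open>Enlarging a coset modulo maps through projectives of C to a coset modulo those
    of the subcategory. This is well defined by \<open>proj_maps_subset\<close>, and it is a linear
    surjection, so finite generation passes to the target.\<close>
  define h where "h U = (\<Union>f\<in>U. dcls X Y f)" for U
  have h: "h (cls X Y f) = dcls X Y f" if f: "f \<in> arr C X Y" for f
    unfolding h_def
  proof (rule UN_constant_eq)
    note fm = homI[OF o f]
    show "f \<in> cls X Y f" using mem_stable_class_iff[OF o f] f by blast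
    show "\<forall>g\<in>cls X Y f. dcls X Y g = dcls X Y f"
    proof
      fix g assume g: "g \<in> cls X Y f"
      note g = mem_stable_classD[OF g fm]
      show "dcls X Y g = dcls X Y f"
        using dcls_eq_iff[OF B g(1) fm] proj_maps_subset[OF B] g(2) by blast
    qed
  qed
  note carrC = stable_carrier[OF o] and carrD = stable_D_carrier[OF B]
  interpret M: module K "Hom C X Y" by (rule hom_module[OF o])
  show "finite_dim K (Hom (stable_cat D F) X Y)"
  proof (rule finite_dim_surj[where h = h])
    show "module K (Hom (stable_cat C E) X Y)" by (rule stable_module[OF o])
    show "module K (Hom (stable_cat D F) X Y)" using D.stable_module[of X Y] B by simp
    show "finite_dim K (Hom (stable_cat C E) X Y)"
      using assms o unfolding hom_finite_def stable_cat_simps by blast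
    show "h ` arr (stable_cat C E) X Y = arr (stable_cat D F) X Y"
      unfolding carrC carrD image_image using h by (intro image_cong) auto
    show "h (U \<oplus>\<^bsub>Hom (stable_cat C E) X Y\<^esub> V) = h U \<oplus>\<^bsub>Hom (stable_cat D F) X Y\<^esub> h V"
      if U: "U \<in> arr (stable_cat C E) X Y" and V: "V \<in> arr (stable_cat C E) X Y" for U V
    proof -
      obtain f where f: "f \<in> arr C X Y" "U = cls X Y f" using U unfolding carrC by blast
      obtain g where g: "g \<in> arr C X Y" "V = cls X Y g" using V unfolding carrC by blast
      show ?thesis
        unfolding f(2) g(2) stable_add[OF o f(1) g(1)]
        using h f(1) g(1) D.stable_add[of X Y f g] B by simp
    qed
    show "h (c \<odot>\<^bsub>Hom (stable_cat C E) X Y\<^esub> U) = c \<odot>\<^bsub>Hom (stable_cat D F) X Y\<^esub> h U"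
      if c: "c \<in> carrier K" and U: "U \<in> arr (stable_cat C E) X Y" for c U
    proof -
      obtain f where f: "f \<in> arr C X Y" "U = cls X Y f" using U unfolding carrC by blast
      show ?thesis
        unfolding f(2) stable_smult[OF o f(1) c]
        using h f(1) c D.stable_smult[of X Y f c] B by simp
    qed
  qed
qed

end

theorem theorem1p2p6:
  fixes K :: "('k, 'x) ring_scheme"
    and C :: "('k, 'o, 'm) k_cat"
    and E :: "('o, 'm) exact_str"
    and B :: "'o set"
  assumes "algebraically_closed K"
    and "stably_2CY_category K C E"
    and "subcategory C B"
    and "functorially_finite C B"
    and "extension_closed E B"
  shows "enough_projectives (full_subcat C B) (inherited_exact E B) \<and>
         enough_injectives (full_subcat C B) (inherited_exact E B) \<and>
         stably_2CY_category K (full_subcat C B) (inherited_exact E B)"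
proof -
  interpret stably_2CY_category K C E by fact
  interpret frobenius_subcategory K C E B
    by unfold_locales (use assms in auto)
  have ks: "krull_schmidt_category K C" by unfold_locales
  have fr: "frobenius_category K (full_subcat C B) (inherited_exact E B)"
    by (rule frobenius_inherited[OF stable_2CY ks assms(4)])
  have fp: "frobenius_pair K C E B"
    by (intro frobenius_pair.intro frobenius_pair_axioms.intro fr frobenius_subcategory_axioms)
  have "stably_2CY_category K (full_subcat C B) (inherited_exact E B)"
    by (intro stably_2CY_category.intro stably_2CY_category_axioms.intro fr
        krull_schmidt_category_full_subcat[OF ks assms(3)]
        frobenius_pair.hom_finite_inherited[OF fp stable_hom_finite]
        frobenius_pair.two_calabi_yau_inherited[OF fp stable_2CY])
  then show ?thesis
    using frobenius_category.enough_proj[OF fr] frobenius_category.enough_inj[OF fr] by blast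
qed

end
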